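(* Let $\sigma\in S_n$ and $\pi\in\mathcal P(n)$ with $\pi\ge\Pi(\sigma)$. Then $$\varphi(\pi,\sigma)[\vec b]=\sum_{\substack{\tau\in S_n\\ g(\sigma,\tau^{-1})=0}}\ \sum_{\substack{\pi'\in\mathcal P(n),\ \pi\ge\pi'\ge\Pi(\tau)\\ \pi'\vee\Pi(\sigma)=\pi\\ L[\pi',\,\Pi(\sigma)\vee\Pi(\tau)\,;\,\Pi(\tau)]=0}}\kappa(\pi',\tau)[\vec b],$$ and $$\kappa(\pi,\sigma)[\vec b]=\sum_{\substack{\tau\in S_n\\ g(\sigma,\tau^{-1})=0}}\ \sum_{\substack{\pi'\in\mathcal P(n),\ \pi\ge\pi'\ge\Pi(\tau)\\ L[\pi',\,\Pi(\sigma)\vee\Pi(\tau)\,;\,\Pi(\tau)]=0}}\varphi(\pi',\tau)[\vec b]\ \Gamma\bigl[\sigma\tau^{-1},\pi,\pi'\vee\Pi(\sigma)\bigr],$$ where, for $\nu\in S_n$ and $\pi\ge\tilde\pi\ge\Pi(\nu)$, $$\Gamma[\nu,\pi,\tilde\pi]=\sum_{\substack{\pi''\in\mathcal P(n),\ \pi''\ge\Pi(\nu)\\ \tilde\pi\vee\pi''=\pi\\ L[\pi'',\,\tilde\pi\,;\,\Pi(\nu)]=0}}\ \prod_{G\in\pi''}\gamma(\nu_{|G}).$$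
   Context: **Permutations and partitions.** $\mathcal P(n)$ is the set of partitions of $\{1,\dots,n\}$, ordered by refinement ($\pi'\le\pi$ if every block of $\pi'$ is contained in a block of $\pi$), with join $\vee$; $\#(\pi)$ is the number of blocks. For $\sigma\in S_n$, $\#(\sigma)$ is its number of cycles (fixed points included), $\Pi(\sigma)\in\mathcal P(n)$ the partition into cycles, $\sigma_{|G}$ its restriction to a union $G$ of cycles, regarded as an element of $S_{|G|}$. The genus $g(\sigma_1,\sigma_2)\ge0$ is defined by $$\#(\sigma_1)+\#(\sigma_2)+\#(\sigma_1\sigma_2)-n=2\#(\Pi(\sigma_1)\vee\Pi(\sigma_2))-2g(\sigma_1,\sigma_2).$$ For $\pi_1,\pi_2\ge\rho$ in $\mathcal P(n)$, $L[\pi_1,\pi_2;\rho]=\#(\rho)-\#(\pi_1)-\#(\pi_2)+\#(\pi_1\vee\pi_2)\ (\ge0)$. **Rescaled monotone Hurwitz numbers.** For $\nu\in S_m$ with $d_q(\nu)$ cycles of length $q$, $$\gamma(\nu)=(-1)^{\#(\nu)+m}\,\frac{(2m+\#(\nu)-3)!}{(2m)!}\prod_{q\ge1}\Bigl[\frac{(2q)!}{q!(q-1)!}\Bigr]^{d_q(\nu)}.$$ **Higher order moments and free cumulants.** $\vec B=(B_1,\dots,B_n)$ are $N\times N$ random matrices for each $N$. $\mathrm{Tr}$ is the unnormalized trace, $k_m$ the $m$-th classical joint cumulant. For $\pi\ge\Pi(\tau)$, $$\varphi(\pi,\tau)[\vec B]=\prod_{G\in\pi}k_{\#(\tau_{|G})}\bigl(\{\mathrm{Tr}(B_{j_1}\cdots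 B_{j_r})\}_{(j_1\cdots j_r)\text{ cycle of }\tau_{|G}}\bigr),$$ and for $\pi\ge\Pi(\sigma)$ $$\kappa(\pi,\sigma)[\vec B]=\sum_{\tau\in S_n}\ \sum_{\pi\ge\pi'\ge\Pi(\tau)}\varphi(\pi',\tau)[\vec B]\sum_{\pi\ge\pi''\ge\Pi(\sigma)\vee\pi'}\lambda_{\pi'',\pi}\prod_{G\in\pi''}W^{(N)}\bigl((\sigma\tau^{-1})_{|G}\bigr),$$ where $\lambda_{\pi'',\pi}$ is the Möbius function of the lattice of partitions and $W^{(N)}$ the unitary Weingarten function (for $N\ge n$, the convolution inverse on $S_n$ of $\nu\mapsto N^{\#(\nu)}$). It is assumed that the limits $\varphi(\pi,\sigma)[\vec b]=\lim_{N\to\infty}N^{\#(\sigma)-2\#(\pi)}\varphi(\pi,\sigma)[\vec B]$ exist; the higher order free cumulants are $\kappa(\pi,\sigma)[\vec b]=\lim_{N\to\infty}N^{\#(\sigma)+n-2\#(\pi)}\kappa(\pi,\sigma)[\vec B]$. *)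

theory Defs
  imports
    "HOL-Probability.Probability"
    "HOL-Combinatorics.Combinatorics"
    "Jordan_Normal_Form.Matrix"
begin

section \<open>Set partitions\<close>

text \<open>Partitions are ordered by \<^const>\<open>refines\<close>. The join of two partitions consists of the
  classes of the transitive closure of ``lying in a common block of one of them''.\<close>

definition part_join :: "'a set set \<Rightarrow> 'a set set \<Rightarrow> 'a set set" where
  "part_join P Q = (\<Union>P) // ({(x, y). \<exists>B\<in>P \<union> Q. x \<in> B \<and> y \<in> B}\<^sup>+)"

lemma equiv_part_join:
  assumes "partition_on A P" "partition_on A Q"
  shows "equiv A ({(x, y). \<exists>B\<in>P \<union> Q. x \<in> B \<and> y \<in> B}\<^sup>+)" (is "equiv A (?r\<^sup>+)")
proof (rule equivI)
  have sub: "?r \<subseteq> A \<times> A" using assms by (auto simp: partition_on_def)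
  then show "?r\<^sup>+ \<subseteq> A \<times> A" by (rule trancl_subset_Sigma)
  show "refl_on A (?r\<^sup>+)"
    using assms by (auto simp: refl_on_def partition_on_def)
  show "sym (?r\<^sup>+)" by (intro sym_trancl) (auto simp: sym_def)
  show "trans (?r\<^sup>+)" by simp
qed

lemma partition_on_part_join:
  assumes "partition_on A P" "partition_on A Q"
  shows "partition_on A (part_join P Q)"
  using partition_on_quotient[OF equiv_part_join[OF assms]] assms(1)
  by (simp add: part_join_def partition_on_def)

lemma refines_part_join:
  assumes "partition_on A P" "partition_on A Q"
  shows "refines A P (part_join P Q)" and "refines A Q (part_join P Q)"
proof -
  let ?r = "{(x, y). \<exists>B\<in>P \<union> Q. x \<in> B \<and> y \<in> B}"
  have "\<exists>Y\<in>part_join P Q. X \<subseteq> Y" if X: "X \<in> P \<union> Q" for X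
  proof -
    have "X \<noteq> {}" and XA: "X \<subseteq> A" using X assms by (auto simp: partition_on_def)
    then obtain x where x: "x \<in> X" by auto
    have "X \<subseteq> ?r\<^sup>+ `` {x}" using X x by auto
    moreover have "?r\<^sup>+ `` {x} \<in> part_join P Q"
      using x XA assms(1) by (auto simp: part_join_def partition_on_def intro: quotientI)
    ultimately show ?thesis by blast
  qed
  then show "refines A P (part_join P Q)" and "refines A Q (part_join P Q)"
    using assms partition_on_part_join[OF assms] by (auto simp: refines_def)
qed

lemma part_join_least:
  assumes "refines A P R" "refines A Q R"
  shows "refines A (part_join P Q) R"
proof -
  let ?r = "{(x, y). \<exists>B\<in>P \<union> Q. x \<in> B \<and> y \<in> B}"
  have P: "partition_on A P" and Q: "partition_on A Q" and R: "partition_on A R"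
    using assms by (auto simp: refines_def)
  have step: "y \<in> Y" if "(x, y) \<in> ?r" "x \<in> Y" "Y \<in> R" for x y Y
  proof -
    obtain B where B: "B \<in> P \<union> Q" "x \<in> B" "y \<in> B" using \<open>(x, y) \<in> ?r\<close> by auto
    then obtain Z where Z: "Z \<in> R" "B \<subseteq> Z" using assms by (auto simp: refines_def)
    have "Z = Y"
      using R Z B that by (auto simp: partition_on_def disjoint_def)
    then show ?thesis using Z B by auto
  qed
  have closed: "y \<in> Y" if "(x, y) \<in> ?r\<^sup>+" "x \<in> Y" "Y \<in> R" for x y Y
    using that(1,2) by (induction rule: trancl_induct) (use step that(3) in blast)+
  have "\<exists>Y\<in>R. X \<subseteq> Y" if "X \<in> part_join P Q" for X
  proof -
    have "X \<in> A // (?r\<^sup>+)" using that P by (simp add: part_join_def partition_on_def)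
    then obtain x where x: "x \<in> A" "X = ?r\<^sup>+ `` {x}" by (rule quotientE)
    then obtain Y where "Y \<in> R" "x \<in> Y" using R by (auto simp: partition_on_def)
    then show ?thesis using x closed by blast
  qed
  then show ?thesis using R partition_on_part_join[OF P Q] by (auto simp: refines_def)
qed

text \<open>The Moebius function of the lattice of partitions of a finite set.\<close>

function part_mobius :: "'a set \<Rightarrow> 'a set set \<Rightarrow> 'a set set \<Rightarrow> int" where
  "part_mobius A P Q =
    (if \<not> finite A \<or> \<not> refines A P Q then 0
     else if P = Q then 1
     else - (\<Sum>R | refines A P R \<and> refines A R Q \<and> R \<noteq> Q. part_mobius A P R))"
  by auto
termination
proof (relation "Wellfounded.measure (\<lambda>(A, P, Q). card {R. refines A R Q})")
  fix A :: "'a set" and P Q R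
  assume *: "\<not> (\<not> finite A \<or> \<not> refines A P Q)"
    and R: "R \<in> {R. refines A P R \<and> refines A R Q \<and> R \<noteq> Q}"
  have "finite {R. refines A R Q}"
    using * by (auto intro: finite_subset[OF _ finitely_many_partition_on[of A]]
        simp: refines_def)
  moreover have "{S. refines A S R} \<subset> {S. refines A S Q}"
  proof
    show "{S. refines A S R} \<subseteq> {S. refines A S Q}"
      using R refines_trans[of A _ R Q] by blast
    have "refines A Q Q" using * by (auto simp: refines_def)
    moreover have "\<not> refines A Q R" using R refines_asym[of A R Q] by blast
    ultimately show "{S. refines A S R} \<noteq> {S. refines A S Q}" by blast
  qed
  ultimately show "((A, P, R), (A, P, Q)) \<in> Wellfounded.measure (\<lambda>(A, P, Q). card {R. refines A R Q})"
    by (auto intro: psubset_card_mono)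
qed simp

declare part_mobius.simps [simp del]

definition part_L :: "'a set set \<Rightarrow> 'a set set \<Rightarrow> 'a set set \<Rightarrow> int" where
  "part_L P Q R = int (card R) - int (card P) - int (card Q) + int (card (part_join P Q))"


section \<open>Permutations\<close>

text \<open>Permutations of a finite set \<open>A\<close> are functions that satisfy \<open>\<sigma> permutes A\<close>. For \<open>\<sigma>\<close> that maps
  the finite set \<open>A\<close> bijectively to itself, \<open>cyc A \<sigma>\<close> is the partition of \<open>A\<close> into cycles (fixed
  points included). If \<open>G\<close> is a union of cycles of \<open>\<sigma>\<close>, then \<open>cyc G \<sigma>\<close> is the set of cycles of the
  restriction of \<open>\<sigma>\<close> to \<open>G\<close>. This restriction, \<open>perm_restrict \<sigma> G\<close>, is not relabelled to a permutation
  of \<open>{1..card G}\<close>; instead, functions on symmetric groups take the underlying finite set as an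
  argument.\<close>

definition cyc :: "'a set \<Rightarrow> ('a \<Rightarrow> 'a) \<Rightarrow> 'a set set" where
  "cyc A \<sigma> = orbit \<sigma> ` A"

text \<open>The prefix notation \<open>inv\<close> is taken by HOL-Algebra.\<close>

abbreviation perm_inv :: "('a \<Rightarrow> 'a) \<Rightarrow> 'a \<Rightarrow> 'a" where
  "perm_inv \<sigma> \<equiv> inv_into UNIV \<sigma>"

text \<open>The solution \<open>g\<close> of
  \<open>#(\<sigma>\<^sub>1) + #(\<sigma>\<^sub>2) + #(\<sigma>\<^sub>1 \<sigma>\<^sub>2) - |A| = 2 #(\<Pi>(\<sigma>\<^sub>1) \<or> \<Pi>(\<sigma>\<^sub>2)) - 2 g\<close>; it is real valued, so that no rounding
  is involved in the division by 2.\<close>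

definition genus :: "'a set \<Rightarrow> ('a \<Rightarrow> 'a) \<Rightarrow> ('a \<Rightarrow> 'a) \<Rightarrow> real" where
  "genus A \<sigma>\<^sub>1 \<sigma>\<^sub>2 =
    (2 * real (card (part_join (cyc A \<sigma>\<^sub>1) (cyc A \<sigma>\<^sub>2)))
      - (real (card (cyc A \<sigma>\<^sub>1)) + real (card (cyc A \<sigma>\<^sub>2)) + real (card (cyc A (\<sigma>\<^sub>1 \<circ> \<sigma>\<^sub>2)))
          - real (card A))) / 2"

text \<open>For \<open>N \<ge> card A\<close>, \<open>weingarten N A\<close> is the convolution inverse of \<open>\<nu> \<mapsto> N ^ #(\<nu>)\<close> on the symmetric
  group of \<open>A\<close>, extended by 0. It is not specified for smaller \<open>N\<close>.\<close>

definition perm_convolution ::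
    "'a set \<Rightarrow> (('a \<Rightarrow> 'a) \<Rightarrow> real) \<Rightarrow> (('a \<Rightarrow> 'a) \<Rightarrow> real) \<Rightarrow> ('a \<Rightarrow> 'a) \<Rightarrow> real" where
  "perm_convolution A f g \<nu> = (\<Sum>\<tau> | \<tau> permutes A. f \<tau> * g (perm_inv \<tau> \<circ> \<nu>))"

definition weingarten :: "nat \<Rightarrow> 'a set \<Rightarrow> ('a \<Rightarrow> 'a) \<Rightarrow> real" where
  "weingarten N A = (THE w.
    (\<forall>\<nu>. \<not> \<nu> permutes A \<longrightarrow> w \<nu> = 0) \<and>
    (\<forall>\<nu>. \<nu> permutes A \<longrightarrow>
      perm_convolution A w (\<lambda>\<tau>. real N ^ card (cyc A \<tau>)) \<nu> = (if \<nu> = id then 1 else 0)))"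

text \<open>Rescaled monotone Hurwitz numbers. Cycle lengths above \<open>card A\<close> contribute the factor 1, and
  the subtraction of 3 does not truncate when \<open>A\<close> is nonempty.\<close>

definition hurwitz_gamma :: "'a set \<Rightarrow> ('a \<Rightarrow> 'a) \<Rightarrow> real" where
  "hurwitz_gamma A \<nu> =
    (-1) ^ (card (cyc A \<nu>) + card A)
    * (fact (2 * card A + card (cyc A \<nu>) - 3) / fact (2 * card A))
    * (\<Prod>q = 1..card A. (fact (2 * q) / (fact q * fact (q - 1))) ^ card {C \<in> cyc A \<nu>. card C = q})"

definition Gamma_coeff :: "'a set \<Rightarrow> ('a \<Rightarrow> 'a) \<Rightarrow> 'a set set \<Rightarrow> 'a set set \<Rightarrow> real" where
  "Gamma_coeff A \<nu> \<pi> \<rho> =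
    (\<Sum>\<pi>'' | refines A (cyc A \<nu>) \<pi>'' \<and> part_join \<rho> \<pi>'' = \<pi> \<and> part_L \<pi>'' \<rho> (cyc A \<nu>) = 0.
      \<Prod>G\<in>\<pi>''. hurwitz_gamma G (perm_restrict \<nu> G))"


section \<open>Random matrices and their higher order moments and free cumulants\<close>

definition random_matrix :: "'w measure \<Rightarrow> nat \<Rightarrow> ('w \<Rightarrow> complex mat) \<Rightarrow> bool" where
  "random_matrix M N X \<longleftrightarrow>
    (\<forall>\<omega>\<in>space M. X \<omega> \<in> carrier_mat N N) \<and>
    (\<forall>i<N. \<forall>j<N. (\<lambda>\<omega>. X \<omega> $$ (i, j)) \<in> borel_measurable M)"

text \<open>The classical joint cumulant of the finite family \<open>(X i)\<close>, \<open>i \<in> I\<close>.\<close>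

definition joint_cumulant :: "'w measure \<Rightarrow> ('i \<Rightarrow> 'w \<Rightarrow> complex) \<Rightarrow> 'i set \<Rightarrow> complex" where
  "joint_cumulant M X I =
    (\<Sum>P | partition_on I P.
      (-1) ^ (card P - 1) * fact (card P - 1)
      * (\<Prod>V\<in>P. lebesgue_integral M (\<lambda>\<omega>. \<Prod>i\<in>V. X i \<omega>)))"

definition mat_trace :: "complex mat \<Rightarrow> complex" where
  "mat_trace A = sum_list (diag_mat A)"

text \<open>\<open>Tr (B j\<^sub>1 \<cdots> B j\<^sub>r)\<close> for the cycle \<open>(j\<^sub>1 \<dots> j\<^sub>r)\<close> of \<open>\<tau>\<close> with underlying set \<open>C\<close>. The cycle is read from its
  least element; by cyclicity of the trace, the starting point does not matter.\<close>

definition cycle_trace :: "nat \<Rightarrow> (nat \<Rightarrow> complex mat) \<Rightarrow> (nat \<Rightarrow> nat) \<Rightarrow> nat set \<Rightarrow> complex" where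
  "cycle_trace N B \<tau> C =
    mat_trace (foldr (\<lambda>k X. B ((\<tau> ^^ k) (Min C)) * X) [0..<card C] (1\<^sub>m N))"

text \<open>Below, \<open>M\<close> and \<open>B j\<close>, \<open>j \<in> {1..n}\<close>, are the probability space and the matrices for one fixed
  dimension \<open>N\<close>.\<close>

definition moment ::
    "'w measure \<Rightarrow> nat \<Rightarrow> (nat \<Rightarrow> 'w \<Rightarrow> complex mat) \<Rightarrow> nat set set \<Rightarrow> (nat \<Rightarrow> nat) \<Rightarrow> complex" where
  "moment M N B \<pi> \<tau> =
    (\<Prod>G\<in>\<pi>. joint_cumulant M (\<lambda>C \<omega>. cycle_trace N (\<lambda>j. B j \<omega>) \<tau> C) (cyc G \<tau>))"

definition cumulant ::
    "nat \<Rightarrow> 'w measure \<Rightarrow> nat \<Rightarrow> (nat \<Rightarrow> 'w \<Rightarrow> complex mat) \<Rightarrow> nat set set \<Rightarrow> (nat \<Rightarrow> nat) \<Rightarrow> complex" where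
  "cumulant n M N B \<pi> \<sigma> =
    (\<Sum>\<tau> | \<tau> permutes {1..n}.
      \<Sum>\<pi>' | refines {1..n} (cyc {1..n} \<tau>) \<pi>' \<and> refines {1..n} \<pi>' \<pi>.
        moment M N B \<pi>' \<tau> *
        (\<Sum>\<pi>'' | refines {1..n} (part_join (cyc {1..n} \<sigma>) \<pi>') \<pi>'' \<and> refines {1..n} \<pi>'' \<pi>.
          of_int (part_mobius {1..n} \<pi>'' \<pi>) *
          (\<Prod>G\<in>\<pi>''. of_real (weingarten N G (perm_restrict (\<sigma> \<circ> perm_inv \<tau>) G)))))"

text \<open>From here on, \<open>M N\<close> and \<open>B N j\<close> form a sequence indexed by the dimension \<open>N\<close>.\<close>

definition scaled_moment ::
    "nat \<Rightarrow> (nat \<Rightarrow> 'w measure) \<Rightarrow> (nat \<Rightarrow> nat \<Rightarrow> 'w \<Rightarrow> complex mat)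
      \<Rightarrow> nat set set \<Rightarrow> (nat \<Rightarrow> nat) \<Rightarrow> nat \<Rightarrow> complex" where
  "scaled_moment n M B \<pi> \<sigma> N =
    of_nat N powi (int (card (cyc {1..n} \<sigma>)) - 2 * int (card \<pi>)) * moment (M N) N (B N) \<pi> \<sigma>"

definition scaled_cumulant ::
    "nat \<Rightarrow> (nat \<Rightarrow> 'w measure) \<Rightarrow> (nat \<Rightarrow> nat \<Rightarrow> 'w \<Rightarrow> complex mat)
      \<Rightarrow> nat set set \<Rightarrow> (nat \<Rightarrow> nat) \<Rightarrow> nat \<Rightarrow> complex" where
  "scaled_cumulant n M B \<pi> \<sigma> N =
    of_nat N powi (int (card (cyc {1..n} \<sigma>)) + int n - 2 * int (card \<pi>))
      * cumulant n (M N) N (B N) \<pi> \<sigma>"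

definition limit_moment ::
    "nat \<Rightarrow> (nat \<Rightarrow> 'w measure) \<Rightarrow> (nat \<Rightarrow> nat \<Rightarrow> 'w \<Rightarrow> complex mat)
      \<Rightarrow> nat set set \<Rightarrow> (nat \<Rightarrow> nat) \<Rightarrow> complex" where
  "limit_moment n M B \<pi> \<sigma> = lim (scaled_moment n M B \<pi> \<sigma>)"

definition free_cumulant ::
    "nat \<Rightarrow> (nat \<Rightarrow> 'w measure) \<Rightarrow> (nat \<Rightarrow> nat \<Rightarrow> 'w \<Rightarrow> complex mat)
      \<Rightarrow> nat set set \<Rightarrow> (nat \<Rightarrow> nat) \<Rightarrow> complex" where
  "free_cumulant n M B \<pi> \<sigma> = lim (scaled_cumulant n M B \<pi> \<sigma>)"

end

theory Submission
  imports Defs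
begin

text \<open>
  In dimension \<open>N\<close> the definition of the cumulants is a Moebius inversion over the partitions combined
  with a convolution on Young subgroups. Since the product of Weingarten functions over the blocks of
  \<open>\<pi>\<close> is the convolution inverse of \<open>N ^ #(\<nu>)\<close> on the Young subgroup of \<open>\<pi>\<close>, the definition can be
  inverted exactly. Both formulas then follow by comparing powers
  of \<open>N\<close>: the exponents are \<open>- 2 g - 2 L\<close> and \<open>- 2 g - 2 L - 2 L'\<close>, and \<open>g\<close>, \<open>L\<close>, \<open>L'\<close> are nonnegative.

  The second formula also needs the leading order of the cumulants of the Weingarten function. The
  identity \<open>N W(\<nu>) + \<Sum>\<^sub>i W((i a) \<nu>) = [\<nu> a = a] W(\<nu>)\<close>, with the right-hand side taken on the complement
  of \<open>a\<close>, expresses that the sum of all \<open>N ^ #(\<nu>) \<nu>\<close> is a product of factors \<open>N + J\<^sub>a\<close> with Jucys--Murphy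
  elements \<open>J\<^sub>a\<close>. Moebius inversion turns it into a linear system for the cumulants which, after
  rescaling, is triangular in the limit. Hence the cumulants converge to the solution of the limiting
  cut-and-join recursion, and it remains to check that products of \<open>\<gamma>\<close> satisfy this recursion.

  For that, one variable is introduced for every cycle not containing \<open>a\<close>, with square zero, and a
  further variable \<open>u\<close> for the length of the cycle of \<open>a\<close>. The recursion becomes a quadratic equation
  with a catalytic variable \<open>u\<close>. It is solved by the quadratic method: up to an explicit polynomial
  part the solution is \<open>M (1 - 4 u B\<^sup>2)\<^sup>1\<^sup>/\<^sup>2\<close> with \<open>M\<close> polynomial and \<open>B = 1 + \<Sum>\<^sub>j z\<^sub>j B ^ (2 \<lambda>\<^sub>j + 1)\<close>, and the
  powers of \<open>B\<close> have the coefficients of the Rothe--Hagen identity.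
\<close>

section \<open>Set partitions as equivalence relations\<close>

text \<open>The second formula has to come first, because its limit also supplies the existence of
  all the limits \<open>free_cumulant\<close>, with which the first formula is passed to the limit.
  The obstacle there is that the system for the Weingarten cumulants is not recursive at finite N:
  it couples all pairs (R, \<nu>) on one set, since cuts and joins undo each other. Only in the
  limit do the surviving terms strictly lower #(\<nu>) - 2 #(R), so convergence is proved for the
  whole finite system at once. The weights in \<gamma> are q times the central binomial coefficient
  of q. The factor q absorbs the number of points at which a cycle of length q can be joined to that
  of a; the binomial coefficients belong to (1 - 4 x)^(-1/2). Joining a cycle of length l brings in
  u^(-l), and that series, truncated at degree l, is the polynomial whose product with (1 - 4
  x)^(1/2) is 1 up to terms beyond x^l; this makes the negative powers match. The square-zero
  variables record which cycles go to which piece of a cut, so that the quadratic term is an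
  ordinary product.\<close>

definition same_block :: "'a set set \<Rightarrow> 'a \<Rightarrow> 'a \<Rightarrow> bool" where
  "same_block P x y \<longleftrightarrow> (\<exists>B\<in>P. x \<in> B \<and> y \<in> B)"

lemma same_block_sym: "same_block P x y \<longleftrightarrow> same_block P y x"
  by (auto simp: same_block_def)

lemma same_block_refl: "partition_on A P \<Longrightarrow> same_block P x x \<longleftrightarrow> x \<in> A"
  by (auto simp: same_block_def partition_on_def)

lemma same_block_in: "partition_on A P \<Longrightarrow> same_block P x y \<Longrightarrow> x \<in> A \<and> y \<in> A"
  by (auto simp: same_block_def partition_on_def)

lemma same_block_iff_mem:
  "partition_on A P \<Longrightarrow> B \<in> P \<Longrightarrow> x \<in> B \<Longrightarrow> same_block P x y \<longleftrightarrow> y \<in> B"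
  unfolding same_block_def partition_on_def disjoint_def by blast

lemma partition_unique:
  "partition_on A P \<Longrightarrow> B \<in> P \<Longrightarrow> C \<in> P \<Longrightarrow> x \<in> B \<Longrightarrow> x \<in> C \<Longrightarrow> B = C"
  unfolding partition_on_def disjoint_def by blast

lemma same_block_trans:
  "partition_on A P \<Longrightarrow> same_block P x y \<Longrightarrow> same_block P y z \<Longrightarrow> same_block P x z"
  by (metis same_block_def same_block_iff_mem)

lemma same_block_Collect:
  "partition_on A P \<Longrightarrow> B \<in> P \<Longrightarrow> x \<in> B \<Longrightarrow> {y. same_block P x y} = B"
  by (auto simp: same_block_iff_mem)

lemma block_in_partition:
  assumes "partition_on A P" "x \<in> A"
  shows "{y. same_block P x y} \<in> P"
proof -
  obtain B where "B \<in> P" "x \<in> B" using assms by (auto simp: partition_on_def)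
  then show ?thesis using same_block_Collect[OF assms(1)] by auto
qed

lemma partition_eqI:
  assumes "partition_on A P" "partition_on A Q" "\<And>x y. same_block P x y \<longleftrightarrow> same_block Q x y"
  shows "P = Q"
proof -
  have sub: "P \<subseteq> Q" if P: "partition_on A P" and Q: "partition_on A Q"
    and eq: "\<forall>x y. same_block P x y \<longleftrightarrow> same_block Q x y" for P Q
  proof
    fix B assume B: "B \<in> P"
    then obtain x where x: "x \<in> B" "x \<in> A"
      using P unfolding partition_on_def by (metis Union_iff ex_in_conv)
    then show "B \<in> Q"
      using block_in_partition[OF Q x(2)] same_block_Collect[OF P B x(1)] eq by simp
  qed
  show ?thesis using sub[of P Q] sub[of Q P] assms by simp
qed

lemma refines_iff_same_block:
  assumes P: "partition_on A P" and Q: "partition_on A Q"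
  shows "refines A P Q \<longleftrightarrow> (\<forall>x y. same_block P x y \<longrightarrow> same_block Q x y)"
proof
  assume "refines A P Q"
  then show "\<forall>x y. same_block P x y \<longrightarrow> same_block Q x y"
    unfolding refines_def same_block_def by (meson subsetD)
next
  assume *: "\<forall>x y. same_block P x y \<longrightarrow> same_block Q x y"
  have "\<exists>Y\<in>Q. B \<subseteq> Y" if B: "B \<in> P" for B
  proof -
    obtain x where x: "x \<in> B" "x \<in> A" using B P unfolding partition_on_def by (metis Union_iff ex_in_conv)
    then obtain Y where Y: "Y \<in> Q" "x \<in> Y" using Q by (auto simp: partition_on_def)
    have "B \<subseteq> Y"
      using * x B Y same_block_iff_mem[OF Q Y] by (auto simp: same_block_def)
    then show ?thesis using Y by blast
  qed
  then show "refines A P Q" using P Q by (auto simp: refines_def)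
qed

lemma refines_same_block: "refines A P Q \<Longrightarrow> same_block P x y \<Longrightarrow> same_block Q x y"
  using refines_iff_same_block[of A P Q] by (auto simp: refines_def)

lemma refines_partition: "refines A P Q \<Longrightarrow> partition_on A P" "refines A P Q \<Longrightarrow> partition_on A Q"
  by (auto simp: refines_def)

lemma finite_partitions: "finite A \<Longrightarrow> (\<And>P. P \<in> \<P> \<Longrightarrow> partition_on A P) \<Longrightarrow> finite \<P>"
  by (rule finite_subset[OF _ finitely_many_partition_on[of A]]) auto

text \<open>A partition is determined by the partitions above it. Identities between joins and
  merges are reduced in this way to their universal properties, so the transitive closure in
  \<open>part_join\<close> need not be unfolded.\<close>

lemma refines_eqI:
  assumes "partition_on A P" "partition_on A Q"
    "\<And>R. partition_on A R \<Longrightarrow> refines A P R \<longleftrightarrow> refines A Q R"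
  shows "P = Q"
  using assms refines_asym refines_refl by metis

lemma part_join_refines_iff:
  assumes "partition_on A P" "partition_on A Q"
  shows "refines A (part_join P Q) R \<longleftrightarrow> refines A P R \<and> refines A Q R"
  using part_join_least[of A P R Q] refines_part_join[OF assms] refines_trans[of A] by blast

lemma part_join_commute:
  assumes "partition_on A P" "partition_on A Q"
  shows "part_join P Q = part_join Q P"
  by (rule refines_eqI[of A])
    (auto simp: assms partition_on_part_join part_join_refines_iff[of A])

lemma part_join_absorb:
  assumes "refines A P Q"
  shows "part_join P Q = Q" "part_join Q P = Q"
  by (rule refines_eqI[of A]; use assms in \<open>auto simp: refines_partition[OF assms] partition_on_part_join
      part_join_refines_iff[of A] dest: refines_trans[OF assms]\<close>)+

section \<open>Merging the blocks of two points\<close>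

definition merge_blocks :: "'a set set \<Rightarrow> 'a \<Rightarrow> 'a \<Rightarrow> 'a set set" where
  "merge_blocks P x y = insert (\<Union>{B\<in>P. x \<in> B \<or> y \<in> B}) {B\<in>P. x \<notin> B \<and> y \<notin> B}"

context
  fixes A :: "'a set" and P :: "'a set set" and x y :: 'a
  assumes P: "partition_on A P" and xy: "x \<in> A" "y \<in> A"
begin

lemma merge_blocks_eq:
  obtains X Y where "X \<in> P" "x \<in> X" "Y \<in> P" "y \<in> Y" "merge_blocks P x y = insert (X \<union> Y) (P - {X, Y})"
proof -
  obtain X Y where X: "X \<in> P" "x \<in> X" and Y: "Y \<in> P" "y \<in> Y"
    using P xy by (auto simp: partition_on_def)
  have "{B\<in>P. x \<in> B \<or> y \<in> B} = {X, Y}" "{B\<in>P. x \<notin> B \<and> y \<notin> B} = P - {X, Y}"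
    using X Y partition_unique[OF P] by blast+
  then have "merge_blocks P x y = insert (X \<union> Y) (P - {X, Y})" by (simp add: merge_blocks_def)
  with X Y show thesis by (rule that)
qed

lemma partition_on_merge: "partition_on A (merge_blocks P x y)"
proof -
  obtain X Y where X: "X \<in> P" "x \<in> X" and Y: "Y \<in> P" "y \<in> Y"
    and m: "merge_blocks P x y = insert (X \<union> Y) (P - {X, Y})" by (rule merge_blocks_eq)
  show ?thesis
  proof (rule partition_onI)
    show "\<Union> (merge_blocks P x y) = A" "{} \<notin> merge_blocks P x y"
      using P X Y by (auto simp: m partition_on_def)
    have "p = q" if "p \<in> merge_blocks P x y" "q \<in> merge_blocks P x y" "z \<in> p" "z \<in> q" for p q z
      using that X Y partition_unique[OF P] unfolding m by blast
    then show "disjnt p q" if "p \<in> merge_blocks P x y" "q \<in> merge_blocks P x y" "p \<noteq> q" for p q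
      using that by (auto simp: disjnt_iff)
  qed
qed

lemma same_block_merge:
  "same_block (merge_blocks P x y) u v \<longleftrightarrow> same_block P u v \<or>
    same_block P u x \<and> same_block P v y \<or> same_block P u y \<and> same_block P v x"
proof -
  obtain X Y where X: "X \<in> P" "x \<in> X" and Y: "Y \<in> P" "y \<in> Y"
    and m: "merge_blocks P x y = insert (X \<union> Y) (P - {X, Y})" by (rule merge_blocks_eq)
  have s: "same_block P u x \<longleftrightarrow> u \<in> X" "same_block P u y \<longleftrightarrow> u \<in> Y" for u
    using same_block_iff_mem[OF P X] same_block_iff_mem[OF P Y] by (simp_all add: same_block_sym)
  have "same_block P u v \<longleftrightarrow> (\<exists>B\<in>P - {X, Y}. u \<in> B \<and> v \<in> B) \<or> u \<in> X \<and> v \<in> X \<or> u \<in> Y \<and> v \<in> Y"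
    using X Y by (auto simp: same_block_def)
  then show ?thesis unfolding s by (auto simp: m same_block_def)
qed

text \<open>The universal property: merging is the join with the partition whose only nontrivial
  block is {x, y}. It covers the case that x and y share a block already.\<close>

lemma merge_refines_iff: "refines A (merge_blocks P x y) R \<longleftrightarrow> refines A P R \<and> same_block R x y"
proof
  assume *: "refines A (merge_blocks P x y) R"
  then have R: "partition_on A R" by (rule refines_partition)
  show "refines A P R \<and> same_block R x y"
    using refines_same_block[OF *] same_block_refl[OF P] xy
    by (auto simp: refines_iff_same_block[OF P R] same_block_merge)
next
  assume *: "refines A P R \<and> same_block R x y"
  then have R: "partition_on A R" using refines_partition by auto
  have "same_block R u v" if "same_block (merge_blocks P x y) u v" for u v
    using that * refines_same_block[of A P R] same_block_trans[OF R] same_block_sym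
    unfolding same_block_merge by metis
  then show "refines A (merge_blocks P x y) R"
    by (simp add: refines_iff_same_block[OF partition_on_merge R])
qed

lemma refines_merge: "refines A P (merge_blocks P x y)"
  and same_block_merge_self: "same_block (merge_blocks P x y) x y"
  using merge_refines_iff[of "merge_blocks P x y"] refines_refl[OF partition_on_merge] by auto

lemma merge_same: "same_block P x y \<Longrightarrow> merge_blocks P x y = P"
  using merge_refines_iff[of P] refines_refl[OF P] refines_merge refines_asym by metis

lemma card_merge:
  assumes "finite A" "\<not> same_block P x y"
  shows "card P = card (merge_blocks P x y) + 1"
proof -
  have finP: "finite P" using finite_elements assms(1) P by auto
  obtain X Y where X: "X \<in> P" "x \<in> X" and Y: "Y \<in> P" "y \<in> Y"
    and m: "merge_blocks P x y = insert (X \<union> Y) (P - {X, Y})" by (rule merge_blocks_eq)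
  have XY: "X \<noteq> Y" using assms(2) X Y by (auto simp: same_block_def)
  have "X \<union> Y \<notin> P - {X, Y}"
  proof
    assume a: "X \<union> Y \<in> P - {X, Y}"
    then have "X \<union> Y = X" using X partition_unique[OF P, of "X \<union> Y" X x] by auto
    then show False using a by auto
  qed
  then have "card (merge_blocks P x y) = Suc (card (P - {X, Y}))"
    unfolding m using finP by simp
  moreover have "card (P - {X, Y}) = card P - 2" "card P \<ge> card {X, Y}"
    using X Y XY finP card_mono[of P "{X, Y}"] by (auto simp: card_Diff_subset)
  ultimately show ?thesis using XY by simp
qed

lemma card_merge_ge: "finite A \<Longrightarrow> card P \<le> card (merge_blocks P x y) + 1"
  using card_merge merge_same by (cases "same_block P x y") auto

end

lemma part_join_merge:
  assumes "partition_on A P" "partition_on A Q" "x \<in> A" "y \<in> A"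
  shows "part_join P (merge_blocks Q x y) = merge_blocks (part_join P Q) x y"
  by (rule refines_eqI[of A])
    (auto simp: assms partition_on_part_join partition_on_merge part_join_refines_iff[of A] merge_refines_iff[of A])

lemma partition_exists_unmerged:
  assumes "refines A P Q" "P \<noteq> Q"
  obtains x y where "x \<in> A" "y \<in> A" "same_block Q x y" "\<not> same_block P x y"
  using assms partition_eqI[of A P Q] refines_same_block[of A P Q] refines_partition[OF assms(1)]
    same_block_in[of A Q] by metis

text \<open>Semimodularity of the partition lattice. If R is not yet P, some pair is separated by R
  and joined by P. Merging this pair in both R and Q lowers \<open>card R\<close> by exactly 1 and
  \<open>card Q\<close> by at most 1, and leaves the join with P unchanged, as P already joins the
  pair. At R = P there is equality.\<close>

lemma part_L_nonneg:
  assumes fin: "finite A" and "refines A R P" "refines A R Q"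
  shows "card P + card Q \<le> card R + card (part_join P Q)"
  using assms(2,3)
proof (induction "card R" arbitrary: R Q rule: less_induct)
  case less
  have p: "partition_on A P" "partition_on A Q" "partition_on A R"
    using less.prems refines_partition by auto
  show ?case
  proof (cases "R = P")
    case True
    then show ?thesis using part_join_absorb(1)[of A P Q] less.prems by simp
  next
    case False
    then obtain x y where xy: "x \<in> A" "y \<in> A" "same_block P x y" "\<not> same_block R x y"
      using partition_exists_unmerged[OF less.prems(1)] by metis
    note c = card_merge[OF p(3) xy(1,2) fin xy(4)]
    have "card P + card (merge_blocks Q x y) \<le>
      card (merge_blocks R x y) + card (part_join P (merge_blocks Q x y))"
    proof (rule less.hyps)
      show "card (merge_blocks R x y) < card R" using c by simp
      show "refines A (merge_blocks R x y) P"
        using less.prems xy by (simp add: merge_refines_iff[OF p(3)])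
      show "refines A (merge_blocks R x y) (merge_blocks Q x y)"
        using less.prems xy refines_merge[OF p(2) xy(1,2)] same_block_merge_self[OF p(2) xy(1,2)] refines_trans
        by (auto simp: merge_refines_iff[OF p(3)])
    qed
    moreover have "part_join P (merge_blocks Q x y) = part_join P Q"
      using part_join_merge[OF p(1,2) xy(1,2)] merge_same[OF partition_on_part_join[OF p(1,2)] xy(1,2)]
        refines_same_block[OF refines_part_join(1)[OF p(1,2)] xy(3)] by simp
    moreover have "card Q \<le> card (merge_blocks Q x y) + 1"
      by (rule card_merge_ge[OF p(2) xy(1,2) fin])
    ultimately show ?thesis using c by simp
  qed
qed


section \<open>Cycles\<close>

lemma orbit_permutes:
  assumes "finite A" "\<nu> permutes A" "x \<in> A"
  shows "x \<in> orbit \<nu> x" "orbit \<nu> x \<subseteq> A"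
  using assms permutation_self_in_orbit permutation_permutes permutes_orbit_subset by metis+

lemma orbit_eq_permutes:
  assumes "finite A" "\<nu> permutes A" "y \<in> orbit \<nu> x"
  shows "orbit \<nu> y = orbit \<nu> x"
  using cyclic_on_orbit[OF assms(2,1), of x] assms(3) orbit_cyclic_eq3 by metis

lemma partition_on_cyc:
  assumes "finite A" "\<nu> permutes A"
  shows "partition_on A (cyc A \<nu>)"
proof (rule partition_onI)
  show "\<Union> (cyc A \<nu>) = A" using orbit_permutes[OF assms] by (auto simp: cyc_def)
  show "{} \<notin> cyc A \<nu>" using orbit_nonempty by (fastforce simp: cyc_def)
  fix p q assume "p \<in> cyc A \<nu>" "q \<in> cyc A \<nu>" "p \<noteq> q"
  then obtain x y where "p = orbit \<nu> x" "q = orbit \<nu> y" by (auto simp: cyc_def)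
  then show "disjnt p q"
    using orbit_eq_permutes[OF assms] \<open>p \<noteq> q\<close> unfolding disjnt_iff by metis
qed

lemma same_block_cyc:
  assumes "finite A" "\<nu> permutes A"
  shows "same_block (cyc A \<nu>) x y \<longleftrightarrow> x \<in> A \<and> y \<in> orbit \<nu> x"
proof
  assume "same_block (cyc A \<nu>) x y"
  then obtain z where "z \<in> A" "x \<in> orbit \<nu> z" "y \<in> orbit \<nu> z" by (auto simp: same_block_def cyc_def)
  then show "x \<in> A \<and> y \<in> orbit \<nu> x"
    using orbit_permutes[OF assms] orbit_eq_permutes[OF assms] by blast
qed (use orbit_permutes[OF assms] in \<open>auto simp: same_block_def cyc_def\<close>)

lemma cyc_refines_iff:
  assumes "finite A" "\<nu> permutes A" "partition_on A P"
  shows "refines A (cyc A \<nu>) P \<longleftrightarrow> (\<forall>x\<in>A. same_block P x (\<nu> x))"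
proof
  assume "refines A (cyc A \<nu>) P"
  then show "\<forall>x\<in>A. same_block P x (\<nu> x)"
    using refines_same_block same_block_cyc[OF assms(1,2)] orbit.base by metis
next
  assume *: "\<forall>x\<in>A. same_block P x (\<nu> x)"
  have "same_block P x y" if "x \<in> A" "y \<in> orbit \<nu> x" for x y
    using that(2)
  proof induction
    case (step y)
    then show ?case using * same_block_trans[OF assms(3)] orbit_permutes[OF assms(1,2)] that(1) by blast
  qed (use * that in auto)
  then show "refines A (cyc A \<nu>) P"
    by (simp add: refines_iff_same_block[OF partition_on_cyc[OF assms(1,2)] assms(3)] same_block_cyc[OF assms(1,2)])
qed

lemma cyc_id: "cyc A id = (\<lambda>x. {x}) ` A"
  unfolding cyc_def by (rule image_cong) (auto simp: orbit_eq_singleton_iff)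

lemma card_cyc_id: "card (cyc A id) = card A"
  unfolding cyc_id by (rule card_image) auto

lemma cyc_inv:
  assumes "finite A" "\<nu> permutes A"
  shows "cyc A (perm_inv \<nu>) = cyc A \<nu>"
proof -
  have "permutation \<nu>" using assms permutation_permutes by blast
  then show ?thesis by (simp add: cyc_def orbit_inv_eq)
qed

section \<open>Cutting and joining cycles by a transposition\<close>

lemma transpose_comp_permutes:
  assumes "\<nu> permutes A" "i \<in> A" "a \<in> A"
  shows "Transposition.transpose i a \<circ> \<nu> permutes A"
  by (intro permutes_compose[OF assms(1)] permutes_swap_id assms(2,3))

text \<open>When i and a share a block of R, applying the transposition does not change the block of
  \<nu> x, so R cannot distinguish the two permutations.\<close>

lemma merge_cyc_transpose:
  assumes fin: "finite A" and \<nu>: "\<nu> permutes A" and ia: "i \<in> A" "a \<in> A" "partition_on A R"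
  shows "refines A (cyc A (Transposition.transpose i a \<circ> \<nu>)) R \<and> same_block R i a \<longleftrightarrow>
    refines A (cyc A \<nu>) R \<and> same_block R i a"
proof -
  have "same_block R x (Transposition.transpose i a (\<nu> x)) \<longleftrightarrow> same_block R x (\<nu> x)" if "same_block R i a" for x
  proof -
    have "same_block R x i \<longleftrightarrow> same_block R x a"
      using that same_block_trans[OF ia(3)] same_block_sym[of R i a] by blast
    then show ?thesis by (simp add: Transposition.transpose_def)
  qed
  then show ?thesis
    using cyc_refines_iff[OF fin \<nu> ia(3)] cyc_refines_iff[OF fin transpose_comp_permutes[OF \<nu> ia(1,2)] ia(3)]
    by auto
qed

lemma merge_cyc_transpose_eq:
  assumes fin: "finite A" and \<nu>: "\<nu> permutes A" and ia: "i \<in> A" "a \<in> A"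
  shows "merge_blocks (cyc A (Transposition.transpose i a \<circ> \<nu>)) i a = merge_blocks (cyc A \<nu>) i a"
  by (rule refines_eqI[of A])
    (auto simp: partition_on_merge partition_on_cyc transpose_comp_permutes merge_refines_iff[of A]
      merge_cyc_transpose assms)

text \<open>If the new orbit of a avoided i, it would contain the old orbit, since the two
  permutations differ only where a value is i or a. It would then contain the old preimage of a,
  whose new image is i.\<close>

lemma orbit_transpose_join:
  assumes fin: "finite A" and \<nu>: "\<nu> permutes A" and ia: "i \<in> A" "a \<in> A" and "i \<notin> orbit \<nu> a"
  shows "i \<in> orbit (Transposition.transpose i a \<circ> \<nu>) a"
proof (rule ccontr)
  let ?\<nu>' = "Transposition.transpose i a \<circ> \<nu>"
  assume *: "i \<notin> orbit ?\<nu>' a"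
  note \<nu>' = transpose_comp_permutes[OF \<nu> ia]
  have "z \<in> orbit ?\<nu>' a" if "z \<in> orbit \<nu> a" for z
  proof -
    have step: "\<nu> u \<in> orbit ?\<nu>' a" if "u = a \<or> u \<in> orbit ?\<nu>' a" "\<nu> u \<noteq> i" for u
    proof (cases "\<nu> u = a")
      case True
      then show ?thesis using orbit_permutes(1)[OF fin \<nu>' ia(2)] by simp
    next
      case False
      then have "?\<nu>' u = \<nu> u" using that(2) by (simp add: Transposition.transpose_def)
      then show ?thesis using that(1) orbit.base[of ?\<nu>' a] orbit.step[of u ?\<nu>' a] by metis
    qed
    from that show ?thesis
    proof induction
      case base
      show ?case using step[of a] assms(5) orbit.base[of \<nu> a] by metis
    next
      case (step z)
      then show ?case using \<open>\<And>u. _ \<Longrightarrow> _ \<Longrightarrow> \<nu> u \<in> _\<close>[of z] assms(5) orbit.step[of z \<nu> a] by metis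
    qed
  qed
  moreover have "perm_inv \<nu> a \<in> orbit \<nu> a"
    using orbit_permutes[OF fin \<nu> ia(2)] orbit_inv_eq[of \<nu> a] orbit.base[of "perm_inv \<nu>" a] \<nu> fin
      permutation_permutes by blast
  ultimately have "?\<nu>' (perm_inv \<nu> a) \<in> orbit ?\<nu>' a" using orbit.step by metis
  moreover have "?\<nu>' (perm_inv \<nu> a) = i" using permutes_inverses(1)[OF \<nu>] by simp
  ultimately show False using * by simp
qed

lemma orbit_funpow:
  assumes fin: "finite A" and \<nu>: "\<nu> permutes A" and a: "a \<in> A"
  shows "orbit \<nu> a = (\<lambda>s. (\<nu> ^^ s) a) ` {..<card (orbit \<nu> a)}"
    and "inj_on (\<lambda>s. (\<nu> ^^ s) a) {..<card (orbit \<nu> a)}"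
    and "(\<nu> ^^ card (orbit \<nu> a)) a = a"
proof -
  note self = orbit_permutes(1)[OF assms]
  let ?k = "funpow_dist1 \<nu> a a"
  have "card (orbit \<nu> a) = ?k"
    using card_image[OF inj_on_funpow_dist1[OF self]] orbit_conv_funpow_dist1[OF self] by simp
  then show "orbit \<nu> a = (\<lambda>s. (\<nu> ^^ s) a) ` {..<card (orbit \<nu> a)}"
    "inj_on (\<lambda>s. (\<nu> ^^ s) a) {..<card (orbit \<nu> a)}" "(\<nu> ^^ card (orbit \<nu> a)) a = a"
    using orbit_conv_funpow_dist1[OF self] inj_on_funpow_dist1[OF self] funpow_dist1_prop[OF self]
    by (simp_all only: atLeast0LessThan)
qed

text \<open>The new permutation follows the old cycle from a until step t, where it returns to a
  instead of reaching i. This links the position of i on the cycle with the length of the piece that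
  keeps a.\<close>

lemma orbit_transpose_cut:
  assumes fin: "finite A" and \<nu>: "\<nu> permutes A" and a: "a \<in> A"
    and t: "1 \<le> t" "t < card (orbit \<nu> a)"
  shows "orbit (Transposition.transpose ((\<nu> ^^ t) a) a \<circ> \<nu>) a = (\<lambda>s. (\<nu> ^^ s) a) ` {..<t}"
    and "card (orbit (Transposition.transpose ((\<nu> ^^ t) a) a \<circ> \<nu>) a) = t"
    and "(\<nu> ^^ t) a \<notin> orbit (Transposition.transpose ((\<nu> ^^ t) a) a \<circ> \<nu>) a"
proof -
  define i where "i = (\<nu> ^^ t) a"
  let ?\<nu>' = "Transposition.transpose i a \<circ> \<nu>"
  note inj = orbit_funpow(2)[OF fin \<nu> a]
  have i: "i \<in> A" using \<nu> a by (simp add: i_def permutes_in_funpow_image)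
  have ne: "(\<nu> ^^ r) a \<noteq> (\<nu> ^^ s) a" if "r < s" "s \<le> t" for r s
    using inj_onD[OF inj, of r s] that t by auto
  have step: "?\<nu>' ((\<nu> ^^ s) a) = (if Suc s = t then a else (\<nu> ^^ Suc s) a)" if "s < t" for s
    using ne[of 0 "Suc s"] ne[of "Suc s" t] that by (auto simp: i_def Transposition.transpose_def)
  have 1: "x \<in> (\<lambda>s. (\<nu> ^^ s) a) ` {..<t}" if "x \<in> orbit ?\<nu>' a" for x
    using that
  proof induction
    case base
    show ?case using step[of 0] t by (auto simp: image_iff intro: bexI[of _ 0] bexI[of _ "Suc 0"])
  next
    case (step x)
    then obtain s where "s < t" "x = (\<nu> ^^ s) a" by auto
    then show ?case using \<open>\<And>s. s < t \<Longrightarrow> _\<close>[of s]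
      by (auto simp: image_iff intro: bexI[of _ 0] bexI[of _ "Suc s"])
  qed
  have 2: "(\<nu> ^^ s) a \<in> orbit ?\<nu>' a" if "s < t" for s
    using that
  proof (induction s)
    case 0
    show ?case using orbit_permutes(1)[OF fin transpose_comp_permutes[OF \<nu> i a] a] by (simp only: funpow_0)
  next
    case (Suc s)
    then have "?\<nu>' ((\<nu> ^^ s) a) = (\<nu> ^^ Suc s) a" "(\<nu> ^^ s) a \<in> orbit ?\<nu>' a"
      using step[of s] by (auto simp only: Suc_lessD split: if_splits)
    then show ?case using orbit.step[of "(\<nu> ^^ s) a" ?\<nu>' a] by metis
  qed
  show o: "orbit (Transposition.transpose ((\<nu> ^^ t) a) a \<circ> \<nu>) a = (\<lambda>s. (\<nu> ^^ s) a) ` {..<t}"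
    using 1 2 by (auto simp: i_def)
  show "card (orbit (Transposition.transpose ((\<nu> ^^ t) a) a \<circ> \<nu>) a) = t"
    unfolding o using t by (subst card_image) (auto intro: inj_on_subset[OF inj])
  show "(\<nu> ^^ t) a \<notin> orbit (Transposition.transpose ((\<nu> ^^ t) a) a \<circ> \<nu>) a"
    unfolding o using ne[of _ t] by (metis (no_types, lifting) imageE lessThan_iff order_refl)
qed

lemma orbit_transpose_iff:
  assumes fin: "finite A" and \<nu>: "\<nu> permutes A" and ia: "i \<in> A" "a \<in> A" and "i \<noteq> a"
  shows "i \<in> orbit (Transposition.transpose i a \<circ> \<nu>) a \<longleftrightarrow> i \<notin> orbit \<nu> a"
proof -
  have "i \<notin> orbit (Transposition.transpose i a \<circ> \<nu>) a" if i: "i \<in> orbit \<nu> a"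
  proof -
    obtain t where t: "t < card (orbit \<nu> a)" "i = (\<nu> ^^ t) a"
      using orbit_funpow(1)[OF fin \<nu> ia(2), THEN equalityD1, THEN subsetD, OF i] by auto
    then have "1 \<le> t" using assms(5) by (cases t) auto
    then show ?thesis using orbit_transpose_cut(3)[OF fin \<nu> ia(2) _ t(1)] t(2) by simp
  qed
  then show ?thesis using orbit_transpose_join[OF fin \<nu> ia] by blast
qed

text \<open>Merging i and a makes the two cycle partitions equal, by
  \<open>merge_cyc_transpose_eq\<close>, and exactly one of the two permutations has i and a on a
  common cycle. Its cycle partition is therefore the merge of the other one.\<close>

lemma cyc_transpose:
  assumes fin: "finite A" and \<nu>: "\<nu> permutes A" and ia: "i \<in> A" "a \<in> A" "i \<noteq> a"
  shows "same_block (cyc A (Transposition.transpose i a \<circ> \<nu>)) i a \<longleftrightarrow> \<not> same_block (cyc A \<nu>) i a"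
    and "\<not> same_block (cyc A \<nu>) i a \<Longrightarrow>
      cyc A (Transposition.transpose i a \<circ> \<nu>) = merge_blocks (cyc A \<nu>) i a \<and>
      card (cyc A \<nu>) = card (cyc A (Transposition.transpose i a \<circ> \<nu>)) + 1"
    and "same_block (cyc A \<nu>) i a \<Longrightarrow>
      cyc A \<nu> = merge_blocks (cyc A (Transposition.transpose i a \<circ> \<nu>)) i a \<and>
      card (cyc A (Transposition.transpose i a \<circ> \<nu>)) = card (cyc A \<nu>) + 1"
proof -
  let ?\<nu>' = "Transposition.transpose i a \<circ> \<nu>"
  note \<nu>' = transpose_comp_permutes[OF \<nu> ia(1,2)]
  note p = partition_on_cyc[OF fin \<nu>] partition_on_cyc[OF fin \<nu>']
  note m = merge_cyc_transpose_eq[OF fin \<nu> ia(1,2)]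
  show s: "same_block (cyc A ?\<nu>') i a \<longleftrightarrow> \<not> same_block (cyc A \<nu>) i a"
    using orbit_transpose_iff[OF assms] ia
    by (simp add: same_block_sym[of _ i] same_block_cyc[OF fin \<nu>] same_block_cyc[OF fin \<nu>'])
  show "\<not> same_block (cyc A \<nu>) i a \<Longrightarrow> cyc A ?\<nu>' = merge_blocks (cyc A \<nu>) i a \<and>
      card (cyc A \<nu>) = card (cyc A ?\<nu>') + 1"
    using s m merge_same[OF p(2) ia(1,2)] card_merge[OF p(1) ia(1,2) fin] by simp
  show "same_block (cyc A \<nu>) i a \<Longrightarrow> cyc A \<nu> = merge_blocks (cyc A ?\<nu>') i a \<and>
      card (cyc A ?\<nu>') = card (cyc A \<nu>) + 1"
    using s m merge_same[OF p(1) ia(1,2)] card_merge[OF p(2) ia(1,2) fin] by simp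
qed

text \<open>Induction on a set S carrying \<sigma>2. Splitting off a transposition (a b) from
  \<sigma>2 costs #(\<sigma>2) one cycle. If the product gains a cycle, a and b lie together in the
  join already, which stays the same; if it loses one, the join loses at most one block, which
  counts twice on the right.\<close>

lemma genus_inequality:
  assumes fin: "finite A" and s1: "\<sigma>1 permutes A" and "S \<subseteq> A" "\<sigma>2 permutes S"
  shows "card (cyc A \<sigma>1) + card (cyc A \<sigma>2) + card (cyc A (\<sigma>1 \<circ> \<sigma>2))
    \<le> card A + 2 * card (part_join (cyc A \<sigma>1) (cyc A \<sigma>2))"
proof -
  have "finite S" using assms finite_subset by auto
  from this assms(3,4) show ?thesis
  proof (induction S arbitrary: \<sigma>2 rule: finite_induct)
    case empty
    then have id: "\<sigma>2 = id" by simp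
    have "refines A (cyc A id) (cyc A \<sigma>1)"
      using cyc_refines_iff[OF fin permutes_id partition_on_cyc[OF fin s1]]
      by (simp add: same_block_refl[OF partition_on_cyc[OF fin s1]])
    then have "part_join (cyc A \<sigma>1) (cyc A id) = cyc A \<sigma>1" by (rule part_join_absorb(2))
    then show ?case unfolding id by (simp only: card_cyc_id comp_id)
  next
    case (insert a S)
    \<comment> \<open>With b = \<sigma>2 a the remaining factor q fixes a, so it permutes S.\<close>
    obtain b q where b: "b \<in> insert a S" and q: "q permutes S" and \<sigma>2: "\<sigma>2 = Transposition.transpose a b \<circ> q"
    proof (rule that)
      show "\<sigma>2 a \<in> insert a S" using permutes_in_image[OF insert.prems(2)] by simp
      show "Transposition.transpose a (\<sigma>2 a) \<circ> \<sigma>2 permutes S" using permutes_insert_lemma[OF insert.prems(2)] .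
      show "\<sigma>2 = Transposition.transpose a (\<sigma>2 a) \<circ> (Transposition.transpose a (\<sigma>2 a) \<circ> \<sigma>2)"
        by (simp add: fun_eq_iff)
    qed
    have aA: "a \<in> A" "b \<in> A" and SA: "S \<subseteq> A" using insert.prems(1) b by auto
    have qA: "q permutes A" using permutes_subset[OF q SA] .
    note IH = insert.IH[OF SA q]
    show ?case
    proof (cases "b = a")
      case True
      then show ?thesis using IH \<sigma>2 by simp
    next
      case False
      then have ab: "a \<noteq> b" by simp
      let ?J = "part_join (cyc A \<sigma>1) (cyc A q)"
      have qa: "q a = a" using q insert.hyps(2) permutes_not_in by metis
      have "\<not> same_block (cyc A q) a b"
        using qa ab orbit_eq_singleton_iff[of q a] by (simp add: same_block_cyc[OF fin qA])
      note c = cyc_transpose(2)[OF fin qA aA ab this]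
      note n = c[folded \<sigma>2, THEN conjunct2]
      have s1q: "\<sigma>1 \<circ> q permutes A" using permutes_compose[OF qA s1] .
      have s: "\<sigma>1 a \<in> A" "\<sigma>1 b \<in> A" "\<sigma>1 a \<noteq> \<sigma>1 b"
        using aA ab permutes_in_image[OF s1] permutes_inj[OF s1] by (auto dest: injD)
      \<comment> \<open>Moving the transposition to the left of \<sigma>1 conjugates it, after which
        the cut-and-join alternative applies to the product as well.\<close>
      have comp: "\<sigma>1 \<circ> \<sigma>2 = Transposition.transpose (\<sigma>1 a) (\<sigma>1 b) \<circ> (\<sigma>1 \<circ> q)"
        using permutes_inj[OF s1] by (auto simp: \<sigma>2 fun_eq_iff Transposition.transpose_def inj_eq)
      note pp = partition_on_cyc[OF fin s1] partition_on_cyc[OF fin qA]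
      note pJ = partition_on_part_join[OF pp]
      have J': "part_join (cyc A \<sigma>1) (cyc A \<sigma>2) = merge_blocks ?J a b"
        using c \<sigma>2 part_join_merge[OF pp aA] by simp
      note r = refines_same_block[OF refines_part_join(1)[OF pp]] refines_same_block[OF refines_part_join(2)[OF pp]]
      show ?thesis
      proof (cases "same_block (cyc A (\<sigma>1 \<circ> q)) (\<sigma>1 a) (\<sigma>1 b)")
        case True
        have s1J: "same_block ?J x (\<sigma>1 x)" if "x \<in> A" for x
          using that r(1) same_block_cyc[OF fin s1] orbit.base by metis
        have "same_block ?J x ((\<sigma>1 \<circ> q) x)" if "x \<in> A" for x
          using that r(2)[of x "q x"] same_block_cyc[OF fin qA] orbit.base[of q x] s1J[of "q x"]
            permutes_in_image[OF qA, of x] same_block_trans[OF pJ] by auto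
        then have "refines A (cyc A (\<sigma>1 \<circ> q)) ?J"
          using cyc_refines_iff[OF fin s1q pJ] by blast
        then have "same_block ?J (\<sigma>1 a) (\<sigma>1 b)" using True refines_same_block by metis
        then have "same_block ?J a b"
          using s1J[OF aA(1)] s1J[OF aA(2)] same_block_trans[OF pJ] same_block_sym by metis
        then have m: "merge_blocks ?J a b = ?J" by (rule merge_same[OF pJ aA])
        show ?thesis
          using cyc_transpose(3)[OF fin s1q s True, folded comp, THEN conjunct2] n IH unfolding J' m by linarith
      next
        case False
        then show ?thesis
          using cyc_transpose(2)[OF fin s1q s False, folded comp, THEN conjunct2] n IH
            card_merge_ge[OF pJ aA fin] unfolding J' by linarith
      qed
    qed
  qed
qed


section \<open>The ring of set functions\<close>

text \<open>The value at infinite sets is fixed to 0, because the sum over all subsets in the product vanishes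
  there.\<close>

typedef 'i setfun = "{f :: 'i set \<Rightarrow> real. \<forall>S. infinite S \<longrightarrow> f S = 0}"
  morphisms coef Setfun by (rule exI[of _ "\<lambda>_. 0"]) simp

setup_lifting type_definition_setfun

lemma coef_infinite: "infinite S \<Longrightarrow> coef f S = 0"
  using coef[of f] by simp

text \<open>A finite set S stands for the monomial with one variable for each element of S. Only
  disjoint sets multiply to something nonzero, so every variable has square zero.\<close>

instantiation setfun :: (type) "{comm_ring_1, real_algebra_1}"
begin

lift_definition zero_setfun :: "'a setfun" is "\<lambda>_. 0" by simp
lift_definition one_setfun :: "'a setfun" is "\<lambda>S. if S = {} then 1 else 0" by auto
lift_definition plus_setfun :: "'a setfun \<Rightarrow> 'a setfun \<Rightarrow> 'a setfun" is "\<lambda>f g S. f S + g S" by simp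
lift_definition minus_setfun :: "'a setfun \<Rightarrow> 'a setfun \<Rightarrow> 'a setfun" is "\<lambda>f g S. f S - g S" by simp
lift_definition uminus_setfun :: "'a setfun \<Rightarrow> 'a setfun" is "\<lambda>f S. - f S" by simp
lift_definition scaleR_setfun :: "real \<Rightarrow> 'a setfun \<Rightarrow> 'a setfun" is "\<lambda>r f S. r * f S" by simp
lift_definition times_setfun :: "'a setfun \<Rightarrow> 'a setfun \<Rightarrow> 'a setfun"
  is "\<lambda>f g S. \<Sum>T\<in>Pow S. f T * g (S - T)" by simp

instance
proof
  fix f g h :: "'a setfun" and a b :: real
  show "f * g * h = f * (g * h)"
  proof (transfer, rule ext)
    fix f g h :: "'a set \<Rightarrow> real" and S
    assume f: "\<forall>S. infinite S \<longrightarrow> f S = 0"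
    show "(\<Sum>T\<in>Pow S. (\<Sum>U\<in>Pow T. f U * g (T - U)) * h (S - T)) =
      (\<Sum>U\<in>Pow S. f U * (\<Sum>V\<in>Pow (S - U). g V * h (S - U - V)))"
    proof (cases "finite S")
      case True
      have fin: "finite T" if "T \<in> Pow S" for T using that True finite_subset by auto
      have "(\<Sum>T\<in>Pow S. (\<Sum>U\<in>Pow T. f U * g (T - U)) * h (S - T)) =
        (\<Sum>(T, U)\<in>(SIGMA T:Pow S. Pow T). f U * g (T - U) * h (S - T))"
        using True fin by (subst sum.Sigma[symmetric]) (auto simp: sum_distrib_right)
      \<comment> \<open>Chains U \<subseteq> T \<subseteq> S correspond to disjoint pairs U, V with
        V = T - U.\<close>
      also have "\<dots> = (\<Sum>(U, V)\<in>(SIGMA U:Pow S. Pow (S - U)). f U * (g V * h (S - U - V)))"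
        by (rule sum.reindex_bij_witness[of _ "\<lambda>(U, V). (U \<union> V, U)" "\<lambda>(T, U). (U, T - U)"])
          (auto simp: Un_Diff Int_absorb1 Diff_Int Diff_triv algebra_simps Int_commute
            intro!: arg_cong[of _ _ h] arg_cong[of _ _ g])
      also have "\<dots> = (\<Sum>U\<in>Pow S. f U * (\<Sum>V\<in>Pow (S - U). g V * h (S - U - V)))"
        using True by (subst sum.Sigma[symmetric]) (auto simp: sum_distrib_left)
      finally show ?thesis .
    qed simp
  qed
  show comm: "f * g = g * f" for f g :: "'a setfun"
  proof (transfer, rule ext)
    fix f g :: "'a set \<Rightarrow> real" and S
    show "(\<Sum>T\<in>Pow S. f T * g (S - T)) = (\<Sum>T\<in>Pow S. g T * f (S - T))"
      by (rule sum.reindex_bij_witness[of _ "\<lambda>T. S - T" "\<lambda>T. S - T"]) (auto simp: double_diff)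
  qed
  show one: "1 * f = f" for f :: "'a setfun"
  proof (transfer, rule ext)
    fix f :: "'a set \<Rightarrow> real" and S
    assume f: "\<forall>S. infinite S \<longrightarrow> f S = 0"
    show "(\<Sum>T\<in>Pow S. (if T = {} then 1 else 0) * f (S - T)) = f S"
    proof (cases "finite S")
      case True
      have "(\<Sum>T\<in>Pow S. (if T = {} then 1 else 0) * f (S - T)) = (\<Sum>T\<in>Pow S. if T = {} then f S else 0)"
        by (rule sum.cong) auto
      also have "\<dots> = f S" using True by simp
      finally show ?thesis .
    qed (use f in simp)
  qed
  show "(f + g) * h = f * h + g * h"
    by transfer (simp add: sum.distrib distrib_right)
  show "a *\<^sub>R f * g = a *\<^sub>R (f * g)"
    by transfer (simp add: sum_distrib_left mult.assoc)
  show "f * a *\<^sub>R g = a *\<^sub>R (f * g)"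
    by transfer (simp add: sum_distrib_left mult_ac)
  show "(0::'a setfun) \<noteq> 1" by transfer (auto simp: fun_eq_iff)
  show "f + g + h = f + (g + h)" by transfer (simp add: add.assoc)
  show "f + g = g + f" by transfer (simp add: add.commute)
  show "0 + f = f" by transfer simp
  show "- f + f = 0" by transfer simp
  show "f - g = f + - g" by transfer simp
  show "f * (g + h) = f * g + f * h" by transfer (simp add: sum.distrib distrib_left)
  show "f * 1 = f" for f :: "'a setfun" using one comm by metis
  show "a *\<^sub>R (f + g) = a *\<^sub>R f + a *\<^sub>R g" by transfer (simp add: distrib_left)
  show "(a + b) *\<^sub>R f = a *\<^sub>R f + b *\<^sub>R f" by transfer (simp add: distrib_right)
  show "a *\<^sub>R b *\<^sub>R f = (a * b) *\<^sub>R f" by transfer (simp add: mult.assoc)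
  show "1 *\<^sub>R f = f" by transfer simp
qed

end

lemma coef_0 [simp]: "coef 0 S = 0" by transfer simp
lemma coef_1: "coef 1 S = (if S = {} then 1 else 0)" by transfer simp
lemma coef_add [simp]: "coef (f + g) S = coef f S + coef g S" by transfer simp
lemma coef_diff [simp]: "coef (f - g) S = coef f S - coef g S" by transfer simp
lemma coef_scaleR [simp]: "coef (a *\<^sub>R f) S = a * coef f S" by transfer simp
lemma coef_sum [simp]: "coef (sum f A) S = (\<Sum>x\<in>A. coef (f x) S)"
  by (induction A rule: infinite_finite_induct) auto
lemma coef_mult: "coef (f * g) S = (\<Sum>T\<in>Pow S. coef f T * coef g (S - T))" by transfer simp

lift_definition setfun_var :: "'i \<Rightarrow> 'i setfun" is "\<lambda>j S. if S = {j} then 1 else 0" by auto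

lemma coef_var_mult:
  "coef (setfun_var j * f) S = (if j \<in> S then coef f (S - {j}) else 0)"
proof (cases "finite S")
  case True
  have "coef (setfun_var j * f) S = (\<Sum>T\<in>Pow S. if T = {j} then coef f (S - {j}) else 0)"
    unfolding coef_mult by (rule sum.cong) (auto simp: setfun_var.rep_eq)
  also have "\<dots> = (if j \<in> S then coef f (S - {j}) else 0)"
    using True by simp
  finally show ?thesis .
qed (simp add: coef_infinite)


section \<open>Falling factorials and the Rothe--Hagen convolution\<close>

definition ffact :: "real \<Rightarrow> nat \<Rightarrow> real" where
  "ffact y r = (\<Prod>i<r. y - real i)"

lemma ffact_0 [simp]: "ffact y 0 = 1" by (simp add: ffact_def)
lemma ffact_Suc: "ffact y (Suc r) = ffact y r * (y - real r)" by (simp add: ffact_def)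
lemma ffact_Suc_left: "ffact y (Suc r) = y * ffact (y - 1) r"
  by (simp add: ffact_def prod.lessThan_Suc_shift algebra_simps del: prod.lessThan_Suc)

text \<open>\<open>rothe I x a\<close> is the power \<open>B ^ a\<close> of the solution of \<open>B = 1 + \<Sum>\<^sub>j z\<^sub>j B ^ x\<^sub>j\<close>, with coefficients given
  by Lagrange inversion.\<close>

lift_definition rothe :: "'i set \<Rightarrow> ('i \<Rightarrow> nat) \<Rightarrow> nat \<Rightarrow> 'i setfun" is
  "\<lambda>I x a S. if finite S \<and> S \<subseteq> I then
    (if S = {} then 1 else real a * ffact (real a + real (sum x S) - 1) (card S - 1)) else 0"
  by auto

lemma coef_setfun_eqI: "(\<And>S. finite S \<Longrightarrow> coef f S = coef g S) \<Longrightarrow> f = g"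
  by (metis coef_infinite coef_inject ext)

lemma rothe_0: "rothe I x 0 = 1"
  by (rule coef_setfun_eqI) (auto simp: rothe.rep_eq coef_1)

text \<open>This is the equation for B multiplied by B^a. Together with the value at exponent 0 it
  characterises the powers.\<close>

lemma rothe_Suc:
  assumes "finite I"
  shows "rothe I x (Suc a) = rothe I x a + (\<Sum>j\<in>I. setfun_var j * rothe I x (a + x j))"
proof (rule coef_setfun_eqI)
  fix S :: "'a set" assume S: "finite S"
  have "(\<Sum>j\<in>I. coef (setfun_var j * rothe I x (a + x j)) S) =
      (\<Sum>j\<in>I. if j \<in> S then coef (rothe I x (a + x j)) (S - {j}) else 0)"
    by (simp add: coef_var_mult)
  also have "\<dots> = (\<Sum>j\<in>I \<inter> S. coef (rothe I x (a + x j)) (S - {j}))"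
    using assms by (simp add: sum.inter_restrict)
  finally have *: "coef (\<Sum>j\<in>I. setfun_var j * rothe I x (a + x j)) S =
    (\<Sum>j\<in>I \<inter> S. coef (rothe I x (a + x j)) (S - {j}))" by simp
  show "coef (rothe I x (Suc a)) S =
    coef (rothe I x a + (\<Sum>j\<in>I. setfun_var j * rothe I x (a + x j))) S"
  proof (cases "S \<subseteq> I")
    case False
    have "coef (rothe I x (a + x j)) (S - {j}) = 0" if "j \<in> I \<inter> S" for j
      using False that by (auto simp: rothe.rep_eq)
    then show ?thesis using False by (simp only: coef_add *) (simp add: rothe.rep_eq)
  next
    case True
    then have IS: "I \<inter> S = S" by auto
    show ?thesis
    \<comment> \<open>Sets with at most one element are separate, because removing j may leave the
      empty set, where the coefficient is 1 and not given by the falling factorial.\<close>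
    proof (cases "card S \<le> 1")
      case True
      then consider "S = {}" | j where "S = {j}"
        using S by (metis card_0_eq card_1_singletonE le_SucE le_zero_eq One_nat_def)
      then show ?thesis
      proof cases
        case 1
        then show ?thesis by (simp add: rothe.rep_eq coef_var_mult)
      next
        case 2
        with \<open>S \<subseteq> I\<close> * IS show ?thesis by (simp add: rothe.rep_eq)
      qed
    next
      case False
      then obtain r where r: "card S = Suc (Suc r)"
        by (metis One_nat_def Suc_le_mono card.infinite le0 nat.exhaust)
      define X where "X = real (sum x S)"
      have ne: "S \<noteq> {}" using r by auto
      \<comment> \<open>Raising the exponent by x j compensates for the removal of j from the sum
        over S, so the falling factorial is the same for every j and the sum over j is
        linear.\<close>
      have "coef (rothe I x (a + x j)) (S - {j}) = (real a + real (x j)) * ffact (real a + X - 1) r"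
        if "j \<in> S" for j
      proof -
        have "card (S - {j}) = Suc r" using r that S by simp
        then have "S - {j} \<noteq> {}" by (metis card.empty nat.distinct(1))
        moreover have "real (sum x (S - {j})) = X - real (x j)"
          using that S by (simp add: X_def sum_diff1_nat member_le_sum)
        ultimately show ?thesis using True \<open>card (S - {j}) = Suc r\<close> S
          by (auto simp: rothe.rep_eq algebra_simps)
      qed
      then have "(\<Sum>j\<in>S. coef (rothe I x (a + x j)) (S - {j})) =
        (\<Sum>j\<in>S. real a + real (x j)) * ffact (real a + X - 1) r"
        by (simp add: sum_distrib_right)
      also have "(\<Sum>j\<in>S. real a + real (x j)) = real (r + 2) * real a + X"
        using r by (simp add: sum.distrib X_def)
      finally have sum: "(\<Sum>j\<in>S. coef (rothe I x (a + x j)) (S - {j})) =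
        (real (r + 2) * real a + X) * ffact (real a + X - 1) r" .
      have "coef (rothe I x (Suc a)) S = (real a + 1) * ffact (real a + X) (Suc r)"
        "coef (rothe I x a) S = real a * ffact (real a + X - 1) (Suc r)"
        using True S ne r by (simp_all add: rothe.rep_eq X_def[symmetric] del: of_nat_sum)
      moreover have "(real a + 1) * ffact (real a + X) (Suc r) =
          real a * ffact (real a + X - 1) (Suc r) + (real (r + 2) * real a + X) * ffact (real a + X - 1) r"
        unfolding ffact_Suc_left[of "real a + X" r] ffact_Suc[of "real a + X - 1" r]
        by (simp add: algebra_simps)
      ultimately show ?thesis by (simp only: coef_add * IS sum)
    qed
  qed
qed

text \<open>The Rothe--Hagen identity. Expanding one factor by \<open>rothe_Suc\<close> yields a
  term with a smaller exponent and terms with a variable in front; these have larger exponents but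
  are evaluated at proper subsets. Hence the induction is on S, for all exponents, and then on
  a.\<close>

lemma rothe_add:
  assumes "finite I"
  shows "rothe I x a * rothe I x b = rothe I x (a + b)"
proof (rule coef_setfun_eqI)
  fix S :: "'a set" assume "finite S"
  then show "coef (rothe I x a * rothe I x b) S = coef (rothe I x (a + b)) S"
  proof (induction S arbitrary: a b rule: finite_psubset_induct)
    case (psubset S)
    show ?case
    proof (induction a)
      case 0
      show ?case by (simp add: rothe_0)
    next
      case (Suc a)
      have IH: "coef (setfun_var j * (rothe I x (a + x j) * rothe I x b)) S =
          coef (setfun_var j * rothe I x (a + x j + b)) S" for j
        unfolding coef_var_mult using psubset.IH[of "S - {j}"] by auto
      have "coef (rothe I x (Suc a) * rothe I x b) S =
          coef (rothe I x a * rothe I x b) S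
          + (\<Sum>j\<in>I. coef (setfun_var j * (rothe I x (a + x j) * rothe I x b)) S)"
        by (simp add: rothe_Suc[OF assms] distrib_right sum_distrib_right mult.assoc)
      also have "\<dots> = coef (rothe I x (Suc a + b)) S"
        by (simp add: Suc IH rothe_Suc[OF assms] add_ac)
      finally show ?case .
    qed
  qed
qed


section \<open>Central binomial coefficients\<close>

text \<open>The central binomial coefficients, which are the coefficients of (1 - 4
  x)^(-1/2).\<close>

definition central :: "nat \<Rightarrow> real" where
  "central n = fact (2 * n) / (fact n)\<^sup>2"

lemma central_0 [simp]: "central 0 = 1" by (simp add: central_def)
lemma central_pos: "central n > 0" by (simp add: central_def)

lemma central_Suc: "real (Suc n) * central (Suc n) = 2 * (2 * real n + 1) * central n"
proof -
  have "fact (2 * Suc n) = (2 * real n + 2) * (2 * real n + 1) * fact (2 * n)"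
    by (simp add: algebra_simps)
  then have "real (Suc n) * central (Suc n) = real (Suc n) * ((2 * real n + 2) * (2 * real n + 1) * fact (2 * n)) / (real (Suc n) * fact n)\<^sup>2"
    by (simp only: central_def fact_Suc of_nat_mult times_divide_eq_right)
  also have "\<dots> = 2 * (2 * real n + 1) * central n"
    by (simp add: central_def power_mult_distrib power2_eq_square divide_simps)
      (simp add: algebra_simps)
  finally show ?thesis .
qed

text \<open>The coefficients of (1 - 4 x)^(1/2); the value at 0 is 1.\<close>

definition sqrt_coeff :: "nat \<Rightarrow> real" where
  "sqrt_coeff n = - central n / (2 * real n - 1)"

lemma odd_nonzero: "2 * real n - 1 \<noteq> 0"
proof
  assume "2 * real n - 1 = 0"
  then have "real (2 * n) = real 1" by simp
  then show False by (simp only: of_nat_eq_iff) presburger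
qed

text \<open>The partial sums of this convolution have a closed form, so induction on l suffices. At
  l = n the factor n - l vanishes, which makes the two series inverse to each other; for l < n the
  value is the tail left by truncating (1 - 4 x)^(-1/2).\<close>

lemma central_sqrt_partial:
  assumes "n \<ge> 1" "l \<le> n"
  shows "(\<Sum>r\<le>l. central r * sqrt_coeff (n - r)) =
    - central l * central (n - l) * real (n - l) * (2 * real l + 1) / ((2 * real (n - l) - 1) * real n)"
  using assms(2)
proof (induction l)
  case 0
  then show ?case using assms(1) by (simp add: sqrt_coeff_def)
next
  case (Suc l)
  define k where "k = n - Suc l"
  have nl: "n - l = Suc k" and n: "n = l + k + 1" using Suc.prems by (auto simp: k_def)
  have s: "real (Suc k) * central (Suc k) = 2 * (2 * real k + 1) * central k"
      "2 * (2 * real l + 1) * central l = real (Suc l) * central (Suc l)"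
    using central_Suc by auto
  have nz: "2 * real k - 1 \<noteq> 0" "2 * real k + 1 \<noteq> 0" "real n \<noteq> 0" using odd_nonzero[of k] n by auto
  have "- central l * central (n - l) * real (n - l) * (2 * real l + 1) / ((2 * real (n - l) - 1) * real n)
    = - central l * (real (Suc k) * central (Suc k)) * (2 * real l + 1) / ((2 * real k + 1) * real n)"
    by (simp add: nl algebra_simps)
  also have "\<dots> = - (2 * (2 * real l + 1) * central l) * central k / real n"
    unfolding s(1) using nz by (simp add: divide_simps) (simp add: algebra_simps)
  also have "\<dots> = - real (Suc l) * central (Suc l) * central k / real n"
    by (simp only: s(2) minus_mult_left)
  finally have IH: "(\<Sum>r\<le>l. central r * sqrt_coeff (n - r)) = - real (Suc l) * central (Suc l) * central k / real n"
    using Suc by simp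
  have key: "- real (Suc l) / real n - 1 / (2 * real k - 1) =
      - real k * (2 * real (Suc l) + 1) / ((2 * real k - 1) * real n)"
    using nz by (simp add: divide_simps) (simp add: n algebra_simps)
  have "(\<Sum>r\<le>Suc l. central r * sqrt_coeff (n - r)) =
      (\<Sum>r\<le>l. central r * sqrt_coeff (n - r)) + central (Suc l) * sqrt_coeff k"
    by (simp add: k_def)
  also have "\<dots> = central (Suc l) * central k * (- real (Suc l) / real n - 1 / (2 * real k - 1))"
    unfolding IH by (simp add: sqrt_coeff_def algebra_simps del: of_nat_Suc)
  also have "\<dots> = - central (Suc l) * central k * real k * (2 * real (Suc l) + 1) / ((2 * real k - 1) * real n)"
    unfolding key by (simp add: algebra_simps)
  finally show ?case by (simp add: k_def)
qed

definition central_fps :: "real fps" where "central_fps = Abs_fps central"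
definition sqrt_fps :: "real fps" where "sqrt_fps = Abs_fps sqrt_coeff"

lemma central_times_sqrt: "central_fps * sqrt_fps = 1"
proof (rule fps_ext)
  fix n
  show "fps_nth (central_fps * sqrt_fps) n = fps_nth 1 n"
  proof (cases "n = 0")
    case False
    then show ?thesis using central_sqrt_partial[of n n]
      by (simp add: fps_mult_nth central_fps_def sqrt_fps_def atMost_atLeast0)
  qed (simp add: fps_mult_nth central_fps_def sqrt_fps_def sqrt_coeff_def)
qed

text \<open>Comparison of coefficients gives \<open>sqrt_fps\<close> as 1 - 4 x times
  \<open>central_fps\<close>; multiplying by \<open>sqrt_fps\<close> cancels the latter.\<close>

lemma sqrt_fps_square: "sqrt_fps * sqrt_fps = 1 - fps_const 4 * fps_X"
proof -
  have "sqrt_fps = (1 - fps_const 4 * fps_X) * central_fps"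
  proof (rule fps_ext)
    fix n
    show "fps_nth sqrt_fps n = fps_nth ((1 - fps_const 4 * fps_X) * central_fps) n"
    proof (cases n)
      case 0
      then show ?thesis by (simp add: sqrt_fps_def central_fps_def left_diff_distrib mult.assoc sqrt_coeff_def)
    next
      case (Suc m)
      have "central (Suc m) / real (2 * m + 1) * real (Suc m) = 2 * central m"
        using central_Suc[of m] by (simp add: divide_simps algebra_simps)
      then show ?thesis using Suc
        by (simp add: sqrt_fps_def central_fps_def left_diff_distrib mult.assoc sqrt_coeff_def)
          (simp add: field_simps)
    qed
  qed
  then have "sqrt_fps * sqrt_fps = (1 - fps_const 4 * fps_X) * (central_fps * sqrt_fps)"
    by (metis mult.assoc)
  then show ?thesis by (simp add: central_times_sqrt)
qed


section \<open>The kernel recursion for the genus zero monotone Hurwitz numbers\<close>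

lemma fps_mult_nth_above:
  fixes f g :: "'a::comm_ring_1 fps"
  assumes "\<And>m. m > K \<Longrightarrow> fps_nth f m = 0" "\<And>m. m > L \<Longrightarrow> fps_nth g m = 0"
  shows "m > K + L \<Longrightarrow> fps_nth (f * g) m = 0" "fps_nth (f * g) (K + L) = fps_nth f K * fps_nth g L"
proof -
  have "fps_nth (f * g) m = (\<Sum>i=0..m. if i = K \<and> m - i = L then fps_nth f K * fps_nth g L else 0)"
    if "m \<ge> K + L" for m
    unfolding fps_mult_nth
  proof (rule sum.cong)
    fix i assume "i \<in> {0..m}"
    then have "i > K \<or> m - i > L \<or> i = K \<and> m - i = L" using that by auto
    then consider "i > K" | "m - i > L" | "i = K" "m - i = L" by blast
    then show "fps_nth f i * fps_nth g (m - i) = (if i = K \<and> m - i = L then fps_nth f K * fps_nth g L else 0)"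
      by cases (auto simp: assms)
  qed simp
  note nth = this
  have "(\<Sum>i=0..K + L. if i = K \<and> K + L - i = L then fps_nth f K * fps_nth g L else 0) =
      (\<Sum>i=0..K + L. if i = K then fps_nth f K * fps_nth g L else 0)"
    by (rule sum.cong) auto
  with nth[of m] nth[of "K + L"]
  show "m > K + L \<Longrightarrow> fps_nth (f * g) m = 0" "fps_nth (f * g) (K + L) = fps_nth f K * fps_nth g L"
    by (auto intro!: sum.neutral)
qed

text \<open>The square of the linear form in \<open>A\<close> on the left is a polynomial of degree at most
  \<open>2 L + 1\<close>; comparing the coefficients above \<open>2 L\<close> yields the recursion for \<open>A\<close>.\<close>

lemma quadratic_method:
  fixes A V M :: "'a::comm_ring_1 fps"
  assumes eq: "(V - fps_const 2 * fps_X ^ L * A)\<^sup>2 = M\<^sup>2 * (1 - fps_const (4 * b) * fps_X)"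
    and V: "\<And>m. m > L \<Longrightarrow> fps_nth V m = 0" and M: "\<And>m. m > L \<Longrightarrow> fps_nth M m = 0"
    and b: "b * (fps_nth M L)\<^sup>2 = 1" and k: "k \<ge> 1"
  shows "4 * (fps_nth (V * A) (L + k)) = 4 * (fps_nth (A * A) k) + (if k = 1 then 4 else 0)"
proof -
  have "V\<^sup>2 - fps_const 4 * (fps_X ^ L * (V * A)) + fps_const 4 * (fps_X ^ (2 * L) * (A * A))
    = M\<^sup>2 - fps_const (4 * b) * (fps_X * M\<^sup>2)"
  proof -
    have c: "fps_const (4::'a) = fps_const 2 * fps_const 2" by simp
    define P where "P = (fps_X ^ L :: 'a fps)"
    have P: "fps_X ^ (2 * L) = P * P" by (simp add: mult_2 power_add P_def)
    have "V\<^sup>2 - fps_const 4 * (P * (V * A)) + fps_const 4 * (P * P * (A * A)) = (V - fps_const 2 * P * A)\<^sup>2"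
      unfolding c by (simp add: power2_eq_square algebra_simps del: fps_const_mult fps_const_mult_left)
         (simp add: numeral_fps_const[symmetric] algebra_simps)
    then have "V\<^sup>2 - fps_const 4 * (fps_X ^ L * (V * A)) + fps_const 4 * (fps_X ^ (2 * L) * (A * A))
       = (V - fps_const 2 * fps_X ^ L * A)\<^sup>2"
      unfolding P P_def .
    also note eq
    finally show ?thesis by (simp add: algebra_simps)
  qed
  \<comment> \<open>In degree 2 L + k the squares of V and M vanish, and X M^2 contributes only for
    k = 1, through the square of the top coefficient of M. The factor 4 is kept since the ring is
    arbitrary.\<close>
  then have "fps_nth (V\<^sup>2 - fps_const 4 * (fps_X ^ L * (V * A)) + fps_const 4 * (fps_X ^ (2 * L) * (A * A))) (2 * L + k)
    = fps_nth (M\<^sup>2 - fps_const (4 * b) * (fps_X * M\<^sup>2)) (2 * L + k)" by simp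
  moreover have "fps_nth (V\<^sup>2) (2 * L + k) = 0" "fps_nth (M\<^sup>2) (2 * L + k) = 0"
    using fps_mult_nth_above(1)[of L V L V] fps_mult_nth_above(1)[of L M L M] V M k
    by (simp_all add: power2_eq_square)
  moreover have "fps_nth (fps_X * M\<^sup>2) (2 * L + k) = (if k = 1 then (fps_nth M L)\<^sup>2 else 0)"
    using fps_mult_nth_above(1)[of L M L M "2 * L + k - 1"] fps_mult_nth_above(2)[of L M L M] M k
    by (auto simp: power2_eq_square mult_2)
  moreover have "2 * L + k - L = L + k" by simp
  ultimately have *: "- (4 * fps_nth (V * A) (L + k)) + 4 * fps_nth (A * A) k =
      - (4 * b * (if k = 1 then (fps_nth M L)\<^sup>2 else 0))"
    by (simp add: fps_X_power_mult_nth)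
  have "4 * b * (if k = 1 then (fps_nth M L)\<^sup>2 else 0) = 4 * (if k = 1 then b * (fps_nth M L)\<^sup>2 else 0)"
    by (simp add: mult.assoc)
  also have "\<dots> = (if k = 1 then 4 else 0)" using b by simp
  finally show ?thesis using * by (simp add: algebra_simps add_eq_0_iff)
qed


text \<open>Up to the sign and the weights of the cycles in \<open>S\<close>, \<open>hcoef lam k S\<close> is \<open>\<gamma>\<close> of a permutation with a
  distinguished cycle of length \<open>k\<close> and further cycles \<open>j \<in> S\<close> of length \<open>lam j\<close>. The
  subtraction does not truncate when \<open>k \<ge> 1\<close>.\<close>

definition hcoef :: "('i \<Rightarrow> nat) \<Rightarrow> nat \<Rightarrow> 'i set \<Rightarrow> real" where
  "hcoef lam k S = real k * central k * fact (2 * (k + sum lam S) + card S - 1 - 1) / fact (2 * (k + sum lam S))"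

section \<open>The explicit solution as a power series in the catalytic variable\<close>

context
  fixes I :: "'i set" and lam :: "'i \<Rightarrow> nat"
  assumes fin: "finite I"
begin

text \<open>The exponents 2 \<open>lam j\<close> + 1 are forced by the quadratic method. The top
  coefficient of M will be 1 - \<Sum> z_j B^(2 \<open>lam j\<close>), and comparing coefficients
  requires B times it to be 1, which is the equation for B.\<close>

definition Bpow :: "nat \<Rightarrow> 'i setfun" where
  "Bpow = rothe I (\<lambda>j. 2 * lam j + 1)"

lemma Bpow_add: "Bpow a * Bpow b = Bpow (a + b)"
  unfolding Bpow_def by (rule rothe_add[OF fin])

lemma Bpow_0: "Bpow 0 = 1"
  unfolding Bpow_def by (rule rothe_0)

lemma Bpow_1: "Bpow 1 = 1 + (\<Sum>j\<in>I. setfun_var j * Bpow (2 * lam j + 1))"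
  using rothe_Suc[OF fin, of "\<lambda>j. 2 * lam j + 1" 0] by (simp add: Bpow_def rothe_0)

text \<open>Substitution of B^2 X for X, which turns \<open>sqrt_fps\<close> into the square root of
  1 - 4 B^2 X.\<close>

definition dilate :: "real fps \<Rightarrow> 'i setfun fps" where
  "dilate f = Abs_fps (\<lambda>i. fps_nth f i *\<^sub>R Bpow (2 * i))"

lemma dilate_mult: "dilate (f * g) = dilate f * dilate g"
proof (rule fps_ext)
  fix n
  have "fps_nth (dilate f * dilate g) n =
      (\<Sum>i=0..n. (fps_nth f i * fps_nth g (n - i)) *\<^sub>R (Bpow (2 * i) * Bpow (2 * (n - i))))"
    by (simp add: fps_mult_nth dilate_def mult.commute)
  also have "\<dots> = (\<Sum>i=0..n. (fps_nth f i * fps_nth g (n - i)) *\<^sub>R Bpow (2 * n))"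
    unfolding Bpow_add by (rule sum.cong) (auto simp flip: distrib_left)
  also have "\<dots> = fps_nth (dilate (f * g)) n"
    by (simp add: dilate_def fps_mult_nth scaleR_sum_left)
  finally show "fps_nth (dilate (f * g)) n = fps_nth (dilate f * dilate g) n" by simp
qed

text \<open>The polynomial of degree l that inverts (1 - 4 x)^(1/2) up to order l. It makes the pole
  X^(-l) of the joining term reappear without lower-order corrections.\<close>

definition central_trunc :: "nat \<Rightarrow> real fps" where
  "central_trunc l = Abs_fps (\<lambda>i. if i \<le> l then central i else 0)"

lemma central_trunc_times_sqrt_nth:
  "n \<le> l \<Longrightarrow> fps_nth (central_trunc l * sqrt_fps) n = (if n = 0 then 1 else 0)"
  "k \<ge> 1 \<Longrightarrow> fps_nth (central_trunc l * sqrt_fps) (k + l) =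
    - central l * central k * real k * (2 * real l + 1) / ((2 * real k - 1) * (real k + real l))"
proof -
  assume "n \<le> l"
  then have "fps_nth (central_trunc l * sqrt_fps) n = fps_nth (central_fps * sqrt_fps) n"
    unfolding fps_mult_nth by (intro sum.cong) (auto simp: central_trunc_def central_fps_def)
  then show "fps_nth (central_trunc l * sqrt_fps) n = (if n = 0 then 1 else 0)"
    by (simp add: central_times_sqrt)
next
  assume k: "k \<ge> 1"
  have "fps_nth (central_trunc l * sqrt_fps) (k + l) = (\<Sum>r=0..k+l. if r \<in> {..l} then central r * sqrt_coeff (k + l - r) else 0)"
    unfolding fps_mult_nth by (intro sum.cong) (auto simp: central_trunc_def sqrt_fps_def)
  also have "\<dots> = (\<Sum>r\<in>{0..k+l} \<inter> {..l}. central r * sqrt_coeff (k + l - r))"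
    by (subst sum.inter_restrict) auto
  also have "{0..k+l} \<inter> {..l} = {..l}" by auto
  finally show "fps_nth (central_trunc l * sqrt_fps) (k + l) =
    - central l * central k * real k * (2 * real l + 1) / ((2 * real k - 1) * (real k + real l))"
    using central_sqrt_partial[of "k + l" l] k by simp
qed

text \<open>What remains of the product of the dilated truncation and square root after subtracting
  1 and dividing by X^l. It has no constant term, also for l = 0.\<close>

definition remainder_fps :: "nat \<Rightarrow> 'i setfun fps" where
  "remainder_fps l = Abs_fps (\<lambda>k. if k = 0 then 0 else fps_nth (central_trunc l * sqrt_fps) (k + l) *\<^sub>R Bpow (2 * (k + l)))"

lemma dilate_central_trunc: "dilate (central_trunc l) * dilate sqrt_fps = 1 + fps_X ^ l * remainder_fps l"
proof (unfold dilate_mult[symmetric], rule fps_ext)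
  fix n
  show "fps_nth (dilate (central_trunc l * sqrt_fps)) n = fps_nth (1 + fps_X ^ l * remainder_fps l) n"
  proof (cases "n \<le> l")
    case True
    then show ?thesis by (auto simp: dilate_def central_trunc_times_sqrt_nth fps_X_power_mult_nth remainder_fps_def Bpow_0)
  next
    case False
    then have "n = (n - l) + l" "n - l \<ge> 1" by auto
    then show ?thesis by (auto simp: dilate_def fps_X_power_mult_nth remainder_fps_def)
  qed
qed

text \<open>The factor 1 / \<open>central\<close> is the weight of a join in the recursion; it also
  cancels the top coefficient of the truncated series.\<close>

definition cycle_var :: "'i \<Rightarrow> 'i setfun" where
  "cycle_var j = (1 / central (lam j)) *\<^sub>R setfun_var j"

text \<open>Half of V - M (1 - 4 B^2 X)^(1/2), divided by X^L, for the polynomials V, M and the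
  exponent L of the next proof. The terms with negative powers of X have cancelled.\<close>

definition hurwitz_fps :: "'i setfun fps" where
  "hurwitz_fps = fps_const ((-1/2) *\<^sub>R 1) * (dilate sqrt_fps - 1 - (\<Sum>j\<in>I. fps_const (cycle_var j) * remainder_fps (lam j)))"

lemma hurwitz_fps_recursion:
  assumes k: "k \<ge> 1"
  shows "fps_nth hurwitz_fps k = fps_nth (hurwitz_fps * hurwitz_fps) k
    + (\<Sum>j\<in>I. cycle_var j * fps_nth hurwitz_fps (k + lam j)) + (if k = 1 then 1 else 0)"
proof -
  \<comment> \<open>L is large enough to clear all the poles X^(-\<open>lam j\<close>). V is X^L
    times the linear coefficient of the quadratic equation, and M has the dilated truncated series
    inserted in its joining terms.\<close>
  define L where "L = (\<Sum>j\<in>I. lam j)"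
  have L: "lam j \<le> L" if "j \<in> I" for j unfolding L_def using that fin by (simp add: member_le_sum)
  define V where "V = fps_X ^ L - (\<Sum>j\<in>I. fps_const (cycle_var j) * fps_X ^ (L - lam j))"
  define M where "M = fps_X ^ L - (\<Sum>j\<in>I. fps_const (cycle_var j) * (fps_X ^ (L - lam j) * dilate (central_trunc (lam j))))"
  have "fps_const (2 :: 'i setfun) * fps_const ((-1/2) *\<^sub>R 1) = -1"
  proof -
    have "(2 :: 'i setfun) * ((-1/2) *\<^sub>R 1) = of_real (2 * (-1/2))"
      by (simp only: of_real_mult of_real_numeral) (simp only: of_real_def)
    then have "(2 :: 'i setfun) * ((-1/2) *\<^sub>R 1) = -1" by (simp del: mult_scaleR_right)
    then show ?thesis by (simp flip: fps_const_neg)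
  qed
  then have "fps_const 2 * fps_X ^ L * hurwitz_fps =
      - (fps_X ^ L * (dilate sqrt_fps - 1 - (\<Sum>j\<in>I. fps_const (cycle_var j) * remainder_fps (lam j))))"
    unfolding hurwitz_fps_def by (metis (no_types, lifting) mult.assoc mult.commute mult_minus1)
  then have "V - fps_const 2 * fps_X ^ L * hurwitz_fps = fps_X ^ L * dilate sqrt_fps
      - (\<Sum>j\<in>I. fps_const (cycle_var j) * (fps_X ^ (L - lam j) + fps_X ^ L * remainder_fps (lam j)))"
    by (simp add: V_def algebra_simps sum.distrib sum_distrib_left)
  also have "(\<Sum>j\<in>I. fps_const (cycle_var j) * (fps_X ^ (L - lam j) + fps_X ^ L * remainder_fps (lam j))) =
      (\<Sum>j\<in>I. fps_const (cycle_var j) * (fps_X ^ (L - lam j) * (dilate (central_trunc (lam j)) * dilate sqrt_fps)))"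
  proof (rule sum.cong)
    fix j assume "j \<in> I"
    then have "fps_X ^ L = fps_X ^ (L - lam j) * (fps_X ^ lam j :: 'i setfun fps)"
      using L by (simp flip: power_add)
    then show "fps_const (cycle_var j) * (fps_X ^ (L - lam j) + fps_X ^ L * remainder_fps (lam j)) =
      fps_const (cycle_var j) * (fps_X ^ (L - lam j) * (dilate (central_trunc (lam j)) * dilate sqrt_fps))"
      by (simp only: dilate_central_trunc distrib_left mult.assoc mult_1_right)
  qed simp
  also have "fps_X ^ L * dilate sqrt_fps - \<dots> = M * dilate sqrt_fps"
    by (simp add: M_def left_diff_distrib sum_distrib_right mult.assoc)
  finally have "(V - fps_const 2 * fps_X ^ L * hurwitz_fps)\<^sup>2 = M\<^sup>2 * (dilate sqrt_fps * dilate sqrt_fps)"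
    by (simp add: power2_eq_square mult_ac)
  also have "dilate sqrt_fps * dilate sqrt_fps = 1 - fps_const (4 * Bpow 2) * fps_X"
  proof -
    have "dilate sqrt_fps * dilate sqrt_fps = dilate (1 - fps_const 4 * fps_X)"
      by (simp add: dilate_mult[symmetric] sqrt_fps_square)
    also have "\<dots> = 1 - fps_const (4 * Bpow 2) * fps_X"
      by (rule fps_ext) (auto simp: dilate_def Bpow_0 scaleR_conv_of_real le_Suc_eq)
    finally show ?thesis .
  qed
  finally have eq: "(V - fps_const 2 * fps_X ^ L * hurwitz_fps)\<^sup>2 = M\<^sup>2 * (1 - fps_const (4 * Bpow 2) * fps_X)" .
  have V0: "fps_nth V m = 0" if "m > L" for m
    using that by (auto simp: V_def fps_sum_nth intro!: sum.neutral)
  have M0: "fps_nth M m = 0" if "m > L" for m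
    using that L by (auto simp: M_def fps_sum_nth fps_X_power_mult_nth dilate_def central_trunc_def intro!: sum.neutral)
  have topM: "fps_nth M L = 1 - (\<Sum>j\<in>I. setfun_var j * Bpow (2 * lam j))"
    using L central_pos by (auto simp: M_def fps_sum_nth fps_X_power_mult_nth dilate_def central_trunc_def cycle_var_def
       less_imp_neq[symmetric] intro!: sum.cong)
  \<comment> \<open>Here the equation for B is used: B is the inverse of the top coefficient of
    M.\<close>
  have "Bpow 1 * fps_nth M L = Bpow 1 - (\<Sum>j\<in>I. setfun_var j * (Bpow 1 * Bpow (2 * lam j)))"
    unfolding topM by (simp add: right_diff_distrib sum_distrib_left mult_ac)
  also have "\<dots> = 1"
    by (simp only: Bpow_add add.commute[of 1]) (simp only: Bpow_1, simp)
  finally have "(Bpow 1 * fps_nth M L)\<^sup>2 = 1" by simp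
  moreover have "Bpow 2 = Bpow 1 * Bpow 1"
    using Bpow_add[of 1 1] by (simp add: numeral_2_eq_2)
  ultimately have b: "Bpow 2 * (fps_nth M L)\<^sup>2 = 1"
    by (simp add: power2_eq_square mult_ac)
  have "4 * (fps_nth (V * hurwitz_fps) (L + k)) = 4 * (fps_nth (hurwitz_fps * hurwitz_fps) k) + (if k = 1 then 4 else 0)"
    by (rule quadratic_method[OF eq V0 M0 b k])
  \<comment> \<open>The factor 4 is cancelled with the real scalars of the ring.\<close>
  moreover have quarter: "(1/4 :: real) *\<^sub>R (4 * y) = y" for y :: "'i setfun"
  proof -
    have "(4 :: 'i setfun) * y = 4 *\<^sub>R y" by (simp add: scaleR_conv_of_real)
    then show ?thesis by (simp del: mult_scaleR_right)
  qed
  moreover have "4 * fps_nth (hurwitz_fps * hurwitz_fps) k + (if k = 1 then 4 else 0) =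
      4 * (fps_nth (hurwitz_fps * hurwitz_fps) k + (if k = 1 then 1 else 0))" by (simp add: distrib_left)
  ultimately have "fps_nth (V * hurwitz_fps) (L + k) = fps_nth (hurwitz_fps * hurwitz_fps) k + (if k = 1 then 1 else 0)"
    by (metis (no_types, lifting))
  \<comment> \<open>The term of V for cycle j lies \<open>lam j\<close> below degree L, so it picks
    out the coefficient of the series at k + \<open>lam j\<close>.\<close>
  moreover have "fps_nth (V * hurwitz_fps) (L + k) = fps_nth hurwitz_fps k - (\<Sum>j\<in>I. cycle_var j * fps_nth hurwitz_fps (k + lam j))"
  proof -
    have "L + k - (L - lam j) = k + lam j" "\<not> L + k < L - lam j" if "j \<in> I" for j using L[OF that] by auto
    then show ?thesis
      by (simp add: V_def left_diff_distrib sum_distrib_right fps_sum_nth mult.assoc fps_X_power_mult_nth)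
  qed
  ultimately show ?thesis by (simp add: algebra_simps)
qed

lemma ffact_eq_fact: "ffact (real (n + r)) r = fact (n + r) / fact n"
proof (induction r)
  case (Suc r)
  have "ffact (real (n + Suc r)) (Suc r) = real (n + Suc r) * ffact (real (n + r)) r"
    by (simp add: ffact_Suc_left)
  then show ?case using Suc by simp
qed simp

lemma hurwitz_fps_nth:
  assumes "k \<ge> 1"
  shows "fps_nth hurwitz_fps k = (central k / (2 * (2 * real k - 1))) *\<^sub>R
    (Bpow (2 * k) - (\<Sum>j\<in>I. (real k * (2 * real (lam j) + 1) / (real k + real (lam j))) *\<^sub>R
       (setfun_var j * Bpow (2 * (k + lam j)))))"
proof -
  define c where "c = central k / (2 * real k - 1)"
  have "cycle_var j * fps_nth (remainder_fps (lam j)) k =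
    - (c * (real k * (2 * real (lam j) + 1) / (real k + real (lam j)))) *\<^sub>R
      (setfun_var j * Bpow (2 * (k + lam j)))" for j
    using assms central_pos[of "lam j"]
    by (simp add: cycle_var_def remainder_fps_def central_trunc_times_sqrt_nth(2) c_def)
  then have "fps_nth hurwitz_fps k = (-1/2) *\<^sub>R (- c *\<^sub>R Bpow (2 * k) - (\<Sum>j\<in>I. - (c * (real k * (2 * real (lam j) + 1) / (real k + real (lam j)))) *\<^sub>R
      (setfun_var j * Bpow (2 * (k + lam j)))))"
    using assms by (simp add: hurwitz_fps_def fps_sum_nth dilate_def sqrt_fps_def sqrt_coeff_def c_def)
  also have "\<dots> = (c / 2) *\<^sub>R (Bpow (2 * k) - (\<Sum>j\<in>I. (real k * (2 * real (lam j) + 1) / (real k + real (lam j))) *\<^sub>R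
       (setfun_var j * Bpow (2 * (k + lam j)))))"
    by (simp add: scaleR_right_diff_distrib scaleR_sum_right sum_negf)
  finally show ?thesis by (simp add: c_def)
qed

text \<open>The term B^(2k) and the joining corrections share a falling factorial P. Their
  difference is 2k (2k + X - 1) P - 2k X P = 2k (2k - 1) P, with X the sum of 2 \<open>lam j\<close>
  + 1 over S; this removes the denominator 2k - 1.\<close>

lemma coef_hurwitz_fps:
  assumes k: "k \<ge> 1" and S: "S \<subseteq> I"
  shows "coef (fps_nth hurwitz_fps k) S = hcoef lam k S"
proof -
  have finS: "finite S" using S fin finite_subset by auto
  have nz: "2 * real k - 1 \<noteq> 0" "real k > 0" using odd_nonzero k by auto
  have pos: "real k + real (lam j) > 0" for j using k by simp
  define y where "y j = real k * (2 * real (lam j) + 1) / (real k + real (lam j))" for j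
  have "coef (\<Sum>j\<in>I. y j *\<^sub>R (setfun_var j * Bpow (2 * (k + lam j)))) S =
    (\<Sum>j\<in>I. if j \<in> S then y j * coef (Bpow (2 * (k + lam j))) (S - {j}) else 0)"
    by (simp add: coef_var_mult if_distrib cong: if_cong)
  also have "\<dots> = (\<Sum>j\<in>S. y j * coef (Bpow (2 * (k + lam j))) (S - {j}))"
    using fin S by (simp add: sum.inter_restrict[symmetric] Int_absorb1)
  finally have A: "coef (fps_nth hurwitz_fps k) S = central k / (2 * (2 * real k - 1)) *
    (coef (Bpow (2 * k)) S - (\<Sum>j\<in>S. y j * coef (Bpow (2 * (k + lam j))) (S - {j})))"
    by (simp add: hurwitz_fps_nth[OF k] y_def)
  obtain k' where k': "k = Suc k'" using k by (cases k) auto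
  \<comment> \<open>The empty set and singletons are separate for the same reason as in
    \<open>rothe_Suc\<close>.\<close>
  consider "S = {}" | j where "S = {j}" | r where "card S = Suc (Suc r)"
    using finS by (metis card_0_eq card_1_singletonE not0_implies_Suc One_nat_def)
  then show ?thesis
  proof cases
    case 1
    have "fact (2 * k) = 2 * real k * (2 * real k - 1) * fact (2 * k - 1 - 1)"
      by (simp add: k' algebra_simps)
    then show ?thesis unfolding A using nz 1
      by (simp add: Bpow_def rothe.rep_eq hcoef_def)
  next
    case 2
    have "2 * k - y j = real k * (2 * real k - 1) / (real k + real (lam j))"
      using pos[of j] by (simp add: y_def field_simps)
    then have "coef (fps_nth hurwitz_fps k) S = central k / (2 * (2 * real k - 1)) * (real k * (2 * real k - 1) / (real k + real (lam j)))"
      unfolding A using 2 S by (simp add: Bpow_def rothe.rep_eq)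
    also have "\<dots> = real k * central k / (2 * (real k + real (lam j)))"
      using nz pos[of j] by (simp add: divide_simps) (simp add: algebra_simps)
    also have "\<dots> = hcoef lam k S"
      using 2 pos[of j] by (simp add: hcoef_def k')
    finally show ?thesis .
  next
    case (3 r)
    define X where "X = real (\<Sum>j\<in>S. 2 * lam j + 1)"
    define P where "P = ffact (2 * real k + X - 2) r"
    have ne: "S \<noteq> {}" using 3 by auto
    \<comment> \<open>The exponent 2 (k + \<open>lam j\<close>) of B cancels the denominator of y j,
      and only the numerator 2 \<open>lam j\<close> + 1 still depends on j.\<close>
    have "y j * coef (Bpow (2 * (k + lam j))) (S - {j}) = 2 * real k * P * real (2 * lam j + 1)"
      if j: "j \<in> S" for j
    proof -
      have c: "card (S - {j}) = Suc r" using 3 j finS by simp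
      then have "S - {j} \<noteq> {}" by (metis card.empty nat.distinct(1))
      moreover have "real (\<Sum>j\<in>S - {j}. 2 * lam j + 1) = X - real (2 * lam j + 1)"
      proof -
        have "(\<Sum>j\<in>S. 2 * lam j + 1) = (2 * lam j + 1) + (\<Sum>j\<in>S - {j}. 2 * lam j + 1)"
          by (rule sum.remove[OF finS j])
        then show ?thesis by (simp add: X_def del: sum.remove)
      qed
      ultimately have "coef (Bpow (2 * (k + lam j))) (S - {j}) = 2 * (real k + real (lam j)) * P"
        using S c finS by (auto simp: Bpow_def rothe.rep_eq P_def algebra_simps simp del: of_nat_sum)
      then show ?thesis using pos[of j] by (simp add: y_def field_simps)
    qed
    then have "(\<Sum>j\<in>S. y j * coef (Bpow (2 * (k + lam j))) (S - {j})) = 2 * real k * P * X"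
      by (simp add: X_def sum_distrib_left del: of_nat_Suc of_nat_add)
    moreover have "coef (Bpow (2 * k)) S = 2 * real k * ((2 * real k + X - 1) * P)"
      using S finS ne 3 unfolding Bpow_def rothe.rep_eq X_def[symmetric] P_def
      by (simp add: ffact_Suc_left)
    ultimately have "coef (Bpow (2 * k)) S - (\<Sum>j\<in>S. y j * coef (Bpow (2 * (k + lam j))) (S - {j})) =
        2 * real k * (2 * real k - 1) * P"
      by (simp only:) (simp add: algebra_simps)
    then have "coef (fps_nth hurwitz_fps k) S = central k / (2 * (2 * real k - 1)) * (2 * real k * (2 * real k - 1) * P)"
      unfolding A by simp
    also have "\<dots> = real k * central k * P" using nz by (simp add: divide_simps)
    also have "P = ffact (real (2 * (k + sum lam S) + r)) r"
    proof -
      have "(\<Sum>j\<in>S. 2 * lam j + 1) = 2 * sum lam S + Suc (Suc r)"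
        using 3 by (subst sum.distrib) (simp add: sum_distrib_left)
      then show ?thesis by (simp add: P_def X_def algebra_simps del: of_nat_sum)
    qed
    also have "\<dots> = fact (2 * (k + sum lam S) + r) / fact (2 * (k + sum lam S))"
      by (rule ffact_eq_fact)
    finally show ?thesis by (simp add: hcoef_def 3)
  qed
qed

lemma hurwitz_fps_nth_0: "fps_nth hurwitz_fps 0 = 0"
  by (simp add: hurwitz_fps_def dilate_def fps_sum_nth remainder_fps_def sqrt_fps_def sqrt_coeff_def Bpow_0)

end

text \<open>The coefficient at S of the power series recursion. The quadratic term cuts the
  distinguished cycle into lengths i and k - i and distributes the others; the linear term joins
  cycle j to it.\<close>

theorem hcoef_recursion:
  fixes lam :: "'i \<Rightarrow> nat"
  assumes fin: "finite S" and k: "k \<ge> 1"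
  shows "hcoef lam k S = (\<Sum>i=1..<k. \<Sum>T\<in>Pow S. hcoef lam i T * hcoef lam (k - i) (S - T))
    + (\<Sum>j\<in>S. hcoef lam (k + lam j) (S - {j}) / central (lam j))
    + (if k = 1 \<and> S = {} then 1 else 0)"
proof -
  note h = coef_hurwitz_fps[OF fin]
  have "coef (fps_nth (hurwitz_fps S lam * hurwitz_fps S lam) k) S =
    (\<Sum>i=0..k. coef (fps_nth (hurwitz_fps S lam) i * fps_nth (hurwitz_fps S lam) (k - i)) S)"
    by (simp add: fps_mult_nth)
  \<comment> \<open>The end terms vanish because the series has no constant term.\<close>
  also have "\<dots> = (\<Sum>i=1..<k. coef (fps_nth (hurwitz_fps S lam) i * fps_nth (hurwitz_fps S lam) (k - i)) S)"
  proof (rule sum.mono_neutral_right)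
    show "\<forall>i\<in>{0..k} - {1..<k}. coef (fps_nth (hurwitz_fps S lam) i * fps_nth (hurwitz_fps S lam) (k - i)) S = 0"
    proof
      fix i assume "i \<in> {0..k} - {1..<k}"
      then have "i = 0 \<or> k - i = 0" by auto
      then show "coef (fps_nth (hurwitz_fps S lam) i * fps_nth (hurwitz_fps S lam) (k - i)) S = 0"
        using hurwitz_fps_nth_0[OF fin, of lam] by auto
    qed
  qed auto
  also have "\<dots> = (\<Sum>i=1..<k. \<Sum>T\<in>Pow S. hcoef lam i T * hcoef lam (k - i) (S - T))"
    unfolding coef_mult by (intro sum.cong) (auto simp: h)
  finally have prod: "coef (fps_nth (hurwitz_fps S lam * hurwitz_fps S lam) k) S =
    (\<Sum>i=1..<k. \<Sum>T\<in>Pow S. hcoef lam i T * hcoef lam (k - i) (S - T))" .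
  have "coef (cycle_var lam j * fps_nth (hurwitz_fps S lam) (k + lam j)) S = hcoef lam (k + lam j) (S - {j}) / central (lam j)"
    if "j \<in> S" for j
    using that k by (simp add: cycle_var_def[OF fin] coef_var_mult h)
  then have "coef (\<Sum>j\<in>S. cycle_var lam j * fps_nth (hurwitz_fps S lam) (k + lam j)) S =
    (\<Sum>j\<in>S. hcoef lam (k + lam j) (S - {j}) / central (lam j))" by simp
  with prod h[OF k order.refl, of lam, symmetric] show ?thesis
    by (subst (1) h[OF k order.refl, of lam, symmetric], subst hurwitz_fps_recursion[OF fin k])
       (simp add: coef_1)
qed


section \<open>Moebius inversion\<close>

lemma finite_refines_between:
  assumes "finite A"
  shows "finite {R. refines A P R \<and> \<Phi> R}" "finite {R. refines A R P \<and> \<Phi> R}"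
  by (rule finite_partitions[OF assms], use refines_partition in blast)+

lemma part_mobius_sum:
  assumes fin: "finite A" and "refines A P Q"
  shows "(\<Sum>R | refines A P R \<and> refines A R Q. part_mobius A P R) = (if P = Q then 1 else 0)"
proof -
  have Q: "refines A Q Q" using refines_refl refines_partition(2)[OF assms(2)] .
  have split: "{R. refines A P R \<and> refines A R Q} = insert Q {R. refines A P R \<and> refines A R Q \<and> R \<noteq> Q}"
    using assms(2) Q by auto
  have "finite {R. refines A P R \<and> refines A R Q \<and> R \<noteq> Q}" by (rule finite_refines_between[OF fin])
  then have s: "(\<Sum>R | refines A P R \<and> refines A R Q. part_mobius A P R) =
    part_mobius A P Q + (\<Sum>R | refines A P R \<and> refines A R Q \<and> R \<noteq> Q. part_mobius A P R)"
    unfolding split by (subst sum.insert) auto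
  show ?thesis
  proof (cases "P = Q")
    case True
    have e: "{R. refines A P R \<and> refines A R Q \<and> R \<noteq> Q} = {}" using True refines_asym by blast
    have "(\<Sum>R | refines A P R \<and> refines A R Q \<and> R \<noteq> Q. part_mobius A P R) = 0" unfolding e by simp
    moreover have "part_mobius A P Q = 1" using True assms by (subst part_mobius.simps) simp
    ultimately show ?thesis using s True by simp
  next
    case False
    have "part_mobius A P Q = - (\<Sum>R | refines A P R \<and> refines A R Q \<and> R \<noteq> Q. part_mobius A P R)"
      using False assms by (subst part_mobius.simps) simp
    then show ?thesis using s False by simp
  qed
qed

text \<open>After exchanging the sums, f P is multiplied by the sum of the Moebius function over the
  upper argument in [P, R], which is 0 unless P = R.\<close>

lemma mobius_inversion:
  fixes f :: "'a set set \<Rightarrow> 'b::comm_ring_1"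
  assumes fin: "finite A" and LR: "refines A L R"
  shows "(\<Sum>Q | refines A L Q \<and> refines A Q R. \<Sum>P | refines A L P \<and> refines A P Q. of_int (part_mobius A P Q) * f P)
    = f R"
proof -
  let ?I = "{P. refines A L P \<and> refines A P R}"
  have finI: "finite ?I" by (rule finite_refines_between[OF fin])
  have "(\<Sum>Q\<in>?I. \<Sum>P | refines A L P \<and> refines A P Q. of_int (part_mobius A P Q) * f P) =
    (\<Sum>Q\<in>?I. \<Sum>P\<in>?I. if refines A P Q then of_int (part_mobius A P Q) * f P else 0)"
  proof (rule sum.cong[OF refl])
    fix Q assume "Q \<in> ?I"
    then have "{P. refines A L P \<and> refines A P Q} = {P \<in> ?I. refines A P Q}" using refines_trans by blast
    then show "(\<Sum>P | refines A L P \<and> refines A P Q. of_int (part_mobius A P Q) * f P) =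
      (\<Sum>P\<in>?I. if refines A P Q then of_int (part_mobius A P Q) * f P else 0)"
      using finI by (simp only: sum.inter_filter)
  qed
  also have "\<dots> = (\<Sum>P\<in>?I. \<Sum>Q\<in>?I. if refines A P Q then of_int (part_mobius A P Q) * f P else 0)"
    by (rule sum.swap)
  also have "\<dots> = (\<Sum>P\<in>?I. if P = R then f R else 0)"
  proof (rule sum.cong[OF refl])
    fix P assume P: "P \<in> ?I"
    then have "{Q \<in> ?I. refines A P Q} = {Q. refines A P Q \<and> refines A Q R}" using refines_trans by blast
    then have "(\<Sum>Q\<in>?I. if refines A P Q then of_int (part_mobius A P Q) * f P else 0) =
      (\<Sum>Q | refines A P Q \<and> refines A Q R. of_int (part_mobius A P Q) * f P)"
      using finI by (simp only: sum.inter_filter[symmetric])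
    also have "\<dots> = of_int (\<Sum>Q | refines A P Q \<and> refines A Q R. part_mobius A P Q) * f P"
      by (simp add: sum_distrib_right)
    also have "\<dots> = (if P = R then f R else 0)" using part_mobius_sum[OF fin] P by simp
    finally show "(\<Sum>Q\<in>?I. if refines A P Q then of_int (part_mobius A P Q) * f P else 0) = (if P = R then f R else 0)" .
  qed
  also have "\<dots> = f R" using finI LR refines_refl[OF refines_partition(2)[OF LR]] by simp
  finally show ?thesis .
qed

text \<open>The main device for identities between Moebius-inverted quantities: they are checked
  after summation over lower intervals. Induction on T removes all terms of the sum but the top
  one.\<close>

lemma interval_sums_unique:
  fixes g h :: "'a set set \<Rightarrow> 'b::ab_group_add"
  assumes fin: "finite A"
    and eq: "\<And>R. refines A L R \<Longrightarrow> refines A R T \<Longrightarrow>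
      (\<Sum>Q | refines A L Q \<and> refines A Q R. g Q) = (\<Sum>Q | refines A L Q \<and> refines A Q R. h Q)"
    and "refines A L T"
  shows "g T = h T"
  using \<open>refines A L T\<close> eq
proof (induction "card {Q. refines A Q T}" arbitrary: T rule: less_induct)
  case less
  have TT: "refines A T T" using refines_refl[OF refines_partition(2)[OF less.prems(1)]] .
  let ?J = "{Q. refines A L Q \<and> refines A Q T \<and> Q \<noteq> T}"
  have split: "{Q. refines A L Q \<and> refines A Q T} = insert T ?J" using less.prems(1) TT by auto
  have finJ: "finite ?J" by (rule finite_refines_between[OF fin])
  have "g Q = h Q" if Q: "Q \<in> ?J" for Q
  proof (rule less.hyps)
    have "{P. refines A P Q} \<subset> {P. refines A P T}"
      using Q refines_trans refines_asym TT by blast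
    moreover have "finite {P. refines A P T}" using finite_refines_between(2)[OF fin, of T "\<lambda>_. True"] by simp
    ultimately show "card {P. refines A P Q} < card {P. refines A P T}" by (rule psubset_card_mono[rotated])
    show "refines A L Q" using Q by simp
    show "(\<Sum>Q | refines A L Q \<and> refines A Q R. g Q) = (\<Sum>Q | refines A L Q \<and> refines A Q R. h Q)"
      if "refines A L R" "refines A R Q" for R
      using less.prems(2)[OF that(1)] refines_trans[OF that(2)] Q by simp
  qed
  then have "sum g ?J = sum h ?J" by (rule sum.cong[OF refl])
  moreover have "sum g (insert T ?J) = sum h (insert T ?J)"
    using less.prems(2)[OF less.prems(1) TT] unfolding split .
  ultimately show ?case using finJ by simp
qed


section \<open>Young subgroups\<close>

definition young :: "'a set \<Rightarrow> 'a set set \<Rightarrow> ('a \<Rightarrow> 'a) set" where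
  "young A P = {\<tau>. \<tau> permutes A \<and> refines A (cyc A \<tau>) P}"

definition block_of :: "'a set set \<Rightarrow> 'a \<Rightarrow> 'a set" where
  "block_of P x = {y. same_block P x y}"

lemma block_of_eq: "partition_on A P \<Longrightarrow> B \<in> P \<Longrightarrow> x \<in> B \<Longrightarrow> block_of P x = B"
  unfolding block_of_def by (rule same_block_Collect)

lemma block_of_in: "partition_on A P \<Longrightarrow> x \<in> A \<Longrightarrow> block_of P x \<in> P"
  unfolding block_of_def by (rule block_in_partition)

lemma block_of_self: "partition_on A P \<Longrightarrow> x \<in> A \<Longrightarrow> x \<in> block_of P x"
  by (simp add: block_of_def same_block_refl)

lemma block_subset: "partition_on A P \<Longrightarrow> B \<in> P \<Longrightarrow> B \<subseteq> A"
  by (auto simp: partition_on_def)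

lemma young_iff:
  assumes "finite A" "partition_on A P"
  shows "\<tau> \<in> young A P \<longleftrightarrow> \<tau> permutes A \<and> (\<forall>x\<in>A. same_block P x (\<tau> x))"
  using cyc_refines_iff[OF assms(1) _ assms(2)] by (auto simp: young_def)

lemma finite_young: "finite A \<Longrightarrow> finite (young A P)"
  unfolding young_def using finite_permutations[of A] by (rule rev_finite_subset) auto

lemma young_top:
  assumes "finite A" "A \<noteq> {}"
  shows "young A {A} = {\<tau>. \<tau> permutes A}"
  using young_iff[OF assms(1) partition_on_space[OF assms(2)]] permutes_in_image
  by (fastforce simp: same_block_def)

lemma young_comp:
  assumes "finite A" "partition_on A P" "\<tau> \<in> young A P" "\<nu> \<in> young A P"
  shows "\<tau> \<circ> \<nu> \<in> young A P"
proof -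
  have "same_block P x (\<tau> (\<nu> x))" if "x \<in> A" for x
    using that assms(3,4) same_block_trans[OF assms(2)] permutes_in_image
    unfolding young_iff[OF assms(1,2)] by metis
  then show ?thesis using assms(3,4) permutes_compose by (auto simp: young_iff[OF assms(1,2)])
qed

lemma young_inv:
  assumes "finite A" "\<tau> \<in> young A P"
  shows "perm_inv \<tau> \<in> young A P"
  using assms cyc_inv[OF assms(1), of \<tau>] permutes_inv by (auto simp: young_def)

section \<open>Deleting a point from a partition and from a Young subgroup\<close>

definition del_point :: "'a \<Rightarrow> 'a set set \<Rightarrow> 'a set set" where
  "del_point a P = (\<lambda>B. B - {a}) ` P - {{}}"

lemma partition_on_del_point:
  assumes "partition_on A P"
  shows "partition_on (A - {a}) (del_point a P)"
  unfolding del_point_def by (rule partition_on_transform[OF assms]) (auto simp: disjnt_iff)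

lemma same_block_del_point:
  "same_block (del_point a P) x y \<longleftrightarrow> same_block P x y \<and> x \<noteq> a \<and> y \<noteq> a"
proof
  assume "same_block P x y \<and> x \<noteq> a \<and> y \<noteq> a"
  then obtain B where "B \<in> P" "x \<in> B - {a}" "y \<in> B - {a}" by (auto simp: same_block_def)
  then show "same_block (del_point a P) x y"
    unfolding same_block_def del_point_def by (intro bexI[of _ "B - {a}"]) auto
qed (auto simp: same_block_def del_point_def)

lemma permutes_del_point:
  assumes "\<nu> permutes A" "\<nu> a = a"
  shows "\<nu> permutes (A - {a})"
  by (rule permutes_superset[OF assms(1)]) (use assms(2) in auto)

lemma young_del_point:
  assumes "finite A" "partition_on A P" "\<nu> \<in> young A P" "\<nu> a = a"
  shows "\<nu> \<in> young (A - {a}) (del_point a P)"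
proof -
  note p = young_iff[OF assms(1,2)] young_iff[OF _ partition_on_del_point[OF assms(2)], of a]
  have "\<nu> permutes (A - {a})" using permutes_del_point assms(3,4) by (auto simp: p(1))
  moreover from this have "\<nu> x \<noteq> a" if "x \<in> A - {a}" for x using that permutes_in_image by fastforce
  ultimately show ?thesis using assms by (auto simp: p same_block_del_point)
qed

lemma young_undel_point:
  assumes "finite A" "partition_on A P" "a \<in> A" "\<nu> \<in> young (A - {a}) (del_point a P)"
  shows "\<nu> \<in> young A P" "\<nu> a = a"
proof -
  note p = young_iff[OF assms(1,2)] young_iff[OF _ partition_on_del_point[OF assms(2)], of a]
  have \<nu>: "\<nu> permutes (A - {a})" "\<forall>x\<in>A - {a}. same_block (del_point a P) x (\<nu> x)"
    using assms(1,4) p(2) by auto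
  show a: "\<nu> a = a" using \<nu>(1) by (simp add: permutes_not_in)
  have "\<nu> permutes A" using permutes_subset[OF \<nu>(1)] by auto
  then show "\<nu> \<in> young A P"
    using \<nu>(2) a assms(3) same_block_refl[OF assms(2)] by (auto simp: p(1) same_block_del_point)
qed

lemma cyc_del_point:
  assumes "finite A" "\<nu> permutes A" "a \<in> A" "\<nu> a = a"
  shows "cyc A \<nu> = insert {a} (cyc (A - {a}) \<nu>)" "card (cyc A \<nu>) = card (cyc (A - {a}) \<nu>) + 1"
proof -
  have "orbit \<nu> a = {a}" using assms by (simp add: orbit_eq_singleton_iff)
  then show *: "cyc A \<nu> = insert {a} (cyc (A - {a}) \<nu>)"
    using assms(3) by (auto simp: cyc_def)
  have "partition_on (A - {a}) (cyc (A - {a}) \<nu>)"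
    using partition_on_cyc[of "A - {a}" \<nu>] permutes_del_point[OF assms(2,4)] assms(1) by auto
  then have "{a} \<notin> cyc (A - {a}) \<nu>" by (auto simp: partition_on_def)
  moreover have "finite (cyc (A - {a}) \<nu>)" using assms(1) by (simp add: cyc_def)
  ultimately show "card (cyc A \<nu>) = card (cyc (A - {a}) \<nu>) + 1" unfolding * by simp
qed

text \<open>The fixed point a is inserted into the cycle of i, so the number of cycles is the one of
  q without a.\<close>

lemma card_cyc_transpose_fixed:
  assumes "finite A" "q permutes A" "a \<in> A" "i \<in> A" "i \<noteq> a" "q a = a"
  shows "card (cyc A (Transposition.transpose i a \<circ> q)) = card (cyc (A - {a}) q)"
proof -
  have "\<not> same_block (cyc A q) i a"
    using assms orbit_eq_singleton_iff[of q a]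
    by (simp add: same_block_sym[of _ i] same_block_cyc[OF assms(1,2)])
  then show ?thesis
    using cyc_transpose(2)[OF assms(1,2,4,3,5)] cyc_del_point(2)[OF assms(1,2,3,6)] by linarith
qed

lemma young_transpose:
  assumes "finite A" "partition_on A P" "\<nu> \<in> young A P" "same_block P i a"
  shows "Transposition.transpose i a \<circ> \<nu> \<in> young A P"
proof -
  have ia: "i \<in> A" "a \<in> A" using same_block_in[OF assms(2,4)] by auto
  have "Transposition.transpose i a \<in> young A P"
    using ia assms(4) permutes_swap_id[of i A a] same_block_refl[OF assms(2)] same_block_sym[of P i a]
    by (auto simp: young_iff[OF assms(1,2)] Transposition.transpose_def)
  then show ?thesis using young_comp[OF assms(1,2)] assms(3) by blast
qed

text \<open>Coset decomposition by the stabiliser of a: each \<tau> is uniquely (i a) q with i =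
  \<tau> a and q fixing a.\<close>

lemma sum_young_decompose:
  fixes f :: "('a \<Rightarrow> 'a) \<Rightarrow> 'b::comm_monoid_add"
  assumes fin: "finite A" and P: "partition_on A P" and a: "a \<in> A"
  shows "(\<Sum>\<tau>\<in>young A P. f \<tau>) =
    (\<Sum>i\<in>block_of P a. \<Sum>q\<in>young (A - {a}) (del_point a P). f (Transposition.transpose i a \<circ> q))"
proof -
  let ?Y = "young (A - {a}) (del_point a P)"
  have "(\<Sum>\<tau>\<in>young A P. f \<tau>) =
    (\<Sum>(i, q)\<in>block_of P a \<times> ?Y. f (Transposition.transpose i a \<circ> q))"
  proof (rule sum.reindex_bij_witness[of _ "\<lambda>(i, q). Transposition.transpose i a \<circ> q"
        "\<lambda>\<tau>. (\<tau> a, Transposition.transpose (\<tau> a) a \<circ> \<tau>)"])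
    fix \<tau> assume \<tau>: "\<tau> \<in> young A P"
    then have sa: "same_block P (\<tau> a) a" using a same_block_sym[of P a "\<tau> a"] by (auto simp: young_iff[OF fin P])
    then have "Transposition.transpose (\<tau> a) a \<circ> \<tau> \<in> ?Y"
      by (intro young_del_point[OF fin P] young_transpose[OF fin P \<tau>]) simp_all
    then show "(\<tau> a, Transposition.transpose (\<tau> a) a \<circ> \<tau>) \<in> block_of P a \<times> ?Y"
      using sa same_block_sym[of P a "\<tau> a"] by (auto simp: block_of_def)
    show "(case (\<tau> a, Transposition.transpose (\<tau> a) a \<circ> \<tau>) of (i, q) \<Rightarrow> Transposition.transpose i a \<circ> q) = \<tau>"
      by (simp add: fun_eq_iff)
  next
    fix x assume x: "x \<in> block_of P a \<times> ?Y"
    obtain i q where iq: "x = (i, q)" "same_block P i a" "q \<in> ?Y" using x same_block_sym[of P a] by (auto simp: block_of_def)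
    note q = young_undel_point[OF fin P a iq(3)]
    show "(case x of (i, q) \<Rightarrow> Transposition.transpose i a \<circ> q) \<in> young A P"
      using young_transpose[OF fin P q(1) iq(2)] iq(1) by simp
    show "((case x of (i, q) \<Rightarrow> Transposition.transpose i a \<circ> q) a,
        Transposition.transpose ((case x of (i, q) \<Rightarrow> Transposition.transpose i a \<circ> q) a) a \<circ>
        (case x of (i, q) \<Rightarrow> Transposition.transpose i a \<circ> q)) = x"
      using iq(1) q(2) by (simp add: fun_eq_iff)
  next
    fix \<tau> assume "\<tau> \<in> young A P"
    show "(case (\<tau> a, Transposition.transpose (\<tau> a) a \<circ> \<tau>) of (i, q) \<Rightarrow> f (Transposition.transpose i a \<circ> q)) = f \<tau>"
      by (simp add: comp_assoc[symmetric])
  qed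
  then show ?thesis by (simp add: sum.cartesian_product)
qed

text \<open>In the coset decomposition the choice i = a gives one cycle more than the other choices.
  The power of z belonging to q can be taken out, and the remaining sum over i is the left-hand side
  of \<open>rec\<close> at q \<nu>. What is left is the inverse on the stabiliser of a.\<close>

lemma young_inverse_step:
  fixes w w' :: "('a \<Rightarrow> 'a) \<Rightarrow> real" and z :: real
  assumes fin: "finite A" and P: "partition_on A P" and a: "a \<in> A"
    and rec: "\<And>\<nu>. \<nu> \<in> young A P \<Longrightarrow>
      z * w \<nu> + (\<Sum>i\<in>block_of P a - {a}. w (Transposition.transpose i a \<circ> \<nu>)) = (if \<nu> a = a then w' \<nu> else 0)"
    and inv: "\<And>\<nu>. \<nu> \<in> young (A - {a}) (del_point a P) \<Longrightarrow>
      (\<Sum>\<tau>\<in>young (A - {a}) (del_point a P). z ^ card (cyc (A - {a}) \<tau>) * w' (\<tau> \<circ> \<nu>)) = (if \<nu> = id then 1 else 0)"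
    and \<nu>: "\<nu> \<in> young A P"
  shows "(\<Sum>\<tau>\<in>young A P. z ^ card (cyc A \<tau>) * w (\<tau> \<circ> \<nu>)) = (if \<nu> = id then 1 else 0)"
proof -
  let ?Y = "young (A - {a}) (del_point a P)"
  have finB: "finite (block_of P a)" using block_subset[OF P block_of_in[OF P a]] fin finite_subset by blast
  have "(\<Sum>\<tau>\<in>young A P. z ^ card (cyc A \<tau>) * w (\<tau> \<circ> \<nu>)) =
    (\<Sum>q\<in>?Y. \<Sum>i\<in>block_of P a. z ^ card (cyc A (Transposition.transpose i a \<circ> q)) * w (Transposition.transpose i a \<circ> q \<circ> \<nu>))"
    unfolding sum_young_decompose[OF fin P a] by (rule sum.swap)
  also have "\<dots> = (\<Sum>q\<in>?Y. z ^ card (cyc (A - {a}) q) * (if \<nu> a = a then w' (q \<circ> \<nu>) else 0))"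
  proof (rule sum.cong[OF refl])
    fix q assume "q \<in> ?Y"
    note q = young_undel_point[OF fin P a this]
    have qA: "q permutes A" using q by (simp add: young_def)
    have fixed: "(q \<circ> \<nu>) a = a \<longleftrightarrow> \<nu> a = a" using q(2) permutes_inj[OF qA] by (metis comp_apply injD)
    have "(\<Sum>i\<in>block_of P a. z ^ card (cyc A (Transposition.transpose i a \<circ> q)) * w (Transposition.transpose i a \<circ> q \<circ> \<nu>))
      = z ^ card (cyc A q) * w (q \<circ> \<nu>) + (\<Sum>i\<in>block_of P a - {a}. z ^ card (cyc A (Transposition.transpose i a \<circ> q)) * w (Transposition.transpose i a \<circ> q \<circ> \<nu>))"
      by (subst sum.remove[OF finB block_of_self[OF P a]]) simp
    also have "(\<Sum>i\<in>block_of P a - {a}. z ^ card (cyc A (Transposition.transpose i a \<circ> q)) * w (Transposition.transpose i a \<circ> q \<circ> \<nu>))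
      = (\<Sum>i\<in>block_of P a - {a}. z ^ card (cyc (A - {a}) q) * w (Transposition.transpose i a \<circ> (q \<circ> \<nu>)))"
    proof (rule sum.cong[OF refl])
      fix i assume "i \<in> block_of P a - {a}"
      then have "i \<in> A" "i \<noteq> a" using block_subset[OF P block_of_in[OF P a]] by auto
      then show "z ^ card (cyc A (Transposition.transpose i a \<circ> q)) * w (Transposition.transpose i a \<circ> q \<circ> \<nu>)
        = z ^ card (cyc (A - {a}) q) * w (Transposition.transpose i a \<circ> (q \<circ> \<nu>))"
        using card_cyc_transpose_fixed[OF fin qA a _ _ q(2)] by (simp add: comp_assoc)
    qed
    also have "z ^ card (cyc A q) * w (q \<circ> \<nu>) + \<dots> = z ^ card (cyc (A - {a}) q) *
        (z * w (q \<circ> \<nu>) + (\<Sum>i\<in>block_of P a - {a}. w (Transposition.transpose i a \<circ> (q \<circ> \<nu>))))"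
      using cyc_del_point(2)[OF fin qA a q(2)] by (simp add: algebra_simps sum_distrib_left)
    also have "\<dots> = z ^ card (cyc (A - {a}) q) * (if \<nu> a = a then w' (q \<circ> \<nu>) else 0)"
      using rec[OF young_comp[OF fin P q(1) \<nu>]] fixed by simp
    finally show "(\<Sum>i\<in>block_of P a. z ^ card (cyc A (Transposition.transpose i a \<circ> q)) * w (Transposition.transpose i a \<circ> q \<circ> \<nu>))
      = z ^ card (cyc (A - {a}) q) * (if \<nu> a = a then w' (q \<circ> \<nu>) else 0)" .
  qed
  also have "\<dots> = (if \<nu> = id then 1 else 0)"
  \<comment> \<open>If \<nu> moves a, it is not the identity and all terms are 0.\<close>
  proof (cases "\<nu> a = a")
    case True
    then show ?thesis using inv[OF young_del_point[OF fin P \<nu> True]] by simp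
  qed auto
  finally show ?thesis .
qed


section \<open>The Weingarten function\<close>

lemma cyc_conj:
  assumes fin: "finite A" and p: "p permutes A" and \<rho>: "\<rho> permutes A"
  shows "card (cyc A (perm_inv p \<circ> \<rho> \<circ> p)) = card (cyc A \<rho>)"
proof -
  let ?f = "perm_inv p"
  have f: "?f permutes A" using p by (rule permutes_inv)
  have "?f ` orbit \<rho> x = orbit (?f \<circ> \<rho> \<circ> p) (?f x)" if "x \<in> A" for x
    using orbit_permutes[OF fin \<rho> that] permutes_inverses[OF p] by (intro orbit_inverse) auto
  then have "(\<lambda>C. ?f ` C) ` cyc A \<rho> = (\<lambda>x. orbit (?f \<circ> \<rho> \<circ> p) (?f x)) ` A"
    by (auto simp: cyc_def image_image)
  also have "\<dots> = cyc A (?f \<circ> \<rho> \<circ> p)"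
    using permutes_image[OF f] by (metis (no_types, lifting) cyc_def image_cong image_image)
  finally have "cyc A (?f \<circ> \<rho> \<circ> p) = (\<lambda>C. ?f ` C) ` cyc A \<rho>" by simp
  moreover have "inj_on (\<lambda>C. ?f ` C) (cyc A \<rho>)"
    using permutes_inj[OF f] by (auto simp: inj_on_def inj_image_eq_iff)
  ultimately show ?thesis by (simp add: card_image)
qed

text \<open>The function N^# is invariant under conjugation and inversion, so it can be moved to the
  other side of the convolution. In this form the coset decomposition applies.\<close>

lemma perm_convolution_eq:
  assumes fin: "finite A" and \<nu>: "\<nu> permutes A"
  shows "perm_convolution A w (\<lambda>\<tau>. real N ^ card (cyc A \<tau>)) \<nu> =
    (\<Sum>\<rho> | \<rho> permutes A. real N ^ card (cyc A \<rho>) * w (\<rho> \<circ> \<nu>))"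
  unfolding perm_convolution_def
proof (rule sum.reindex_bij_witness[of _ "\<lambda>\<rho>. \<rho> \<circ> \<nu>" "\<lambda>\<tau>. \<tau> \<circ> perm_inv \<nu>"])
  fix \<tau> assume "\<tau> \<in> {\<tau>. \<tau> permutes A}"
  then have \<tau>: "\<tau> permutes A" by simp
  then show "\<tau> \<circ> perm_inv \<nu> \<in> {\<rho>. \<rho> permutes A}"
    using permutes_compose[OF permutes_inv[OF \<nu>] \<tau>] by simp
  show t: "\<tau> \<circ> perm_inv \<nu> \<circ> \<nu> = \<tau>" using permutes_inv_o(2)[OF \<nu>] by (simp add: comp_assoc)
  let ?\<rho> = "\<tau> \<circ> perm_inv \<nu>"
  have \<rho>: "?\<rho> permutes A" using permutes_compose[OF permutes_inv[OF \<nu>] \<tau>] .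
  have "perm_inv ?\<rho> = \<nu> \<circ> perm_inv \<tau>"
    using permutes_bij[OF \<tau>] permutes_bij[OF permutes_inv[OF \<nu>]] permutes_inv_inv[OF \<nu>]
    by (simp add: o_inv_distrib)
  then have "perm_inv \<tau> \<circ> \<nu> = perm_inv \<nu> \<circ> perm_inv ?\<rho> \<circ> \<nu>"
    using permutes_inv_o(2)[OF \<nu>] by (simp add: comp_assoc[symmetric])
  then have "card (cyc A (perm_inv \<tau> \<circ> \<nu>)) = card (cyc A ?\<rho>)"
    using cyc_conj[OF fin \<nu> permutes_inv[OF \<rho>]] cyc_inv[OF fin \<rho>] by simp
  then show "real N ^ card (cyc A (\<tau> \<circ> perm_inv \<nu>)) * w (\<tau> \<circ> perm_inv \<nu> \<circ> \<nu>) =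
      w \<tau> * real N ^ card (cyc A (perm_inv \<tau> \<circ> \<nu>))"
    unfolding t by simp
next
  fix \<rho> assume \<rho>: "\<rho> \<in> {\<rho>. \<rho> permutes A}"
  then show "\<rho> \<circ> \<nu> \<in> {\<tau>. \<tau> permutes A}" using permutes_compose[OF \<nu>] by simp
  show "\<rho> \<circ> \<nu> \<circ> perm_inv \<nu> = \<rho>" using permutes_inv_o(1)[OF \<nu>] by (simp add: comp_assoc)
qed

definition is_weingarten :: "nat \<Rightarrow> 'a set \<Rightarrow> (('a \<Rightarrow> 'a) \<Rightarrow> real) \<Rightarrow> bool" where
  "is_weingarten N A w \<longleftrightarrow> (\<forall>\<nu>. \<not> \<nu> permutes A \<longrightarrow> w \<nu> = 0) \<and>
    (\<forall>\<nu>. \<nu> permutes A \<longrightarrow>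
      (\<Sum>\<rho> | \<rho> permutes A. real N ^ card (cyc A \<rho>) * w (\<rho> \<circ> \<nu>)) = (if \<nu> = id then 1 else 0))"

text \<open>By \<open>perm_convolution_eq\<close> a solution inverts N^# from both sides. The
  difference of two solutions is annihilated by N^#, and convolving with one of the solutions gives
  the difference back.\<close>

lemma is_weingarten_unique:
  assumes fin: "finite A" and v: "is_weingarten N A v" and w: "is_weingarten N A w"
  shows "v = w"
proof
  fix \<mu>
  show "v \<mu> = w \<mu>"
  proof (cases "\<mu> permutes A")
    case False
    then show ?thesis using v w by (auto simp: is_weingarten_def)
  next
    case \<mu>: True
    let ?S = "{\<rho>. \<rho> permutes A}" and ?Z = "\<lambda>\<tau>. real N ^ card (cyc A \<tau>)"
    have finS: "finite ?S" using finite_permutations[OF fin] .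
    define d where "d \<nu> = v \<nu> - w \<nu>" for \<nu>
    have d0: "(\<Sum>\<rho>\<in>?S. ?Z \<rho> * d (\<rho> \<circ> \<nu>)) = 0" if "\<nu> permutes A" for \<nu>
      using v w that by (simp add: is_weingarten_def d_def right_diff_distrib sum_subtractf)
    have w1: "(\<Sum>\<tau>\<in>?S. w \<tau> * ?Z (perm_inv \<tau> \<circ> \<rho>)) = (if \<rho> = id then 1 else 0)" if "\<rho> permutes A" for \<rho>
      using perm_convolution_eq[OF fin that, of w N] w that by (simp add: is_weingarten_def perm_convolution_def)
    have "d \<mu> = (\<Sum>\<rho>\<in>?S. if \<rho> = id then d \<mu> else 0)" using finS permutes_id by simp
    also have "\<dots> = (\<Sum>\<rho>\<in>?S. (\<Sum>\<tau>\<in>?S. w \<tau> * ?Z (perm_inv \<tau> \<circ> \<rho>)) * d (\<rho> \<circ> \<mu>))"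
      using w1 by (intro sum.cong) auto
    also have "\<dots> = (\<Sum>\<tau>\<in>?S. w \<tau> * (\<Sum>\<rho>\<in>?S. ?Z (perm_inv \<tau> \<circ> \<rho>) * d (\<rho> \<circ> \<mu>)))"
      unfolding sum_distrib_right sum_distrib_left by (subst sum.swap) (simp add: mult.assoc)
    \<comment> \<open>Substitution and invariance under conjugation turn the inner sum into the
      convolution of N^# with d at \<tau> \<mu>.\<close>
    also have "\<dots> = (\<Sum>\<tau>\<in>?S. 0)"
    proof (rule sum.cong[OF refl])
      fix \<tau> assume "\<tau> \<in> ?S"
      then have \<tau>: "\<tau> permutes A" by simp
      have "(\<Sum>\<rho>\<in>?S. ?Z (perm_inv \<tau> \<circ> \<rho>) * d (\<rho> \<circ> \<mu>)) = (\<Sum>\<rho>\<in>?S. ?Z \<rho> * d (\<rho> \<circ> (\<tau> \<circ> \<mu>)))"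
      proof (rule sum.reindex_bij_witness[of _ "\<lambda>\<rho>. \<rho> \<circ> \<tau>" "\<lambda>\<rho>. \<rho> \<circ> perm_inv \<tau>"])
        fix \<rho> assume "\<rho> \<in> ?S"
        then have \<rho>: "\<rho> permutes A" by simp
        show "\<rho> \<circ> perm_inv \<tau> \<circ> \<tau> = \<rho>" "\<rho> \<circ> \<tau> \<circ> perm_inv \<tau> = \<rho>"
          using permutes_inv_o[OF \<tau>] by (simp_all add: comp_assoc)
        show i: "\<rho> \<circ> perm_inv \<tau> \<in> ?S" "\<rho> \<circ> \<tau> \<in> ?S"
          using permutes_compose[OF permutes_inv[OF \<tau>] \<rho>] permutes_compose[OF \<tau> \<rho>] by auto
        have "perm_inv \<tau> \<circ> (\<rho> \<circ> perm_inv \<tau>) \<circ> \<tau> = perm_inv \<tau> \<circ> \<rho>"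
          using permutes_inv_o(2)[OF \<tau>] by (simp add: comp_assoc)
        then have "card (cyc A (\<rho> \<circ> perm_inv \<tau>)) = card (cyc A (perm_inv \<tau> \<circ> \<rho>))"
          using cyc_conj[OF fin \<tau>, of "\<rho> \<circ> perm_inv \<tau>"] i by simp
        moreover have "\<rho> \<circ> perm_inv \<tau> \<circ> (\<tau> \<circ> \<mu>) = \<rho> \<circ> \<mu>"
          using permutes_inv_o(2)[OF \<tau>] by (metis comp_assoc comp_id)
        ultimately show "?Z (\<rho> \<circ> perm_inv \<tau>) * d (\<rho> \<circ> perm_inv \<tau> \<circ> (\<tau> \<circ> \<mu>)) = ?Z (perm_inv \<tau> \<circ> \<rho>) * d (\<rho> \<circ> \<mu>)"
          by simp
      qed
      also have "\<dots> = 0" using d0[OF permutes_compose[OF \<mu> \<tau>]] .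
      finally show "w \<tau> * (\<Sum>\<rho>\<in>?S. ?Z (perm_inv \<tau> \<circ> \<rho>) * d (\<rho> \<circ> \<mu>)) = 0" by simp
    qed
    finally show ?thesis by (simp add: d_def)
  qed
qed


lemma young_del_top:
  assumes "finite A" "a \<in> A"
  shows "young (A - {a}) (del_point a {A}) = {\<tau>. \<tau> permutes (A - {a})}"
proof (cases "A = {a}")
  case True
  have "cyc {} id = ({} :: 'a set set)" by (simp add: cyc_def)
  then show ?thesis using True by (auto simp: young_def del_point_def refines_def partition_on_empty)
next
  case False
  then have "A - {a} \<noteq> {}" using assms(2) by auto
  then show ?thesis using young_top[of "A - {a}"] assms(1) by (simp add: del_point_def)
qed

text \<open>The function \<open>u\<close> is the Neumann series of the inverse of \<open>N\<close> plus the Jucys--Murphy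
  element of \<open>a\<close>, applied to \<open>w'\<close>.\<close>

lemma is_weingarten_step:
  fixes A :: "'a set"
  assumes fin: "finite A" and a: "a \<in> A" and N: "card A \<le> N" and w': "is_weingarten N (A - {a}) w'"
  obtains u where "is_weingarten N A u"
    "\<And>\<nu>. real N * u \<nu> + (\<Sum>i\<in>A - {a}. u (Transposition.transpose i a \<circ> \<nu>)) = w' \<nu>"
proof -
  define m where "m = real (card (A - {a}))"
  \<comment> \<open>This strict inequality is where N \<ge> \<open>card A\<close> enters.\<close>
  have m: "0 \<le> m" "m < real N"
    using card_Suc_Diff1[OF fin a] N by (auto simp: m_def)
  then have N0: "real N > 0" by linarith
  define J where "J f \<nu> = (\<Sum>i\<in>A - {a}. f (Transposition.transpose i a \<circ> \<nu>))"
    for f :: "('a \<Rightarrow> 'a) \<Rightarrow> real" and \<nu>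
  define g where "g k = (J ^^ k) w'" for k
  have g0: "g 0 = w'" and gS: "g (Suc k) = J (g k)" for k by (simp_all add: g_def)
  define K where "K = (\<Sum>\<nu> | \<nu> permutes (A - {a}). \<bar>w' \<nu>\<bar>)"
  have finS: "finite {\<nu>. \<nu> permutes (A - {a})}" using finite_permutations fin by auto
  have K: "\<bar>w' \<nu>\<bar> \<le> K" for \<nu>
  proof (cases "\<nu> permutes (A - {a})")
    case True
    then show ?thesis unfolding K_def using member_le_sum[OF _ _ finS, of \<nu> "\<lambda>\<nu>. \<bar>w' \<nu>\<bar>"] by simp
  next
    case False
    then show ?thesis using w' by (simp add: is_weingarten_def K_def sum_nonneg)
  qed
  \<comment> \<open>J is a sum over \<open>card A\<close> - 1 transpositions, so each application
    costs a factor of at most m < N and the Neumann series is dominated by a geometric one.\<close>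
  have gbound: "\<bar>g k \<nu>\<bar> \<le> m ^ k * K" for k \<nu>
  proof (induction k arbitrary: \<nu>)
    case (Suc k)
    have "\<bar>g (Suc k) \<nu>\<bar> \<le> (\<Sum>i\<in>A - {a}. \<bar>g k (Transposition.transpose i a \<circ> \<nu>)\<bar>)"
      unfolding gS J_def by (rule sum_abs)
    also have "\<dots> \<le> (\<Sum>i\<in>A - {a}. m ^ k * K)" by (rule sum_mono) (rule Suc)
    finally show ?case by (simp add: m_def)
  qed (simp add: g0 K)
  define t where "t \<nu> k = (-1) ^ k / real N ^ (k + 1) * g k \<nu>" for \<nu> k
  have summable: "summable (t \<nu>)" for \<nu>
  proof (rule summable_comparison_test)
    show "\<exists>N'. \<forall>k\<ge>N'. norm (t \<nu> k) \<le> K / real N * (m / real N) ^ k"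
    proof (intro exI allI impI)
      fix k
      have "norm (t \<nu> k) = \<bar>g k \<nu>\<bar> / real N ^ (k + 1)" using N0 by (simp add: t_def abs_mult power_abs)
      also have "\<dots> \<le> m ^ k * K / real N ^ (k + 1)" using gbound N0 by (intro divide_right_mono) auto
      also have "\<dots> = K / real N * (m / real N) ^ k" by (simp add: power_divide)
      finally show "norm (t \<nu> k) \<le> K / real N * (m / real N) ^ k" .
    qed
    show "summable (\<lambda>k. K / real N * (m / real N) ^ k)"
      using m by (intro summable_mult summable_geometric) auto
  qed
  define u where "u \<nu> = (\<Sum>k. t \<nu> k)" for \<nu>
  have rec: "real N * u \<nu> + (\<Sum>i\<in>A - {a}. u (Transposition.transpose i a \<circ> \<nu>)) = w' \<nu>" for \<nu>
  proof -
    have "(\<Sum>i\<in>A - {a}. u (Transposition.transpose i a \<circ> \<nu>)) =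
        (\<Sum>k. \<Sum>i\<in>A - {a}. t (Transposition.transpose i a \<circ> \<nu>) k)"
      unfolding u_def by (rule suminf_sum[symmetric]) (rule summable)
    also have "\<dots> = (\<Sum>k. - real N * t \<nu> (Suc k))"
    proof (rule suminf_cong)
      fix k
      have "(\<Sum>i\<in>A - {a}. t (Transposition.transpose i a \<circ> \<nu>) k) = (-1) ^ k / real N ^ (k + 1) * g (Suc k) \<nu>"
        by (simp add: t_def gS J_def sum_distrib_left)
      also have "\<dots> = - real N * t \<nu> (Suc k)" using N0 by (simp add: t_def)
      finally show "(\<Sum>i\<in>A - {a}. t (Transposition.transpose i a \<circ> \<nu>) k) = - real N * t \<nu> (Suc k)" .
    qed
    also have "\<dots> = - real N * (\<Sum>k. t \<nu> (Suc k))"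
      using summable[of \<nu>] by (intro suminf_mult) (simp add: summable_Suc_iff)
    also have "(\<Sum>k. t \<nu> (Suc k)) = u \<nu> - t \<nu> 0" unfolding u_def by (rule suminf_split_head[OF summable])
    finally have eq: "(\<Sum>i\<in>A - {a}. u (Transposition.transpose i a \<circ> \<nu>)) = - real N * (u \<nu> - t \<nu> 0)" .
    show ?thesis unfolding eq using N0 by (simp add: t_def g0 algebra_simps)
  qed
  have gzero: "g k \<nu> = 0" if "\<not> \<nu> permutes A" for k \<nu>
    using that
  proof (induction k arbitrary: \<nu>)
    case 0
    then have "\<not> \<nu> permutes (A - {a})" using permutes_subset[of \<nu> "A - {a}" A] by auto
    then show ?case using w' by (simp add: g0 is_weingarten_def)
  next
    case (Suc k)
    have "\<not> (Transposition.transpose i a \<circ> \<nu>) permutes A" if "i \<in> A - {a}" for i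
    proof
      assume "(Transposition.transpose i a \<circ> \<nu>) permutes A"
      then have "Transposition.transpose i a \<circ> (Transposition.transpose i a \<circ> \<nu>) permutes A"
        by (rule transpose_comp_permutes) (use that a in auto)
      then show False using Suc.prems by (simp add: comp_assoc[symmetric])
    qed
    then show ?case unfolding gS J_def by (intro sum.neutral ballI Suc.IH) blast
  qed
  have "is_weingarten N A u"
    unfolding is_weingarten_def
  proof (intro conjI allI impI)
    show "u \<nu> = 0" if "\<not> \<nu> permutes A" for \<nu> using gzero[OF that] by (simp add: u_def t_def)
    fix \<nu> assume \<nu>: "\<nu> permutes A"
    have P: "partition_on A {A}" using partition_on_space[of A] a by auto
    have top: "young A {A} = {\<tau>. \<tau> permutes A}" using young_top[OF fin] a by auto
    have "(\<Sum>\<tau>\<in>young A {A}. real N ^ card (cyc A \<tau>) * u (\<tau> \<circ> \<nu>)) = (if \<nu> = id then 1 else 0)"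
    proof (rule young_inverse_step[OF fin P a])
      fix \<mu> assume \<mu>: "\<mu> \<in> young A {A}"
      have "w' \<mu> = 0" if "\<mu> a \<noteq> a"
        using that w' permutes_not_in[of \<mu> "A - {a}" a] by (auto simp: is_weingarten_def)
      then show "real N * u \<mu> + (\<Sum>i\<in>block_of {A} a - {a}. u (Transposition.transpose i a \<circ> \<mu>)) =
          (if \<mu> a = a then w' \<mu> else 0)"
        unfolding block_of_eq[OF P insertI1 a] rec by simp
    next
      show "(\<Sum>\<tau>\<in>young (A - {a}) (del_point a {A}). real N ^ card (cyc (A - {a}) \<tau>) * w' (\<tau> \<circ> \<mu>)) =
        (if \<mu> = id then 1 else 0)" if "\<mu> \<in> young (A - {a}) (del_point a {A})" for \<mu>
        using that w' unfolding young_del_top[OF fin a] is_weingarten_def by simp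
    qed (use \<nu> top in simp)
    then show "(\<Sum>\<rho> | \<rho> permutes A. real N ^ card (cyc A \<rho>) * u (\<rho> \<circ> \<nu>)) = (if \<nu> = id then 1 else 0)"
      unfolding top .
  qed
  from that[OF this rec] show thesis .
qed

lemma is_weingarten_exists: "finite A \<Longrightarrow> card A \<le> N \<Longrightarrow> \<exists>w. is_weingarten N A w"
proof (induction A rule: finite_induct)
  case empty
  have "cyc {} id = ({} :: 'a set set)" by (simp add: cyc_def)
  then have "is_weingarten N {} (\<lambda>\<nu> :: 'a \<Rightarrow> 'a. if \<nu> = id then 1 else 0)"
    by (simp add: is_weingarten_def)
  then show ?case by blast
next
  case (insert a A)
  then obtain w where "is_weingarten N A w" by auto
  then have "is_weingarten N (insert a A - {a}) w" using insert by simp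
  then show ?case using is_weingarten_step[of "insert a A" a N w] insert by (metis finite_insert insertI1)
qed

lemma weingarten_is:
  assumes "finite A" "card A \<le> N"
  shows "is_weingarten N A (weingarten N A)"
proof -
  have "weingarten N A = (THE w. is_weingarten N A w)"
    unfolding weingarten_def is_weingarten_def
    by (simp add: perm_convolution_eq[OF assms(1)] cong: imp_cong)
  moreover have "\<exists>!w. is_weingarten N A w"
    using is_weingarten_exists[OF assms] is_weingarten_unique[OF assms(1)] by blast
  ultimately show ?thesis using theI'[of "is_weingarten N A"] by simp
qed

text \<open>Uniqueness identifies the Neumann series with the Weingarten function. The right-hand
  side is 0 when \<nu> moves a, because the function on A - {a} is extended by 0.\<close>

lemma weingarten_rec:
  assumes "finite A" "a \<in> A" "card A \<le> N"
  shows "real N * weingarten N A \<nu> + (\<Sum>i\<in>A - {a}. weingarten N A (Transposition.transpose i a \<circ> \<nu>)) =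
    weingarten N (A - {a}) \<nu>"
proof -
  have "card (A - {a}) \<le> N" using assms card_Diff1_le[of A a] by linarith
  then have "is_weingarten N (A - {a}) (weingarten N (A - {a}))" using weingarten_is assms(1) by blast
  from is_weingarten_step[OF assms this] obtain u where "is_weingarten N A u"
    "\<And>\<nu>. real N * u \<nu> + (\<Sum>i\<in>A - {a}. u (Transposition.transpose i a \<circ> \<nu>)) = weingarten N (A - {a}) \<nu>"
    by metis
  moreover from this have "u = weingarten N A"
    using is_weingarten_unique[OF assms(1) _ weingarten_is[OF assms(1,3)]] by blast
  ultimately show ?thesis by simp
qed

lemma weingarten_empty: "weingarten N {} id = 1"
proof -
  have "cyc {} id = ({} :: 'a set set)" by (simp add: cyc_def)
  then show ?thesis using weingarten_is[of "{} :: 'a set" N] by (simp add: is_weingarten_def)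
qed

lemma weingarten_not_permutes:
  "finite A \<Longrightarrow> card A \<le> N \<Longrightarrow> \<not> \<nu> permutes A \<Longrightarrow> weingarten N A \<nu> = 0"
  using weingarten_is[of A N] by (simp add: is_weingarten_def)

section \<open>Products of Weingarten functions over the blocks of a partition\<close>

definition wg_part :: "nat \<Rightarrow> 'a set set \<Rightarrow> ('a \<Rightarrow> 'a) \<Rightarrow> real" where
  "wg_part N P \<nu> = (\<Prod>G\<in>P. weingarten N G (perm_restrict \<nu> G))"

lemma young_block:
  assumes "finite A" "partition_on A P" "\<nu> \<in> young A P" "G \<in> P" "x \<in> G"
  shows "\<nu> x \<in> G"
  using assms same_block_iff_mem[OF assms(2,4,5)] block_subset[OF assms(2,4)]
  by (auto simp: young_iff[OF assms(1,2)])

lemma perm_restrict_permutes: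
  assumes "finite A" "\<nu> permutes A" "G \<subseteq> A" "\<And>x. x \<in> G \<Longrightarrow> \<nu> x \<in> G"
  shows "perm_restrict \<nu> G permutes G"
proof (rule bij_imp_permutes)
  have "inj_on (perm_restrict \<nu> G) G"
    using permutes_inj[OF assms(2)] by (auto simp: inj_on_def perm_restrict_def dest: injD)
  moreover have "perm_restrict \<nu> G ` G \<subseteq> G" using assms(4) by (auto simp: perm_restrict_def)
  moreover have "finite G" using assms finite_subset by blast
  ultimately show "bij_betw (perm_restrict \<nu> G) G G"
    by (simp add: bij_betw_def endo_inj_surj)
qed (simp add: perm_restrict_def)

lemma perm_restrict_block:
  assumes "finite A" "partition_on A P" "\<nu> \<in> young A P" "G \<in> P"
  shows "perm_restrict \<nu> G permutes G"
proof (rule perm_restrict_permutes[OF assms(1)])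
  show "\<nu> permutes A" using assms(3) by (simp add: young_def)
qed (use block_subset[OF assms(2,4)] young_block[OF assms] in auto)

lemma perm_restrict_transpose_same:
  assumes "i \<in> G" "a \<in> G" "\<And>x. x \<in> G \<Longrightarrow> \<nu> x \<in> G"
  shows "perm_restrict (Transposition.transpose i a \<circ> \<nu>) G = Transposition.transpose i a \<circ> perm_restrict \<nu> G"
  using assms by (auto simp: fun_eq_iff perm_restrict_def Transposition.transpose_def)

lemma perm_restrict_transpose_other:
  assumes "i \<notin> G" "a \<notin> G" "\<And>x. x \<in> G \<Longrightarrow> \<nu> x \<in> G"
  shows "perm_restrict (Transposition.transpose i a \<circ> \<nu>) G = perm_restrict \<nu> G"
  using assms by (auto simp: fun_eq_iff perm_restrict_def Transposition.transpose_def)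

lemma del_point_split:
  assumes "partition_on A P" "G \<in> P" "a \<in> G"
  shows "del_point a P = (if G = {a} then P - {G} else insert (G - {a}) (P - {G}))" "G - {a} \<notin> P - {G}"
proof -
  have other: "B - {a} = B" "B \<noteq> {}" if "B \<in> P" "B \<noteq> G" for B
    using that partition_unique[OF assms(1) that(1) assms(2) _ assms(3)] assms(1) by (auto simp: partition_on_def)
  have "(\<lambda>B. B - {a}) ` P = insert (G - {a}) ((\<lambda>B. B - {a}) ` (P - {G}))" using assms(2) by auto
  also have "(\<lambda>B. B - {a}) ` (P - {G}) = P - {G}" 
  proof -
    have "(\<lambda>B. B - {a}) ` (P - {G}) = (\<lambda>B. B) ` (P - {G})"
      by (rule image_cong[OF refl]) (use other in auto)
    then show ?thesis by simp
  qed
  finally have img: "(\<lambda>B. B - {a}) ` P = insert (G - {a}) (P - {G})" .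
  have "{} \<notin> P - {G}" "G - {a} = {} \<longleftrightarrow> G = {a}"
    using partition_onD3[OF assms(1)] assms(3) by auto
  then show "del_point a P = (if G = {a} then P - {G} else insert (G - {a}) (P - {G}))"
    unfolding del_point_def img by (cases "G = {a}") (simp_all add: insert_Diff_if)
  show "G - {a} \<notin> P - {G}"
  proof
    assume *: "G - {a} \<in> P - {G}"
    then have "G - {a} \<noteq> {}" using partition_onD3[OF assms(1)] by (metis DiffD1)
    then obtain x where "x \<in> G - {a}" by auto
    then have "G - {a} = G" using partition_unique[OF assms(1) _ assms(2), of "G - {a}" x] * by auto
    then show False using assms(3) by auto
  qed
qed

text \<open>Transpositions inside the block of a leave the factors of all other blocks alone, so
  this is \<open>weingarten_rec\<close> on that block. If the block is {a}, deleting a leaves the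
  empty block, whose factor is 1.\<close>

lemma wg_part_rec:
  assumes fin: "finite A" and P: "partition_on A P" and a: "a \<in> A" and N: "card A \<le> N" and \<nu>: "\<nu> \<in> young A P"
  shows "real N * wg_part N P \<nu> + (\<Sum>i\<in>block_of P a - {a}. wg_part N P (Transposition.transpose i a \<circ> \<nu>)) =
    (if \<nu> a = a then wg_part N (del_point a P) \<nu> else 0)"
proof -
  define G where "G = block_of P a"
  have G: "G \<in> P" "a \<in> G" using block_of_in[OF P a] block_of_self[OF P a] by (auto simp: G_def)
  have finP: "finite P" using finite_elements[OF fin P] .
  have GA: "G \<subseteq> A" using block_subset[OF P G(1)] .
  then have finG: "finite G" and cG: "card G \<le> N" using fin finite_subset N card_mono[OF fin GA] by auto
  define R where "R = (\<Prod>H\<in>P - {G}. weingarten N H (perm_restrict \<nu> H))"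
  have inv: "\<nu> x \<in> H" if "H \<in> P" "x \<in> H" for x H using young_block[OF fin P \<nu> that] .
  have W: "wg_part N P \<nu> = weingarten N G (perm_restrict \<nu> G) * R"
    unfolding wg_part_def R_def by (rule prod.remove[OF finP G(1)])
  have Wi: "wg_part N P (Transposition.transpose i a \<circ> \<nu>) =
      weingarten N G (Transposition.transpose i a \<circ> perm_restrict \<nu> G) * R" if i: "i \<in> G" for i
  proof -
    have "wg_part N P (Transposition.transpose i a \<circ> \<nu>) =
      weingarten N G (perm_restrict (Transposition.transpose i a \<circ> \<nu>) G) *
      (\<Prod>H\<in>P - {G}. weingarten N H (perm_restrict (Transposition.transpose i a \<circ> \<nu>) H))"
      unfolding wg_part_def by (rule prod.remove[OF finP G(1)])
    also have "(\<Prod>H\<in>P - {G}. weingarten N H (perm_restrict (Transposition.transpose i a \<circ> \<nu>) H)) = R"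
      unfolding R_def
    proof (rule prod.cong[OF refl])
      fix H assume H: "H \<in> P - {G}"
      then have "i \<notin> H" "a \<notin> H" using partition_unique[OF P _ G(1)] i G(2) by blast+
      then show "weingarten N H (perm_restrict (Transposition.transpose i a \<circ> \<nu>) H) = weingarten N H (perm_restrict \<nu> H)"
        using perm_restrict_transpose_other[of i H a \<nu>] inv H by simp
    qed
    also have "perm_restrict (Transposition.transpose i a \<circ> \<nu>) G = Transposition.transpose i a \<circ> perm_restrict \<nu> G"
      by (rule perm_restrict_transpose_same[OF i G(2)]) (rule inv[OF G(1)])
    finally show ?thesis .
  qed
  have "real N * wg_part N P \<nu> + (\<Sum>i\<in>G - {a}. wg_part N P (Transposition.transpose i a \<circ> \<nu>)) =
    (real N * weingarten N G (perm_restrict \<nu> G) + (\<Sum>i\<in>G - {a}. weingarten N G (Transposition.transpose i a \<circ> perm_restrict \<nu> G))) * R"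
    by (simp add: W Wi distrib_right sum_distrib_right)
  also have "\<dots> = weingarten N (G - {a}) (perm_restrict \<nu> G) * R"
    by (simp only: weingarten_rec[OF finG G(2) cG])
  also have "\<dots> = (if \<nu> a = a then wg_part N (del_point a P) \<nu> else 0)"
  proof (cases "\<nu> a = a")
    case False
    then have "\<not> perm_restrict \<nu> G permutes (G - {a})"
      using permutes_not_in[of "perm_restrict \<nu> G" "G - {a}" a] G(2) by (auto simp: perm_restrict_def)
    moreover have "card (G - {a}) \<le> N" using card_Diff1_le[of G a] cG by linarith
    ultimately show ?thesis using False weingarten_not_permutes[of "G - {a}" N] finG by simp
  next
    case True
    then have pr: "perm_restrict \<nu> G = perm_restrict \<nu> (G - {a})"
      by (auto simp: fun_eq_iff perm_restrict_def)
    show ?thesis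
    proof (cases "G = {a}")
      case 1: True
      have "perm_restrict \<nu> {} = id" by (auto simp: fun_eq_iff perm_restrict_def)
      then show ?thesis using True 1 pr del_point_split(1)[OF P G]
        by (simp add: wg_part_def R_def weingarten_empty)
    next
      case 2: False
      then show ?thesis using True pr del_point_split[OF P G] finP
        by (simp add: wg_part_def R_def)
    qed
  qed
  finally show ?thesis by (simp add: G_def)
qed

text \<open>The points are deleted one at a time; \<open>wg_part_rec\<close> supplies the recursion
  assumed in \<open>young_inverse_step\<close>.\<close>

lemma wg_part_inverse:
  assumes "finite A" "partition_on A P" "card A \<le> N" "\<nu> \<in> young A P"
  shows "(\<Sum>\<tau>\<in>young A P. real N ^ card (cyc A \<tau>) * wg_part N P (\<tau> \<circ> \<nu>)) = (if \<nu> = id then 1 else 0)"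
  using assms
proof (induction "card A" arbitrary: A P \<nu>)
  case 0
  then have A: "A = {}" "P = {}" by (auto simp: partition_on_empty)
  have "cyc {} id = ({} :: 'a set set)" by (simp add: cyc_def)
  then have "young {} {} = {id :: 'a \<Rightarrow> 'a}"
    by (auto simp: young_def refines_def partition_on_empty)
  then show ?case using 0 A by (simp add: wg_part_def cyc_def)
next
  case (Suc n)
  then obtain a where a: "a \<in> A" by (metis card.empty ex_in_conv nat.distinct(1))
  have c: "n = card (A - {a})" using Suc a by simp
  show ?case
  proof (rule young_inverse_step[OF Suc.prems(1,2) a _ _ Suc.prems(4), where w' = "wg_part N (del_point a P)"])
    show "(\<Sum>\<tau>\<in>young (A - {a}) (del_point a P). real N ^ card (cyc (A - {a}) \<tau>) * wg_part N (del_point a P) (\<tau> \<circ> \<mu>)) =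
      (if \<mu> = id then 1 else 0)" if "\<mu> \<in> young (A - {a}) (del_point a P)" for \<mu>
      using Suc.hyps(2) Suc.prems(1,3)
      by (intro Suc.hyps(1)[OF c _ partition_on_del_point[OF Suc.prems(2)] _ that]) (auto simp: c[symmetric])
  qed (rule wg_part_rec[OF Suc.prems(1,2) a Suc.prems(3)])
qed


section \<open>Cumulants of the Weingarten function\<close>

text \<open>Only partitions above the cycles of \<nu> enter, since the restriction of \<nu> to a
  block has to be a permutation of it.\<close>

definition wg_cum :: "nat \<Rightarrow> 'a set \<Rightarrow> 'a set set \<Rightarrow> ('a \<Rightarrow> 'a) \<Rightarrow> real" where
  "wg_cum N A P \<nu> = (\<Sum>Q | refines A (cyc A \<nu>) Q \<and> refines A Q P. of_int (part_mobius A Q P) * wg_part N Q \<nu>)"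

lemma wg_cum_sum:
  assumes "finite A" "refines A (cyc A \<nu>) P"
  shows "(\<Sum>Q | refines A (cyc A \<nu>) Q \<and> refines A Q P. wg_cum N A Q \<nu>) = wg_part N P \<nu>"
  unfolding wg_cum_def by (rule mobius_inversion[OF assms])

lemma insert_point:
  assumes "partition_on (A - {a}) Q" "a \<in> A"
  shows "partition_on A (insert {a} Q)" "{a} \<notin> Q"
    "same_block (insert {a} Q) x y \<longleftrightarrow> same_block Q x y \<or> x = a \<and> y = a"
    "del_point a (insert {a} Q) = Q"
proof -
  have a: "a \<notin> B" if "B \<in> Q" for B using assms(1) that by (auto simp: partition_on_def)
  have U: "\<Union> Q = A - {a}" using assms(1) by (auto simp: partition_on_def)
  then have "disjnt {a} (\<Union> Q)" by auto
  then show "partition_on A (insert {a} Q)"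
    using partition_on_insert[of "{a}" Q A] assms by auto
  show "{a} \<notin> Q" using a by auto
  show "same_block (insert {a} Q) x y \<longleftrightarrow> same_block Q x y \<or> x = a \<and> y = a"
    by (auto simp: same_block_def)
  have "(\<lambda>B. B - {a}) ` Q = (\<lambda>B. B) ` Q" by (rule image_cong[OF refl]) (use a in auto)
  then show "del_point a (insert {a} Q) = Q"
    using partition_onD3[OF assms(1)] by (simp add: del_point_def)
qed

lemma partition_singleton_block:
  assumes "partition_on A Q" "{a} \<in> Q"
  shows "partition_on (A - {a}) (Q - {{a}})" "del_point a Q = Q - {{a}}" "insert {a} (Q - {{a}}) = Q"
  using partition_on_del_point[OF assms(1), of a] del_point_split(1)[OF assms, of a] assms(2) by auto

lemma refines_insert_point:
  assumes Q: "partition_on (A - {a}) Q" and R: "partition_on A R" and a: "a \<in> A"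
  shows "refines A (insert {a} Q) R \<longleftrightarrow> refines (A - {a}) Q (del_point a R)"
proof -
  note ip = insert_point[OF Q a]
  have "(\<forall>x y. same_block (insert {a} Q) x y \<longrightarrow> same_block R x y) \<longleftrightarrow>
    (\<forall>x y. same_block Q x y \<longrightarrow> same_block (del_point a R) x y)"
    using same_block_in[OF Q] same_block_refl[OF R] a unfolding ip(3) same_block_del_point by blast
  then show ?thesis
    by (simp only: refines_iff_same_block[OF ip(1) R] refines_iff_same_block[OF Q partition_on_del_point[OF R]])
qed

lemma cyc_refines_insert_point:
  assumes fin: "finite A" and Q: "partition_on (A - {a}) Q" and a: "a \<in> A" and \<nu>: "\<nu> permutes A"
  shows "refines A (cyc A \<nu>) (insert {a} Q) \<longleftrightarrow> \<nu> a = a \<and> refines (A - {a}) (cyc (A - {a}) \<nu>) Q"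
proof (cases "\<nu> a = a")
  case True
  note ip = insert_point[OF Q a]
  have "finite (A - {a})" using fin by simp
  then show ?thesis
    using True cyc_refines_iff[OF fin \<nu> ip(1)] cyc_refines_iff[OF _ permutes_del_point[OF \<nu> True] Q]
      same_block_in[OF Q] ip(3) by auto
next
  case False
  note ip = insert_point[OF Q a]
  have "\<not> same_block (insert {a} Q) a (\<nu> a)" using False same_block_in[OF Q, of a "\<nu> a"] by (auto simp: ip(3))
  then show ?thesis using False cyc_refines_iff[OF fin \<nu> ip(1)] a by auto
qed

text \<open>Both sides are functions of R, compared by summing over all R below a given P, which
  restores \<open>wg_part_rec\<close>. The cumulants of the transposed permutation are grouped by
  the partition that results from merging i and a.\<close>

lemma wg_cum_rec:
  assumes fin: "finite A" and a: "a \<in> A" and N: "card A \<le> N" and \<nu>: "\<nu> permutes A"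
    and R: "refines A (cyc A \<nu>) R"
  shows "real N * wg_cum N A R \<nu> +
      (\<Sum>i\<in>A - {a}. \<Sum>Q | refines A (cyc A (Transposition.transpose i a \<circ> \<nu>)) Q \<and> merge_blocks Q i a = R.
        wg_cum N A Q (Transposition.transpose i a \<circ> \<nu>)) =
    (if {a} \<in> R then wg_cum N (A - {a}) (R - {{a}}) \<nu> else 0)"
proof -
  define ti where "ti i = Transposition.transpose i a \<circ> \<nu>" for i
  define g where "g R = real N * wg_cum N A R \<nu> +
      (\<Sum>i\<in>A - {a}. \<Sum>Q | refines A (cyc A (ti i)) Q \<and> merge_blocks Q i a = R. wg_cum N A Q (ti i))" for R
  define h where "h R = (if {a} \<in> R then wg_cum N (A - {a}) (R - {{a}}) \<nu> else 0)" for R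
  have "g R = h R"
  proof (rule interval_sums_unique[OF fin _ R])
    fix P assume LP: "refines A (cyc A \<nu>) P"
    have P: "partition_on A P" using LP by (rule refines_partition)
    have \<nu>P: "\<nu> \<in> young A P" using LP \<nu> by (simp add: young_def)
    let ?I = "{Q. refines A (cyc A \<nu>) Q \<and> refines A Q P}"
    have finI: "finite ?I" by (rule finite_refines_between[OF fin])
    have B: "block_of P a \<subseteq> A" using block_subset[OF P block_of_in[OF P a]] .
    have inner: "(\<Sum>R\<in>?I. \<Sum>Q | refines A (cyc A (ti i)) Q \<and> merge_blocks Q i a = R. wg_cum N A Q (ti i)) =
        (if i \<in> block_of P a then wg_part N P (ti i) else 0)" if i: "i \<in> A - {a}" for i
    proof -
      have ia: "i \<in> A" "a \<in> A" using i a by auto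
      let ?F = "\<lambda>R. {Q. refines A (cyc A (ti i)) Q \<and> merge_blocks Q i a = R}"
      have "(\<Sum>R\<in>?I. \<Sum>Q\<in>?F R. wg_cum N A Q (ti i)) = (\<Sum>Q\<in>(\<Union>R\<in>?I. ?F R). wg_cum N A Q (ti i))"
        by (rule sum.UNION_disjoint[symmetric]) (use finI finite_refines_between[OF fin] in auto)
      also have "(\<Union>R\<in>?I. ?F R) = (if i \<in> block_of P a then {Q. refines A (cyc A (ti i)) Q \<and> refines A Q P} else {})"
      \<comment> \<open>Merging i and a in Q gives a partition below P exactly when Q is below P and
        P joins i and a. So the fibres fill the whole interval or are all empty.\<close>
      proof -
        have "merge_blocks Q i a \<in> ?I \<longleftrightarrow> i \<in> block_of P a \<and> refines A Q P" if Q: "refines A (cyc A (ti i)) Q" for Q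
        proof -
          have pQ: "partition_on A Q" using Q by (rule refines_partition)
          have "refines A (cyc A (ti i)) (merge_blocks Q i a)"
            using refines_trans[OF Q refines_merge[OF pQ ia]] .
          then have "refines A (cyc A \<nu>) (merge_blocks Q i a)"
            using merge_cyc_transpose[OF fin \<nu> ia partition_on_merge[OF pQ ia]] same_block_merge_self[OF pQ ia]
            by (simp add: ti_def)
          moreover have "i \<in> block_of P a \<longleftrightarrow> same_block P i a"
            using same_block_sym[of P a i] by (simp add: block_of_def)
          ultimately show ?thesis using merge_refines_iff[OF pQ ia, of P] by auto
        qed
        then show ?thesis by auto
      qed
      also have "(\<Sum>Q\<in>\<dots>. wg_cum N A Q (ti i)) = (if i \<in> block_of P a then wg_part N P (ti i) else 0)"
      proof (cases "i \<in> block_of P a")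
        case True
        then have "same_block P i a" using same_block_sym[of P a i] by (simp add: block_of_def)
        then have "refines A (cyc A (ti i)) P" using merge_cyc_transpose[OF fin \<nu> ia P] LP by (simp add: ti_def)
        then show ?thesis using True wg_cum_sum[OF fin] by simp
      qed simp
      finally show ?thesis .
    qed
    have "(\<Sum>R\<in>?I. g R) = real N * wg_part N P \<nu> + (\<Sum>i\<in>A - {a}. if i \<in> block_of P a then wg_part N P (ti i) else 0)"
      unfolding g_def sum.distrib sum_distrib_left[symmetric] wg_cum_sum[OF fin LP]
      by (subst sum.swap) (use inner in simp)
    also have "(\<Sum>i\<in>A - {a}. if i \<in> block_of P a then wg_part N P (ti i) else 0) =
        (\<Sum>i\<in>block_of P a - {a}. wg_part N P (ti i))"
    proof -
      have "(A - {a}) \<inter> block_of P a = block_of P a - {a}" using B by auto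
      then show ?thesis using fin by (simp add: sum.inter_restrict[symmetric])
    qed
    also have "real N * wg_part N P \<nu> + \<dots> = (if \<nu> a = a then wg_part N (del_point a P) \<nu> else 0)"
      unfolding ti_def by (rule wg_part_rec[OF fin P a N \<nu>P])
    also have "\<dots> = (\<Sum>Q\<in>?I. h Q)"
    proof (cases "\<nu> a = a")
      case False
      have "h Q = 0" if "Q \<in> ?I" for Q
      proof -
        have pQ: "partition_on A Q" using that refines_partition by blast
        have "{a} \<notin> Q"
        proof
          assume aQ: "{a} \<in> Q"
          have "refines A (cyc A \<nu>) (insert {a} (Q - {{a}}))"
            using that partition_singleton_block(3)[OF pQ aQ] by simp
          then show False
            using cyc_refines_insert_point[OF fin partition_singleton_block(1)[OF pQ aQ] a \<nu>] False by simp
        qed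
        then show ?thesis by (simp add: h_def)
      qed
      then show ?thesis using False by simp
    next
      case True
      have finA': "finite (A - {a})" using fin by simp
      have "\<nu> \<in> young (A - {a}) (del_point a P)" by (rule young_del_point[OF fin P \<nu>P True])
      then have L': "refines (A - {a}) (cyc (A - {a}) \<nu>) (del_point a P)" by (simp add: young_def)
      \<comment> \<open>Partitions with the block {a} correspond to the partitions of A -
        {a}.\<close>
      have "(\<Sum>Q\<in>?I. h Q) = (\<Sum>Q\<in>{Q \<in> ?I. {a} \<in> Q}. wg_cum N (A - {a}) (Q - {{a}}) \<nu>)"
        unfolding h_def using finI by (simp only: sum.inter_filter)
      also have "\<dots> = (\<Sum>Q | refines (A - {a}) (cyc (A - {a}) \<nu>) Q \<and> refines (A - {a}) Q (del_point a P). wg_cum N (A - {a}) Q \<nu>)"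
      proof (rule sum.reindex_bij_witness[of _ "\<lambda>Q. insert {a} Q" "\<lambda>Q. Q - {{a}}"])
        fix Q assume Q: "Q \<in> {Q \<in> ?I. {a} \<in> Q}"
        then have pQ: "partition_on A Q" "{a} \<in> Q" using refines_partition by auto
        note ps = partition_singleton_block[OF pQ]
        show "insert {a} (Q - {{a}}) = Q" by (rule ps(3))
        show "Q - {{a}} \<in> {Q. refines (A - {a}) (cyc (A - {a}) \<nu>) Q \<and> refines (A - {a}) Q (del_point a P)}"
          using Q refines_insert_point[OF ps(1) P a] cyc_refines_insert_point[OF fin ps(1) a \<nu>] unfolding ps(3) by simp
      next
        fix Q assume Q: "Q \<in> {Q. refines (A - {a}) (cyc (A - {a}) \<nu>) Q \<and> refines (A - {a}) Q (del_point a P)}"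
        then have pQ: "partition_on (A - {a}) Q" using refines_partition by blast
        show "insert {a} Q - {{a}} = Q" using insert_point(2)[OF pQ a] by simp
        show "insert {a} Q \<in> {Q \<in> ?I. {a} \<in> Q}"
          using Q refines_insert_point[OF pQ P a] cyc_refines_insert_point[OF fin pQ a \<nu>] True by simp
      qed simp
      also have "\<dots> = wg_part N (del_point a P) \<nu>" by (rule wg_cum_sum[OF finA' L'])
      finally show ?thesis using True by simp
    qed
    finally show "(\<Sum>Q\<in>?I. g Q) = (\<Sum>Q\<in>?I. h Q)" .
  qed
  then show ?thesis by (simp only: g_def h_def ti_def)
qed


section \<open>Limits of solutions of linear systems\<close>

text \<open>The error d = x - y satisfies d = r + K d with r tending to 0. Once the row sums of K
  are below 1/2, its maximum norm S satisfies S \<le> \<beta> + S / 2, hence S \<le> 2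
  \<beta>.\<close>

lemma contractive_system_limit:
  fixes x b :: "nat \<Rightarrow> 'p \<Rightarrow> real" and K :: "nat \<Rightarrow> 'p \<Rightarrow> 'p \<Rightarrow> real"
  assumes fin: "finite I"
    and x: "eventually (\<lambda>N. \<forall>p\<in>I. x N p = b N p + (\<Sum>q\<in>I. K N p q * x N q)) sequentially"
    and b: "\<And>p. p \<in> I \<Longrightarrow> (\<lambda>N. b N p) \<longlonglongrightarrow> b' p"
    and K: "\<And>p q. p \<in> I \<Longrightarrow> q \<in> I \<Longrightarrow> (\<lambda>N. K N p q) \<longlonglongrightarrow> K' p q"
    and small: "\<And>p. p \<in> I \<Longrightarrow> (\<Sum>q\<in>I. \<bar>K' p q\<bar>) < 1/2"
    and y: "\<And>p. p \<in> I \<Longrightarrow> y p = b' p + (\<Sum>q\<in>I. K' p q * y q)"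
    and p: "p \<in> I"
  shows "(\<lambda>N. x N p) \<longlonglongrightarrow> y p"
proof -
  define r where "r N p = (b N p - b' p) + (\<Sum>q\<in>I. (K N p q - K' p q) * y q)" for N p
  define \<beta> where "\<beta> N = (\<Sum>p\<in>I. \<bar>r N p\<bar>)" for N
  have "(\<lambda>N. r N p) \<longlonglongrightarrow> 0" if "p \<in> I" for p
  proof -
    have "(\<lambda>N. r N p) \<longlonglongrightarrow> (b' p - b' p) + (\<Sum>q\<in>I. (K' p q - K' p q) * y q)"
      unfolding r_def by (intro tendsto_intros b K that)
    then show ?thesis by simp
  qed
  then have "\<beta> \<longlonglongrightarrow> (\<Sum>p\<in>I. \<bar>0\<bar>)" unfolding \<beta>_def by (intro tendsto_intros)
  then have \<beta>: "(\<lambda>N. 2 * \<beta> N) \<longlonglongrightarrow> 0" using tendsto_mult_right_zero by (simp add: tendsto_mult_right_zero)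
  have "eventually (\<lambda>N. (\<Sum>q\<in>I. \<bar>K N p q\<bar>) < 1/2) sequentially" if "p \<in> I" for p
  proof (rule order_tendstoD(2)[OF _ small[OF that]])
    show "(\<lambda>N. \<Sum>q\<in>I. \<bar>K N p q\<bar>) \<longlonglongrightarrow> (\<Sum>q\<in>I. \<bar>K' p q\<bar>)" by (intro tendsto_intros K that)
  qed
  then have "eventually (\<lambda>N. \<forall>p\<in>I. (\<Sum>q\<in>I. \<bar>K N p q\<bar>) < 1/2) sequentially"
    using fin by (simp add: eventually_ball_finite)
  with x have "eventually (\<lambda>N. norm (x N p - y p) \<le> 2 * \<beta> N) sequentially"
  proof eventually_elim
    case (elim N)
    define d where "d p = x N p - y p" for p
    have d: "d p = r N p + (\<Sum>q\<in>I. K N p q * d q)" if "p \<in> I" for p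
      using elim(1) y that
      by (simp add: d_def r_def left_diff_distrib right_diff_distrib sum_subtractf)
    define S where "S = Max ((\<lambda>p. \<bar>d p\<bar>) ` I)"
    have S: "\<bar>d p\<bar> \<le> S" if "p \<in> I" for p unfolding S_def using fin that by simp
    have S0: "S \<ge> 0" using S[OF p] by linarith
    have le: "\<bar>d p\<bar> \<le> \<beta> N + S / 2" if pI: "p \<in> I" for p
    proof -
      have "\<bar>d p\<bar> \<le> \<bar>r N p\<bar> + (\<Sum>q\<in>I. \<bar>K N p q * d q\<bar>)"
        unfolding d[OF pI] by (rule order_trans[OF abs_triangle_ineq]) simp
      also have "(\<Sum>q\<in>I. \<bar>K N p q * d q\<bar>) \<le> (\<Sum>q\<in>I. \<bar>K N p q\<bar> * S)"
        using S by (intro sum_mono) (simp add: abs_mult mult_left_mono)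
      also have "\<dots> = (\<Sum>q\<in>I. \<bar>K N p q\<bar>) * S" by (simp add: sum_distrib_right)
      also have "\<dots> \<le> 1/2 * S" using elim(2) pI S0 by (intro mult_right_mono) auto
      also have "\<bar>r N p\<bar> \<le> \<beta> N" unfolding \<beta>_def using fin pI by (intro member_le_sum) auto
      finally show ?thesis by simp
    qed
    have "S \<in> (\<lambda>p. \<bar>d p\<bar>) ` I" unfolding S_def using fin p by (intro Max_in) auto
    then have "S \<le> \<beta> N + S / 2" using le by auto
    then show ?case using S[OF p] by (simp add: d_def)
  qed
  then have "(\<lambda>N. x N p - y p) \<longlonglongrightarrow> 0" by (rule Lim_null_comparison) (rule \<beta>)
  then show ?thesis by (simp add: LIM_zero_iff)
qed

text \<open>Dividing the unknowns by D^e multiplies each nonzero limiting entry by at most 1 / D,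
  because e drops along it. For large D the system is contractive.\<close>

lemma triangular_system_limit:
  fixes x b :: "nat \<Rightarrow> 'p \<Rightarrow> real" and K :: "nat \<Rightarrow> 'p \<Rightarrow> 'p \<Rightarrow> real" and e :: "'p \<Rightarrow> int"
  assumes fin: "finite I"
    and x: "eventually (\<lambda>N. \<forall>p\<in>I. x N p = b N p + (\<Sum>q\<in>I. K N p q * x N q)) sequentially"
    and b: "\<And>p. p \<in> I \<Longrightarrow> (\<lambda>N. b N p) \<longlonglongrightarrow> b' p"
    and K: "\<And>p q. p \<in> I \<Longrightarrow> q \<in> I \<Longrightarrow> (\<lambda>N. K N p q) \<longlonglongrightarrow> K' p q"
    and tri: "\<And>p q. p \<in> I \<Longrightarrow> q \<in> I \<Longrightarrow> K' p q \<noteq> 0 \<Longrightarrow> e q < e p"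
    and y: "\<And>p. p \<in> I \<Longrightarrow> y p = b' p + (\<Sum>q\<in>I. K' p q * y q)"
    and p: "p \<in> I"
  shows "(\<lambda>N. x N p) \<longlonglongrightarrow> y p"
proof -
  \<comment> \<open>Exceeds twice the sum of all entries, which brings every rescaled row sum below
    1/2.\<close>
  define D where "D = 1 + 2 * (\<Sum>p\<in>I. \<Sum>q\<in>I. \<bar>K' p q\<bar>)"
  have D1: "D \<ge> 1" by (simp add: D_def sum_nonneg)
  then have D0: "D > 0" by linarith
  define w where "w p = D powi (e p)" for p
  have w: "w p > 0" for p using D0 by (simp add: w_def)
  have "(\<lambda>N. x N p / w p) \<longlonglongrightarrow> y p / w p"
  proof (rule contractive_system_limit[OF fin, where b = "\<lambda>N p. b N p / w p" and b' = "\<lambda>p. b' p / w p"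
      and K = "\<lambda>N p q. K N p q * (w q / w p)" and K' = "\<lambda>p q. K' p q * (w q / w p)"])
    show "eventually (\<lambda>N. \<forall>p\<in>I. x N p / w p = b N p / w p + (\<Sum>q\<in>I. K N p q * (w q / w p) * (x N q / w q))) sequentially"
      using x
    proof eventually_elim
      case (elim N)
      have e1: "K N p q * (w q / w p) * (x N q / w q) = K N p q * x N q / w p" for p q
        using w[of q] less_imp_neq[OF w[of q]] by simp
      show ?case
      proof
        fix p assume "p \<in> I"
        with elim have "x N p = b N p + (\<Sum>q\<in>I. K N p q * x N q)" by (rule bspec)
        then have "x N p / w p = (b N p + (\<Sum>q\<in>I. K N p q * x N q)) / w p" by (rule arg_cong)
        then show "x N p / w p = b N p / w p + (\<Sum>q\<in>I. K N p q * (w q / w p) * (x N q / w q))"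
          by (simp only: add_divide_distrib sum_divide_distrib e1)
      qed
    qed
    show "(\<lambda>N. b N p / w p) \<longlonglongrightarrow> b' p / w p" if "p \<in> I" for p
      by (intro tendsto_divide b that tendsto_const) (use w[of p] in auto)
    show "(\<lambda>N. K N p q * (w q / w p)) \<longlonglongrightarrow> K' p q * (w q / w p)" if "p \<in> I" "q \<in> I" for p q
      by (intro tendsto_mult K that tendsto_const)
    show "y p / w p = b' p / w p + (\<Sum>q\<in>I. K' p q * (w q / w p) * (y q / w q))" if "p \<in> I" for p
    proof -
      have e1: "K' p q * (w q / w p) * (y q / w q) = K' p q * y q / w p" for q
        using w[of q] less_imp_neq[OF w[of q]] by simp
      have "y p / w p = (b' p + (\<Sum>q\<in>I. K' p q * y q)) / w p" using y[OF that] by (rule arg_cong)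
      then show ?thesis by (simp only: add_divide_distrib sum_divide_distrib e1)
    qed
    show "(\<Sum>q\<in>I. \<bar>K' p q * (w q / w p)\<bar>) < 1/2" if pI: "p \<in> I" for p
    proof -
      have "\<bar>K' p q * (w q / w p)\<bar> \<le> \<bar>K' p q\<bar> / D" if "q \<in> I" for q
      proof (cases "K' p q = 0")
        case False
        then have "e q \<le> e p - 1" using tri[OF pI that] by simp
        then have "w q \<le> D powi (e p - 1)" unfolding w_def using D1 by (intro power_int_increasing) auto
        also have "\<dots> = w p / D" using D0 by (simp add: w_def power_int_diff)
        finally have "w q / w p \<le> 1 / D" using w[of p] D0 by (simp add: field_simps)
        then have "\<bar>K' p q\<bar> * (w q / w p) \<le> \<bar>K' p q\<bar> * (1 / D)" by (rule mult_left_mono) simp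
        then show ?thesis using w[of q] w[of p] by (simp add: abs_mult)
      qed simp
      then have "(\<Sum>q\<in>I. \<bar>K' p q * (w q / w p)\<bar>) \<le> (\<Sum>q\<in>I. \<bar>K' p q\<bar>) / D"
        unfolding sum_divide_distrib by (rule sum_mono)
      also have "(\<Sum>q\<in>I. \<bar>K' p q\<bar>) \<le> (\<Sum>p\<in>I. \<Sum>q\<in>I. \<bar>K' p q\<bar>)"
        using fin pI by (intro member_le_sum) (auto intro: sum_nonneg)
      then have "(\<Sum>q\<in>I. \<bar>K' p q\<bar>) / D < 1/2" using D0 by (simp add: D_def field_simps)
      finally show ?thesis .
    qed
  qed (rule p)
  then have "(\<lambda>N. x N p / w p * w p) \<longlonglongrightarrow> y p / w p * w p" by (intro tendsto_mult tendsto_const)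
  then show ?thesis using w[of p] by simp
qed


section \<open>The cut-and-join recursion for the monotone Hurwitz numbers\<close>

definition cyc_weight :: "nat \<Rightarrow> real" where
  "cyc_weight q = fact (2 * q) / (fact q * fact (q - 1))"

lemma cyc_weight_central:
  assumes "q \<ge> 1"
  shows "cyc_weight q = real q * central q"
proof -
  have f: "fact q = real q * fact (q - 1)" using assms fact_reduce[of q] by simp
  have "real q * central q = real q * (fact (2 * q) / (fact q * (real q * fact (q - 1))))"
    by (simp only: central_def power2_eq_square f[symmetric])
  then show ?thesis using assms by (simp add: cyc_weight_def)
qed

lemma cyc_perm_restrict:
  assumes "\<And>x. x \<in> G \<Longrightarrow> \<nu> x \<in> G"
  shows "cyc G (perm_restrict \<nu> G) = cyc G \<nu>"
proof -
  have "orbit (perm_restrict \<nu> G) x = orbit \<nu> x" if "x \<in> G" for x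
    by (rule orbit_cong0[OF that]) (use assms in \<open>auto simp: perm_restrict_def\<close>)
  then show ?thesis by (simp add: cyc_def)
qed

lemma hurwitz_gamma_restrict:
  "(\<And>x. x \<in> G \<Longrightarrow> \<nu> x \<in> G) \<Longrightarrow> hurwitz_gamma G (perm_restrict \<nu> G) = hurwitz_gamma G \<nu>"
  unfolding hurwitz_gamma_def by (simp add: cyc_perm_restrict)

text \<open>The weight of the distinguished cycle C is \<open>card C\<close> times a central
  binomial coefficient, the prefactor of \<open>hcoef\<close>. With \<open>card J + 1\<close> cycles
  the factorial (2m + # - 3)! becomes the one in \<open>hcoef\<close>.\<close>

lemma hurwitz_gamma_hcoef:
  assumes fin: "finite A" and \<nu>: "\<nu> permutes A" and GA: "G \<subseteq> A" and inv: "\<And>x. x \<in> G \<Longrightarrow> \<nu> x \<in> G"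
    and J: "cyc G \<nu> = insert C J" "C \<notin> J"
  shows "hurwitz_gamma G \<nu> = (-1) ^ (card J + 1 + card G) * hcoef card (card C) J * (\<Prod>B\<in>J. cyc_weight (card B))"
proof -
  have finG: "finite G" using GA fin finite_subset by blast
  have p: "partition_on G (cyc G \<nu>)"
    using partition_on_cyc[OF finG perm_restrict_permutes[OF fin \<nu> GA inv]] cyc_perm_restrict[of G \<nu>, OF inv] by simp
  have finc: "finite (cyc G \<nu>)" using finite_elements[OF finG p] .
  then have finJ: "finite J" using J by simp
  have BG: "B \<subseteq> G" "B \<noteq> {}" if "B \<in> cyc G \<nu>" for B using that p by (auto simp: partition_on_def)
  have finB: "finite B" "card B \<ge> 1" "card B \<le> card G" if "B \<in> cyc G \<nu>" for B
    using BG[OF that] finG finite_subset card_mono[of G B] by (auto simp: Suc_le_eq card_gt_0_iff intro: finite_subset)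
  have "card G = (\<Sum>B\<in>cyc G \<nu>. card B)" by (rule product_partition[OF p]) (rule finB)
  then have cG: "card G = card C + sum card J" using J finJ by simp
  have cc: "card (cyc G \<nu>) = card J + 1" using J finJ by simp
  have "(\<Prod>q = 1..card G. cyc_weight q ^ card {B \<in> cyc G \<nu>. card B = q}) =
    (\<Prod>q = 1..card G. \<Prod>B\<in>{B \<in> cyc G \<nu>. card B = q}. cyc_weight (card B))"
    by (rule prod.cong) auto
  also have "\<dots> = (\<Prod>B\<in>cyc G \<nu>. cyc_weight (card B))"
    by (rule prod.group) (use finc finB in auto)
  also have "\<dots> = cyc_weight (card C) * (\<Prod>B\<in>J. cyc_weight (card B))" using J finJ by simp
  finally have prod: "(\<Prod>q = 1..card G. cyc_weight q ^ card {B \<in> cyc G \<nu>. card B = q}) =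
    cyc_weight (card C) * (\<Prod>B\<in>J. cyc_weight (card B))" .
  have C1: "card C \<ge> 1" using finB[of C] J by auto
  have "hurwitz_gamma G \<nu> = (-1) ^ (card J + 1 + card G) * (fact (2 * card G + (card J + 1) - 3) / fact (2 * card G)) *
      (cyc_weight (card C) * (\<Prod>B\<in>J. cyc_weight (card B)))"
    unfolding hurwitz_gamma_def prod[unfolded cyc_weight_def] cc by (simp add: cyc_weight_def)
  also have "2 * card G + (card J + 1) - 3 = 2 * card G + card J - 1 - 1" by simp
  finally show ?thesis unfolding cyc_weight_central[OF C1] hcoef_def cG by simp
qed

lemma orbit_eq_cycle:
  assumes "finite A" "\<nu> permutes A" "C \<in> cyc A \<nu>" "x \<in> C"
  shows "orbit \<nu> x = C"
  using assms orbit_eq_permutes[OF assms(1,2)] by (auto simp: cyc_def)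

lemma cyc_Union:
  assumes "finite A" "\<nu> permutes A" "\<J> \<subseteq> cyc A \<nu>"
  shows "cyc (\<Union>\<J>) \<nu> = \<J>" "x \<in> \<Union>\<J> \<Longrightarrow> \<nu> x \<in> \<Union>\<J>"
proof -
  note p = partition_on_cyc[OF assms(1,2)]
  show "cyc (\<Union>\<J>) \<nu> = \<J>"
  proof (intro equalityI subsetI)
    fix C assume "C \<in> cyc (\<Union>\<J>) \<nu>"
    then obtain x B where "B \<in> \<J>" "x \<in> B" "C = orbit \<nu> x" by (auto simp: cyc_def)
    then show "C \<in> \<J>" using orbit_eq_cycle[OF assms(1,2)] assms(3) by auto
  next
    fix C assume C: "C \<in> \<J>"
    then have "C \<noteq> {}" using assms(3) partition_onD3[OF p] by auto
    then obtain x where "x \<in> C" by auto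
    then have "C = orbit \<nu> x" "x \<in> \<Union>\<J>" using orbit_eq_cycle[OF assms(1,2)] assms(3) C by auto
    then show "C \<in> cyc (\<Union>\<J>) \<nu>" by (auto simp: cyc_def)
  qed
  show "\<nu> x \<in> \<Union>\<J>" if x: "x \<in> \<Union>\<J>"
  proof -
    obtain B where B: "B \<in> \<J>" "x \<in> B" using x by auto
    then have "orbit \<nu> x = B" using orbit_eq_cycle[OF assms(1,2)] assms(3) by auto
    then show ?thesis using B orbit.base[of \<nu> x] by auto
  qed
qed

text \<open>The side of a in the divisions of A into two invariant pieces that separate a from i. It
  is applied to permutations in which a and i lie on different cycles.\<close>

definition cut_sets :: "'a set \<Rightarrow> ('a \<Rightarrow> 'a) \<Rightarrow> 'a \<Rightarrow> 'a \<Rightarrow> 'a set set" where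
  "cut_sets A \<nu> i a = {X. X \<subseteq> A \<and> a \<in> X \<and> i \<notin> X \<and> (\<forall>x\<in>X. \<nu> x \<in> X)}"

text \<open>All points i of a cycle C give the same value, so their number cancels the factor
  \<open>card C\<close> in the weight of C and leaves 1 / \<open>central\<close>. The sign changes
  because a cycle is lost.\<close>

lemma hurwitz_gamma_join_sum:
  assumes fin: "finite A" and \<nu>: "\<nu> permutes A" and a: "a \<in> A"
    and J: "J = cyc A \<nu> - {orbit \<nu> a}"
  shows "(\<Sum>i\<in>A - orbit \<nu> a. hurwitz_gamma A (Transposition.transpose i a \<circ> \<nu>)) =
    - ((-1) ^ (card J + 1 + card A) * (\<Prod>B\<in>J. cyc_weight (card B)) *
      (\<Sum>C\<in>J. hcoef card (card (orbit \<nu> a) + card C) (J - {C}) / central (card C)))"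
proof -
  note p = partition_on_cyc[OF fin \<nu>]
  define Oa where "Oa = orbit \<nu> a"
  have Oa: "Oa \<in> cyc A \<nu>" "a \<in> Oa" using a orbit_permutes[OF fin \<nu> a] by (auto simp: Oa_def cyc_def)
  have finJ: "finite J" using finite_elements[OF fin p] J by simp
  have JA: "B \<subseteq> A" "B \<noteq> {}" "finite B" "B \<inter> Oa = {}" if "B \<in> J" for B
    using that p Oa partition_unique[OF p _ Oa(1)] fin finite_subset[of B A]
    by (auto simp: J partition_on_def Oa_def[symmetric])
  have "A = Oa \<union> \<Union>J" using p Oa by (auto simp: J partition_on_def Oa_def[symmetric])
  moreover have "\<Union>J \<inter> Oa = {}" using JA(4) by blast
  ultimately have "A - Oa = \<Union>J" by blast
  then have "(\<Sum>i\<in>A - Oa. hurwitz_gamma A (Transposition.transpose i a \<circ> \<nu>)) =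
    (\<Sum>i\<in>(\<Union>C\<in>J. C). hurwitz_gamma A (Transposition.transpose i a \<circ> \<nu>))" by (simp only: image_ident)
  also have "\<dots> = (\<Sum>C\<in>J. \<Sum>i\<in>C. hurwitz_gamma A (Transposition.transpose i a \<circ> \<nu>))"
  proof (rule sum.UNION_disjoint[OF finJ])
    have "B = C" if "B \<in> J" "C \<in> J" "x \<in> B" "x \<in> C" for B C x
      using partition_unique[OF p _ _ that(3,4)] that(1,2) J by simp
    then show "\<forall>B\<in>J. \<forall>C\<in>J. B \<noteq> C \<longrightarrow> B \<inter> C = {}" by blast
  qed (use JA(3) in blast)
  also have "\<dots> = (\<Sum>C\<in>J. - ((-1) ^ (card J + 1 + card A) * (\<Prod>B\<in>J. cyc_weight (card B)) *
      (hcoef card (card Oa + card C) (J - {C}) / central (card C))))"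
  proof (rule sum.cong[OF refl])
    fix C assume C: "C \<in> J"
    then have Cc: "C \<in> cyc A \<nu>" by (simp add: J)
    have "card C \<ge> 1" using JA[OF C] by (simp add: Suc_le_eq card_gt_0_iff)
    then have cw: "cyc_weight (card C) = real (card C) * central (card C)" "real (card C) \<noteq> 0"
      using cyc_weight_central by auto
    have cJ: "card J = card (J - {C}) + 1" using card_Suc_Diff1[OF finJ C] by simp
    have PJ: "(\<Prod>B\<in>J. cyc_weight (card B)) = cyc_weight (card C) * (\<Prod>B\<in>J - {C}. cyc_weight (card B))"
      by (rule prod.remove[OF finJ C])
    have "hurwitz_gamma A (Transposition.transpose i a \<circ> \<nu>) = (-1) ^ (card (J - {C}) + 1 + card A) *
        hcoef card (card Oa + card C) (J - {C}) * (\<Prod>B\<in>J - {C}. cyc_weight (card B))" if i: "i \<in> C" for i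
    proof -
      have iA: "i \<in> A" "i \<notin> Oa" "i \<noteq> a" using i JA[OF C] Oa by auto
      have "\<not> same_block (cyc A \<nu>) i a"
        using iA by (simp add: same_block_sym[of _ i] same_block_cyc[OF fin \<nu>] Oa_def)
      then have "cyc A (Transposition.transpose i a \<circ> \<nu>) = merge_blocks (cyc A \<nu>) i a"
        using cyc_transpose(2)[OF fin \<nu> iA(1) a iA(3)] by blast
      also have "\<dots> = insert (Oa \<union> C) (J - {C})"
      proof -
        have e: "B = C" if "B \<in> cyc A \<nu>" "i \<in> B" for B using partition_unique[OF p that(1) Cc that(2) i] .
        have e': "B = Oa" if "B \<in> cyc A \<nu>" "a \<in> B" for B using partition_unique[OF p that(1) Oa(1) that(2) Oa(2)] .
        have "{B \<in> cyc A \<nu>. i \<in> B \<or> a \<in> B} = {Oa, C}" using e e' Cc i Oa by blast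
        moreover have "{B \<in> cyc A \<nu>. i \<notin> B \<and> a \<notin> B} = J - {C}"
          unfolding J Oa_def[symmetric] using e e' i Oa by blast
        ultimately show ?thesis by (simp add: merge_blocks_def)
      qed
      finally have c: "cyc A (Transposition.transpose i a \<circ> \<nu>) = insert (Oa \<union> C) (J - {C})" .
      have notin: "Oa \<union> C \<notin> J - {C}" using JA(4)[of "Oa \<union> C"] Oa(2) by auto
      have "card (Oa \<union> C) = card Oa + card C"
        using JA[OF C] orbit_permutes[OF fin \<nu> a] fin finite_subset[of Oa A]
        by (intro card_Un_disjoint) (auto simp: Oa_def)
      then show ?thesis
        using hurwitz_gamma_hcoef[OF fin transpose_comp_permutes[OF \<nu> iA(1) a] order.refl _ c notin]
          permutes_in_image[OF transpose_comp_permutes[OF \<nu> iA(1) a]] by simp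
    qed
    then have "(\<Sum>i\<in>C. hurwitz_gamma A (Transposition.transpose i a \<circ> \<nu>)) = real (card C) * ((-1) ^ (card (J - {C}) + 1 + card A) *
        hcoef card (card Oa + card C) (J - {C}) * (\<Prod>B\<in>J - {C}. cyc_weight (card B)))"
      by simp
    also have "\<dots> = - ((-1) ^ (card J + 1 + card A) * (\<Prod>B\<in>J. cyc_weight (card B)) *
      (hcoef card (card Oa + card C) (J - {C}) / central (card C)))"
      unfolding PJ cJ cw(1) using cw(2) central_pos[of "card C"] by (simp add: field_simps)
    finally show "(\<Sum>i\<in>C. hurwitz_gamma A (Transposition.transpose i a \<circ> \<nu>)) =
      - ((-1) ^ (card J + 1 + card A) * (\<Prod>B\<in>J. cyc_weight (card B)) *
      (hcoef card (card Oa + card C) (J - {C}) / central (card C)))" .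
  qed
  finally show ?thesis by (simp add: Oa_def sum_distrib_left sum_negf)
qed

text \<open>The cut at step t produces cycles of lengths t and
  \<open>card (orbit \<nu> a) - t\<close>. A division into two pieces amounts to choosing the set T
  of other cycles that go with a.\<close>

lemma hurwitz_gamma_cut_sum:
  assumes fin: "finite A" and \<nu>: "\<nu> permutes A" and a: "a \<in> A"
    and J: "J = cyc A \<nu> - {orbit \<nu> a}"
    and t: "1 \<le> t" "t < card (orbit \<nu> a)" and i_def: "i = (\<nu> ^^ t) a"
    and \<nu>i_def: "\<nu>i = Transposition.transpose i a \<circ> \<nu>"
  shows "(\<Sum>X\<in>cut_sets A \<nu>i i a. hurwitz_gamma X \<nu>i * hurwitz_gamma (A - X) \<nu>i) =
    - ((-1) ^ (card J + 1 + card A) * (\<Prod>B\<in>J. cyc_weight (card B)) *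
      (\<Sum>T\<in>Pow J. hcoef card t T * hcoef card (card (orbit \<nu> a) - t) (J - T)))"
proof -
  note p = partition_on_cyc[OF fin \<nu>]
  have iA: "i \<in> A" unfolding i_def using \<nu> a by (simp add: permutes_in_funpow_image)
  have \<nu>i: "\<nu>i permutes A" unfolding \<nu>i_def by (rule transpose_comp_permutes[OF \<nu> iA a])
  note pi = partition_on_cyc[OF fin \<nu>i]
  define Oa where "Oa = orbit \<nu> a"
  define O1 where "O1 = orbit \<nu>i a"
  define O2 where "O2 = orbit \<nu>i i"
  have O1: "O1 \<in> cyc A \<nu>i" "a \<in> O1" and O2: "O2 \<in> cyc A \<nu>i" "i \<in> O2"
    using a iA orbit_permutes[OF fin \<nu>i] by (auto simp: O1_def O2_def cyc_def)
  have iO1: "i \<notin> O1" "card O1 = t"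
    using orbit_transpose_cut(2,3)[OF fin \<nu> a t] by (simp_all add: O1_def \<nu>i_def i_def)
  then have ia: "i \<noteq> a" "O1 \<noteq> O2" using O1 O2 by auto
  then have disj: "O1 \<inter> O2 = {}" using partition_unique[OF pi O1(1) O2(1)] by blast
  have "i \<in> orbit \<nu> a" using orbit_transpose_iff[OF fin \<nu> iA a ia(1)] iO1(1) by (simp add: O1_def \<nu>i_def)
  then have "same_block (cyc A \<nu>) i a"
    using a by (simp add: same_block_sym[of _ i] same_block_cyc[OF fin \<nu>])
  then have "cyc A \<nu> = merge_blocks (cyc A \<nu>i) i a"
    using cyc_transpose(3)[OF fin \<nu> iA a ia(1)] by (simp add: \<nu>i_def)
  also have "\<dots> = insert (O1 \<union> O2) (cyc A \<nu>i - {O1, O2})"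
  proof -
    have e: "B = O2" if "B \<in> cyc A \<nu>i" "i \<in> B" for B using partition_unique[OF pi that(1) O2(1) that(2) O2(2)] .
    have e': "B = O1" if "B \<in> cyc A \<nu>i" "a \<in> B" for B using partition_unique[OF pi that(1) O1(1) that(2) O1(2)] .
    have "{B \<in> cyc A \<nu>i. i \<in> B \<or> a \<in> B} = {O1, O2}" using e e' O1 O2 by blast
    moreover have "{B \<in> cyc A \<nu>i. i \<notin> B \<and> a \<notin> B} = cyc A \<nu>i - {O1, O2}"
      using e e' O1 O2 by blast
    ultimately show ?thesis by (simp add: merge_blocks_def)
  qed
  finally have c: "cyc A \<nu> = insert (O1 \<union> O2) (cyc A \<nu>i - {O1, O2})" .
  have O12: "O1 \<union> O2 = Oa"
    using orbit_eq_cycle[OF fin \<nu>, of "O1 \<union> O2" a] c O1(2) by (simp add: Oa_def)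
  have "O1 \<union> O2 \<notin> cyc A \<nu>i - {O1, O2}"
    using partition_unique[OF pi _ O1(1), of "O1 \<union> O2" a] O1(2) by auto
  then have Ji: "J = cyc A \<nu>i - {O1, O2}" unfolding J c Oa_def[symmetric] O12[symmetric] by simp
  have finc: "finite (cyc A \<nu>i)" using finite_elements[OF fin pi] .
  have finJ: "finite J" using finc Ji by simp
  have finO: "finite O1" "finite O2" using O1 O2 fin block_subset[OF pi] finite_subset by blast+
  have cO: "card Oa = t + card O2" using card_Un_disjoint[OF finO disj] O12 iO1(2) by simp
  have UA: "\<Union>(cyc A \<nu>i) = A" using pi by (simp add: partition_on_def)
  have JO: "B \<inter> O1 = {}" "B \<inter> O2 = {}" "B \<noteq> {}" if "B \<in> J" for B
    using that partition_unique[OF pi _ O1(1)] partition_unique[OF pi _ O2(1)] partition_onD3[OF pi]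
    unfolding Ji by blast+
  have Jdisj: "B = C" if "B \<in> J" "C \<in> J" "x \<in> B" "x \<in> C" for B C x
    using partition_unique[OF pi] that unfolding Ji by blast
  have comp: "A - \<Union>(insert O1 T) = \<Union>(insert O2 (J - T))" if T: "T \<subseteq> J" for T
  proof -
    have "A = O1 \<union> O2 \<union> \<Union>J" using UA O1 O2 unfolding Ji by blast
    note A = this
    show ?thesis
    proof (intro equalityI subsetI)
      fix x assume "x \<in> A - \<Union>(insert O1 T)"
      then show "x \<in> \<Union>(insert O2 (J - T))" using A by auto
    next
      fix x assume "x \<in> \<Union>(insert O2 (J - T))"
      then consider "x \<in> O2" | B where "B \<in> J" "B \<notin> T" "x \<in> B" by auto
      then show "x \<in> A - \<Union>(insert O1 T)"
      proof cases
        case 1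
        then have "x \<notin> O1" using disj by auto
        moreover have "x \<notin> B" if "B \<in> T" for B using JO(2)[of B] T that 1 by auto
        ultimately show ?thesis using A 1 by auto
      next
        case (2 B)
        then have "x \<notin> O1" using JO(1)[of B] by auto
        moreover have "x \<notin> C" if "C \<in> T" for C using Jdisj[of B C x] T that 2 by auto
        ultimately show ?thesis using A 2 by auto
      qed
    qed
  qed
  \<comment> \<open>An invariant set is a union of cycles; here it contains the cycle O1 of a, not
    the cycle O2 of i, and an arbitrary part of J.\<close>
  have "(\<Sum>X\<in>cut_sets A \<nu>i i a. hurwitz_gamma X \<nu>i * hurwitz_gamma (A - X) \<nu>i) =
    (\<Sum>T\<in>Pow J. hurwitz_gamma (\<Union>(insert O1 T)) \<nu>i * hurwitz_gamma (\<Union>(insert O2 (J - T))) \<nu>i)"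
  proof (rule sum.reindex_bij_witness[of _ "\<lambda>T. \<Union>(insert O1 T)" "\<lambda>X. {B \<in> J. B \<subseteq> X}"])
    fix X assume X: "X \<in> cut_sets A \<nu>i i a"
    have orb: "orbit \<nu>i x \<subseteq> X" if "x \<in> X" for x
    proof
      fix y assume "y \<in> orbit \<nu>i x"
      then show "y \<in> X" by induction (use that X in \<open>auto simp: cut_sets_def\<close>)
    qed
    show eq: "\<Union>(insert O1 {B \<in> J. B \<subseteq> X}) = X"
    proof
      show "\<Union>(insert O1 {B \<in> J. B \<subseteq> X}) \<subseteq> X" using orb[of a] X by (auto simp: cut_sets_def O1_def)
      show "X \<subseteq> \<Union>(insert O1 {B \<in> J. B \<subseteq> X})"
      proof
        fix x assume x: "x \<in> X"
        then have xA: "x \<in> A" using X by (auto simp: cut_sets_def)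
        have xo: "x \<in> orbit \<nu>i x" "orbit \<nu>i x \<in> cyc A \<nu>i"
          using orbit_permutes[OF fin \<nu>i xA] xA by (auto simp: cyc_def)
        have "orbit \<nu>i x \<noteq> O2" using orb[OF x] O2(2) X by (auto simp: cut_sets_def)
        then show "x \<in> \<Union>(insert O1 {B \<in> J. B \<subseteq> X})" using xo orb[OF x] unfolding Ji by blast
      qed
    qed
    show "{B \<in> J. B \<subseteq> X} \<in> Pow J" by auto
    show "hurwitz_gamma (\<Union>(insert O1 {B \<in> J. B \<subseteq> X})) \<nu>i * hurwitz_gamma (\<Union>(insert O2 (J - {B \<in> J. B \<subseteq> X}))) \<nu>i =
      hurwitz_gamma X \<nu>i * hurwitz_gamma (A - X) \<nu>i"
      using comp[of "{B \<in> J. B \<subseteq> X}"] eq by auto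
  next
    fix T assume "T \<in> Pow J"
    then have T: "T \<subseteq> J" by auto
    then have Tc: "insert O1 T \<subseteq> cyc A \<nu>i" using O1 Ji by auto
    show "{B \<in> J. B \<subseteq> \<Union>(insert O1 T)} = T"
    proof (intro equalityI subsetI)
      fix B assume B: "B \<in> {B \<in> J. B \<subseteq> \<Union>(insert O1 T)}"
      then obtain x where x: "x \<in> B" using JO(3)[of B] by auto
      then have "x \<notin> O1" using B JO(1)[of B] by auto
      then obtain C where "C \<in> T" "x \<in> C" using B x by auto
      then show "B \<in> T" using Jdisj[of B C x] B x T by auto
    qed (use T in auto)
    have "i \<notin> \<Union>(insert O1 T)" using iO1(1) JO(2) T O2(2) by auto
    moreover have "\<Union>(insert O1 T) \<subseteq> A" using Union_mono[OF Tc] UA by simp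
    moreover have "a \<in> \<Union>(insert O1 T)" using O1(2) by simp
    ultimately show "\<Union>(insert O1 T) \<in> cut_sets A \<nu>i i a"
      using cyc_Union(2)[OF fin \<nu>i Tc] unfolding cut_sets_def mem_Collect_eq by blast
  qed
  also have "\<dots> = (\<Sum>T\<in>Pow J. - ((-1) ^ (card J + 1 + card A) * (\<Prod>B\<in>J. cyc_weight (card B)) *
      (hcoef card t T * hcoef card (card Oa - t) (J - T))))"
  proof (rule sum.cong[OF refl])
    fix T assume "T \<in> Pow J"
    then have T: "T \<subseteq> J" by auto
    then have Tc: "insert O1 T \<subseteq> cyc A \<nu>i" "insert O2 (J - T) \<subseteq> cyc A \<nu>i" using O1 O2 Ji by auto
    let ?X = "\<Union>(insert O1 T)" and ?Y = "\<Union>(insert O2 (J - T))"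
    have XA: "?X \<subseteq> A" "?Y \<subseteq> A" using Tc UA by auto
    have cA: "card A = card ?X + card ?Y"
    proof -
      have "card ?Y = card A - card ?X"
        unfolding comp[OF T, symmetric] by (rule card_Diff_subset[OF finite_subset[OF XA(1) fin] XA(1)])
      then show ?thesis using card_mono[OF fin XA(1)] by linarith
    qed
    have cJ: "card J = card T + card (J - T)"
      using T finJ card_mono[OF finJ T] finite_subset[OF T finJ] by (simp add: card_Diff_subset)
    have P: "(\<Prod>B\<in>J. cyc_weight (card B)) = (\<Prod>B\<in>J - T. cyc_weight (card B)) * (\<Prod>B\<in>T. cyc_weight (card B))"
      by (rule prod.subset_diff[OF T finJ])
    have "O1 \<notin> T" "O2 \<notin> J - T" using T Ji by auto
    note nin = this
    have h1: "hurwitz_gamma ?X \<nu>i = (-1) ^ (card T + 1 + card ?X) * hcoef card (card O1) T * (\<Prod>B\<in>T. cyc_weight (card B))"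
      by (rule hurwitz_gamma_hcoef[OF fin \<nu>i XA(1) _ cyc_Union(1)[OF fin \<nu>i Tc(1)] nin(1)])
        (rule cyc_Union(2)[OF fin \<nu>i Tc(1)])
    have h2: "hurwitz_gamma ?Y \<nu>i = (-1) ^ (card (J - T) + 1 + card ?Y) * hcoef card (card O2) (J - T) * (\<Prod>B\<in>J - T. cyc_weight (card B))"
      by (rule hurwitz_gamma_hcoef[OF fin \<nu>i XA(2) _ cyc_Union(1)[OF fin \<nu>i Tc(2)] nin(2)])
        (rule cyc_Union(2)[OF fin \<nu>i Tc(2)])
    \<comment> \<open>The sizes of the pieces add up to \<open>card A\<close>, but they have
      \<open>card J + 2\<close> cycles together instead of \<open>card J + 1\<close>.\<close>
    have sgn: "(-1) ^ (card T + 1 + card ?X) * (-1) ^ (card (J - T) + 1 + card ?Y) =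
        - ((-1 :: real) ^ (card J + 1 + card A))"
      unfolding cJ cA by (simp only: power_add) simp
    have "hurwitz_gamma ?X \<nu>i * hurwitz_gamma ?Y \<nu>i =
      ((-1) ^ (card T + 1 + card ?X) * (-1) ^ (card (J - T) + 1 + card ?Y)) * (\<Prod>B\<in>J. cyc_weight (card B)) *
      (hcoef card (card O1) T * hcoef card (card O2) (J - T))"
      unfolding h1 h2 P by (simp only: mult_ac)
    also have "\<dots> = - ((-1) ^ (card J + 1 + card A) * (\<Prod>B\<in>J. cyc_weight (card B)) *
      (hcoef card t T * hcoef card (card Oa - t) (J - T)))"
      unfolding sgn iO1(2) cO by simp
    finally show "hurwitz_gamma ?X \<nu>i * hurwitz_gamma ?Y \<nu>i =
      - ((-1) ^ (card J + 1 + card A) * (\<Prod>B\<in>J. cyc_weight (card B)) *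
      (hcoef card t T * hcoef card (card Oa - t) (J - T)))" .
  qed
  finally show ?thesis by (simp add: Oa_def sum_distrib_left sum_negf)
qed

text \<open>\<open>hcoef_recursion\<close> times the common factor s: points outside the cycle of a
  give joins, points on it give cuts.\<close>

lemma hurwitz_gamma_rec:
  assumes fin: "finite A" and \<nu>: "\<nu> permutes A" and a: "a \<in> A"
  shows "hurwitz_gamma A \<nu> + (\<Sum>i\<in>A - orbit \<nu> a. hurwitz_gamma A (Transposition.transpose i a \<circ> \<nu>)) +
    (\<Sum>i\<in>orbit \<nu> a - {a}. \<Sum>X\<in>cut_sets A (Transposition.transpose i a \<circ> \<nu>) i a.
      hurwitz_gamma X (Transposition.transpose i a \<circ> \<nu>) * hurwitz_gamma (A - X) (Transposition.transpose i a \<circ> \<nu>))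
    = (if A = {a} then 1 else 0)"
proof -
  note p = partition_on_cyc[OF fin \<nu>]
  define Oa where "Oa = orbit \<nu> a"
  define k where "k = card Oa"
  define J where "J = cyc A \<nu> - {Oa}"
  define s where "s = (-1) ^ (card J + 1 + card A) * (\<Prod>B\<in>J. cyc_weight (card B))"
  have finJ: "finite J" using finite_elements[OF fin p] J_def by simp
  have Oa: "Oa \<in> cyc A \<nu>" "a \<in> Oa" "Oa \<subseteq> A" using a orbit_permutes[OF fin \<nu> a] by (auto simp: Oa_def cyc_def)
  have k1: "k \<ge> 1" using Oa fin finite_subset[of Oa A] by (auto simp: k_def Suc_le_eq card_gt_0_iff)
  have "cyc A \<nu> = insert Oa J" "Oa \<notin> J" using Oa by (auto simp: J_def)
  from hurwitz_gamma_hcoef[OF fin \<nu> order.refl _ this] permutes_in_image[OF \<nu>]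
  have 1: "hurwitz_gamma A \<nu> = s * hcoef card k J" by (simp add: s_def k_def)
  have 2: "(\<Sum>i\<in>A - orbit \<nu> a. hurwitz_gamma A (Transposition.transpose i a \<circ> \<nu>)) =
      - (s * (\<Sum>C\<in>J. hcoef card (k + card C) (J - {C}) / central (card C)))"
    using hurwitz_gamma_join_sum[OF fin \<nu> a J_def[unfolded Oa_def]] by (simp only: s_def k_def Oa_def)
  define f where "f i = (\<Sum>X\<in>cut_sets A (Transposition.transpose i a \<circ> \<nu>) i a.
      hurwitz_gamma X (Transposition.transpose i a \<circ> \<nu>) * hurwitz_gamma (A - X) (Transposition.transpose i a \<circ> \<nu>))" for i
  \<comment> \<open>The points of the cycle other than a are numbered by their distance t from a,
    which becomes the length of the piece keeping a.\<close>
  have "(\<Sum>i\<in>orbit \<nu> a - {a}. f i) = (\<Sum>t=1..<k. f ((\<nu> ^^ t) a))"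
  proof -
    note of = orbit_funpow(1,2)[OF fin \<nu> a, folded Oa_def, folded k_def]
    have split: "{..<k} = insert 0 {1..<k}" using k1 by auto
    have ne: "(\<nu> ^^ t) a \<noteq> a" if "t \<in> {1..<k}" for t
      using inj_onD[OF of(2), of t 0] that by auto
    have "Oa = insert a ((\<lambda>t. (\<nu> ^^ t) a) ` {1..<k})" using of(1) unfolding split by simp
    then have "Oa - {a} = (\<lambda>t. (\<nu> ^^ t) a) ` {1..<k}" using ne by auto
    moreover have "inj_on (\<lambda>t. (\<nu> ^^ t) a) {1..<k}" using of(2) by (rule inj_on_subset) auto
    ultimately show ?thesis unfolding Oa_def[symmetric] by (simp add: sum.reindex)
  qed
  also have "\<dots> = (\<Sum>t=1..<k. - (s * (\<Sum>T\<in>Pow J. hcoef card t T * hcoef card (k - t) (J - T))))"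
  proof (rule sum.cong[OF refl])
    fix t assume "t \<in> {1..<k}"
    then have t: "1 \<le> t" "t < card (orbit \<nu> a)" by (auto simp: k_def Oa_def)
    show "f ((\<nu> ^^ t) a) = - (s * (\<Sum>T\<in>Pow J. hcoef card t T * hcoef card (k - t) (J - T)))"
      unfolding f_def s_def k_def Oa_def
      by (rule hurwitz_gamma_cut_sum[OF fin \<nu> a J_def[unfolded Oa_def] t refl refl])
  qed
  also have "\<dots> = - (s * (\<Sum>t=1..<k. \<Sum>T\<in>Pow J. hcoef card t T * hcoef card (k - t) (J - T)))"
    by (simp add: sum_distrib_left sum_negf)
  finally have 3: "(\<Sum>i\<in>orbit \<nu> a - {a}. f i) = - (s * (\<Sum>t=1..<k. \<Sum>T\<in>Pow J. hcoef card t T * hcoef card (k - t) (J - T)))" .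
  have "hurwitz_gamma A \<nu> + (\<Sum>i\<in>A - orbit \<nu> a. hurwitz_gamma A (Transposition.transpose i a \<circ> \<nu>)) + (\<Sum>i\<in>orbit \<nu> a - {a}. f i) =
      s * (if k = 1 \<and> J = {} then 1 else 0)"
    unfolding 1 2 3 hcoef_recursion[OF finJ k1, of card] by (simp only: distrib_left)
  also have "\<dots> = (if A = {a} then 1 else 0)"
  proof (cases "A = {a}")
    case True
    then have "Oa = {a}" using Oa by auto
    then have "k = 1" "J = {}" "card A = 1" using True by (auto simp: k_def J_def cyc_def Oa_def)
    then show ?thesis using True by (simp add: s_def)
  next
    case False
    have nk: "\<not> (k = 1 \<and> J = {})"
    proof
      assume "k = 1 \<and> J = {}"
      then have "Oa = {a}" "cyc A \<nu> = {Oa}"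
        using Oa card_1_singletonE[of Oa] by (auto simp: k_def J_def)
      then show False using False p by (auto simp: partition_on_def)
    qed
    show ?thesis by (simp only: nk False if_False mult_zero_right)
  qed
  finally show ?thesis by (simp only: f_def)
qed


definition gamma_part :: "'a set set \<Rightarrow> ('a \<Rightarrow> 'a) \<Rightarrow> real" where
  "gamma_part P \<nu> = (\<Prod>G\<in>P. hurwitz_gamma G (perm_restrict \<nu> G))"

lemma perm_restrict_invariant:
  assumes "X \<subseteq> G"
  shows "perm_restrict (perm_restrict \<nu> G) X = perm_restrict \<nu> X"
  using assms by (auto simp: perm_restrict_def fun_eq_iff)

text \<open>The limiting form of \<open>wg_cum_rec\<close>: the condition on the cardinalities
  selects the terms of leading order. Only the block G of a is affected, and there the identity is
  \<open>hurwitz_gamma_rec\<close>.\<close>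

lemma gamma_part_rec:
  assumes fin: "finite A" and a: "a \<in> A" and \<nu>: "\<nu> permutes A" and R: "refines A (cyc A \<nu>) R"
  shows "gamma_part R \<nu> + (\<Sum>i\<in>A - {a}. \<Sum>Q | refines A (cyc A (Transposition.transpose i a \<circ> \<nu>)) Q \<and> merge_blocks Q i a = R \<and>
        int (card (cyc A (Transposition.transpose i a \<circ> \<nu>))) - 2 * int (card Q) = int (card (cyc A \<nu>)) - 2 * int (card R) - 1.
        gamma_part Q (Transposition.transpose i a \<circ> \<nu>)) =
    (if {a} \<in> R then gamma_part (R - {{a}}) \<nu> else 0)"
proof -
  define ti where "ti i = Transposition.transpose i a \<circ> \<nu>" for i
  define F where "F i = {Q. refines A (cyc A (ti i)) Q \<and> merge_blocks Q i a = R \<and>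
        int (card (cyc A (ti i))) - 2 * int (card Q) = int (card (cyc A \<nu>)) - 2 * int (card R) - 1}" for i
  have pR: "partition_on A R" using R by (rule refines_partition)
  have \<nu>R: "\<nu> \<in> young A R" using \<nu> R by (simp add: young_def)
  define G where "G = block_of R a"
  have G: "G \<in> R" "a \<in> G" using block_of_in[OF pR a] block_of_self[OF pR a] by (auto simp: G_def)
  have GA: "G \<subseteq> A" using block_subset[OF pR G(1)] .
  have finG: "finite G" using GA fin finite_subset by blast
  have finR: "finite R" using finite_elements[OF fin pR] .
  define p where "p = perm_restrict \<nu> G"
  have p: "p permutes G" unfolding p_def by (rule perm_restrict_block[OF fin pR \<nu>R G(1)])
  have inv: "\<nu> x \<in> H" if "H \<in> R" "x \<in> H" for x H using young_block[OF fin pR \<nu>R that] .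
  have orbp: "orbit p x = orbit \<nu> x" if "x \<in> G" for x
    unfolding p_def by (rule orbit_cong0[OF that]) (use inv[OF G(1)] that p in \<open>auto simp: perm_restrict_def\<close>)
  define rest where "rest = (\<Prod>H\<in>R - {G}. hurwitz_gamma H (perm_restrict \<nu> H))"
  have W: "gamma_part R \<nu> = hurwitz_gamma G p * rest"
    unfolding gamma_part_def rest_def p_def by (rule prod.remove[OF finR G(1)])
  have tp: "perm_restrict (ti i) G = Transposition.transpose i a \<circ> p" if "i \<in> G" for i
    unfolding ti_def p_def by (rule perm_restrict_transpose_same[OF that G(2)]) (rule inv[OF G(1)])
  have other: "perm_restrict (ti i) H = perm_restrict \<nu> H" if "H \<in> R - {G}" "i \<in> G" for i H
    unfolding ti_def
  proof (rule perm_restrict_transpose_other)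
    show "i \<notin> H" "a \<notin> H" using partition_unique[OF pR _ G(1)] that G(2) by blast+
    show "\<nu> x \<in> H" if "x \<in> H" for x using inv[of H x] that \<open>H \<in> R - {G}\<close> by simp
  qed
  have rest: "(\<Prod>H\<in>R - {G}. hurwitz_gamma H (perm_restrict (ti i) H)) = rest" if "i \<in> G" for i
    unfolding rest_def by (rule prod.cong[OF refl]) (simp add: other that)
  have tiA: "ti i permutes A" if "i \<in> A" for i unfolding ti_def by (rule transpose_comp_permutes[OF \<nu> that a])
  have sbG: "same_block R i a \<longleftrightarrow> i \<in> G" for i using same_block_sym[of R a i] by (simp add: G_def block_of_def)
  have Rti: "refines A (cyc A (ti i)) R" if "i \<in> G" for i
    using merge_cyc_transpose[OF fin \<nu> _ a pR, of i] R that GA sbG by (auto simp: ti_def)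
  \<comment> \<open>A merge always joins i and a, which R does not do for i outside G.\<close>
  have outside: "(\<Sum>Q\<in>F i. gamma_part Q (ti i)) = 0" if i: "i \<in> A - G" for i
  proof -
    have "F i = {}"
    proof (rule ccontr)
      assume "F i \<noteq> {}"
      then obtain Q where Q: "partition_on A Q" "merge_blocks Q i a = R" by (auto simp: F_def dest: refines_partition)
      have "same_block R i a" using same_block_merge_self[OF Q(1) _ a, of i] i Q(2) by auto
      then show False using i sbG by auto
    qed
    then show ?thesis by simp
  qed
  \<comment> \<open>After a join the cycles already connect i and a, so merging does nothing and Q =
    R is the only term.\<close>
  have join: "(\<Sum>Q\<in>F i. gamma_part Q (ti i)) = hurwitz_gamma G (Transposition.transpose i a \<circ> p) * rest"
    if i: "i \<in> G - orbit p a" for i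
  proof -
    have iA: "i \<in> A" "i \<noteq> a" using i GA orbit_permutes(1)[OF finG p G(2)] by auto
    have ns: "\<not> same_block (cyc A \<nu>) i a"
      using i orbp[OF G(2)] by (simp add: same_block_sym[of _ i] same_block_cyc[OF fin \<nu>])
    note c = cyc_transpose(1,2)[OF fin \<nu> iA(1) a iA(2), folded ti_def]
    have "F i = {R}"
    proof (intro equalityI subsetI)
      fix Q assume "Q \<in> F i"
      then have Q: "refines A (cyc A (ti i)) Q" "merge_blocks Q i a = R" by (auto simp: F_def)
      then have "same_block Q i a" using c(1) ns refines_same_block by metis
      then show "Q \<in> {R}" using merge_same[OF refines_partition(2)[OF Q(1)] iA(1) a] Q(2) by simp
    next
      fix Q assume "Q \<in> {R}"
      then show "Q \<in> F i"
        using Rti[of i] i merge_same[OF pR iA(1) a] sbG c(2)[OF ns] by (auto simp: F_def)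
    qed
    then have "(\<Sum>Q\<in>F i. gamma_part Q (ti i)) = gamma_part R (ti i)" by simp
    also have "\<dots> = hurwitz_gamma G (perm_restrict (ti i) G) * (\<Prod>H\<in>R - {G}. hurwitz_gamma H (perm_restrict (ti i) H))"
      unfolding gamma_part_def by (rule prod.remove[OF finR G(1)])
    finally show ?thesis using tp rest i by simp
  qed
  have cut: "(\<Sum>Q\<in>F i. gamma_part Q (ti i)) =
      (\<Sum>X\<in>cut_sets G (Transposition.transpose i a \<circ> p) i a.
        hurwitz_gamma X (Transposition.transpose i a \<circ> p) * hurwitz_gamma (G - X) (Transposition.transpose i a \<circ> p)) * rest"
    if i: "i \<in> orbit p a - {a}" for i
  proof -
    have iG: "i \<in> G" "i \<noteq> a" using i orbit_permutes(2)[OF finG p G(2)] by auto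
    then have iA: "i \<in> A" using GA by auto
    define q where "q = Transposition.transpose i a \<circ> p"
    have q: "q permutes G" unfolding q_def by (rule transpose_comp_permutes[OF p iG(1) G(2)])
    have qt: "perm_restrict (ti i) G = q" using tp[OF iG(1)] by (simp add: q_def)
    then have qx: "q x = ti i x" if "x \<in> G" for x using that by (auto simp: perm_restrict_def)
    have sb: "same_block (cyc A \<nu>) i a"
      using i a orbp[OF G(2)] by (simp add: same_block_sym[of _ i] same_block_cyc[OF fin \<nu>])
    note c = cyc_transpose(1,3)[OF fin \<nu> iA a iG(2), folded ti_def]
    \<comment> \<open>A cut adds one cycle, so the condition on the cardinalities says that Q has
      one block more than R, that is, Q separates i from a.\<close>
    have Fi: "Q \<in> F i \<longleftrightarrow> refines A (cyc A (ti i)) Q \<and> merge_blocks Q i a = R \<and> \<not> same_block Q i a" for Q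
    proof -
      have "card Q = card R + 1 \<longleftrightarrow> \<not> same_block Q i a" if Q: "refines A (cyc A (ti i)) Q" "merge_blocks Q i a = R"
      proof (cases "same_block Q i a")
        case True
        then have "Q = R" using merge_same[OF refines_partition(2)[OF Q(1)] iA a] Q(2) by simp
        then show ?thesis using True by simp
      next
        case False
        then show ?thesis using card_merge[OF refines_partition(2)[OF Q(1)] iA a fin] Q(2) by simp
      qed
      moreover have "int (card (cyc A (ti i))) - 2 * int (card Q) = int (card (cyc A \<nu>)) - 2 * int (card R) - 1 \<longleftrightarrow>
          card Q = card R + 1"
        using conjunct2[OF c(2)[OF sb]] by linarith
      ultimately show ?thesis unfolding F_def mem_Collect_eq by blast
    qed
    \<comment> \<open>Splits G into X and its complement; the inverse map takes the block of
      a.\<close>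
    define mk where "mk X = insert X (insert (G - X) (R - {G}))" for X
    have mk: "mk X \<in> F i" "block_of (mk X) a = X"
        "gamma_part (mk X) (ti i) = hurwitz_gamma X q * hurwitz_gamma (G - X) q * rest"
      if X: "X \<in> cut_sets G q i a" for X
    proof -
      have Xs: "X \<subseteq> G" "a \<in> X" "i \<notin> X" "\<And>x. x \<in> X \<Longrightarrow> q x \<in> X" using X by (auto simp: cut_sets_def)
      have finX: "finite X" using Xs(1) finG finite_subset by blast
      have img: "q ` X = X"
      proof (rule endo_inj_surj[OF finX])
        show "q ` X \<subseteq> X" using Xs(4) by auto
        show "inj_on q X" using permutes_inj[OF q] by (rule inj_on_subset) auto
      qed
      have comp: "q x \<in> G - X" if x: "x \<in> G - X" for x
      proof -
        have "q x \<notin> X"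
        proof
          assume "q x \<in> X"
          then obtain y where "y \<in> X" "q x = q y" using img by (metis imageE)
          then show False using x permutes_inj[OF q] by (auto dest: injD)
        qed
        then show ?thesis using x permutes_in_image[OF q] by auto
      qed
      have RG: "H \<inter> G = {}" "H \<noteq> {}" if "H \<in> R - {G}" for H
        using that partition_unique[OF pR _ G(1), of H] partition_onD3[OF pR] by auto
      have ne: "X \<noteq> {}" "G - X \<noteq> {}" using Xs iG by auto
      have nin: "X \<notin> insert (G - X) (R - {G})" "G - X \<notin> R - {G}"
        using RG(1)[of X] RG(1)[of "G - X"] Xs ne by auto
      have UR: "\<Union>R = A" using pR by (simp add: partition_on_def)
      have pm: "partition_on A (mk X)"
      proof (rule partition_onI)
        show "\<Union>(mk X) = A" using UR Xs(1) G(1) by (auto simp: mk_def)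
        show "{} \<notin> mk X" using ne RG(2) by (auto simp: mk_def)
        fix B C assume BC: "B \<in> mk X" "C \<in> mk X" "B \<noteq> C"
        have RR: "B \<inter> C = {}" if "B \<in> R" "C \<in> R" using partition_unique[OF pR that] BC(3) by blast
        have "B \<inter> C = {}"
          using BC RR RG(1) Xs(1) unfolding mk_def by blast
        then show "disjnt B C" by (simp add: disjnt_def)
      qed
      have blocks: "X \<in> mk X" "G - X \<in> mk X" by (auto simp: mk_def)
      show bo: "block_of (mk X) a = X" by (rule block_of_eq[OF pm blocks(1) Xs(2)])
      have nsame: "\<not> same_block (mk X) i a"
        using same_block_iff_mem[OF pm blocks(1) Xs(2), of i] Xs(3) by (simp add: same_block_sym[of _ i])
      have ref: "refines A (cyc A (ti i)) (mk X)"
      proof -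
        have "same_block (mk X) x (ti i x)" if xA: "x \<in> A" for x
        proof (cases "x \<in> G")
          case True
          show ?thesis
          proof (cases "x \<in> X")
            case xX: True
            then have "ti i x \<in> X" using Xs(4)[of x] qx[OF True] by simp
            then show ?thesis unfolding same_block_def using xX by (intro bexI[OF _ blocks(1)]) simp
          next
            case xX: False
            then have "ti i x \<in> G - X" using comp[of x] qx[OF True] True by simp
            then show ?thesis unfolding same_block_def using xX True by (intro bexI[OF _ blocks(2)]) simp
          qed
        next
          case False
          then obtain H where H: "H \<in> R - {G}" "x \<in> H" using xA UR by auto
          have "ti i x = \<nu> x" using other[OF H(1) iG(1)] H(2) by (metis perm_restrict_simps(1))
          then have "ti i x \<in> H" using inv[of H x] H by simp
          moreover have "H \<in> mk X" using H(1) by (simp add: mk_def)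
          ultimately show ?thesis unfolding same_block_def using H(2) by (intro bexI[of _ H]) simp_all
        qed
        then show ?thesis using cyc_refines_iff[OF fin tiA[OF iA] pm] by blast
      qed
      have nia: "i \<notin> H \<and> a \<notin> H" if "H \<in> R - {G}" for H using RG(1)[OF that] iG(1) G(2) by blast
      have "{B \<in> mk X. i \<in> B \<or> a \<in> B} = {X, G - X}"
        unfolding mk_def using nia Xs(2,3) iG(1) by blast
      moreover have "{B \<in> mk X. i \<notin> B \<and> a \<notin> B} = R - {G}"
        unfolding mk_def using nia Xs(2,3) iG(1) by blast
      moreover have "X \<union> (G - X) = G" using Xs(1) by auto
      ultimately have "merge_blocks (mk X) i a = R" using G(1) by (simp add: merge_blocks_def insert_absorb)
      then show "mk X \<in> F i" using Fi ref nsame by simp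
      have "gamma_part (mk X) (ti i) = hurwitz_gamma X (perm_restrict (ti i) X) * hurwitz_gamma (G - X) (perm_restrict (ti i) (G - X)) *
          (\<Prod>H\<in>R - {G}. hurwitz_gamma H (perm_restrict (ti i) H))"
        unfolding gamma_part_def mk_def using nin finR by simp
      moreover have "hurwitz_gamma X (perm_restrict (ti i) X) = hurwitz_gamma X q"
        using perm_restrict_invariant[OF Xs(1), of "ti i"] hurwitz_gamma_restrict[of X q] Xs(4) by (simp add: qt)
      moreover have "hurwitz_gamma (G - X) (perm_restrict (ti i) (G - X)) = hurwitz_gamma (G - X) q"
        using perm_restrict_invariant[of "G - X" G "ti i"] hurwitz_gamma_restrict[of "G - X" q] comp by (simp add: qt)
      ultimately show "gamma_part (mk X) (ti i) = hurwitz_gamma X q * hurwitz_gamma (G - X) q * rest"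
        using rest[OF iG(1)] by simp
    qed
    have unmk: "block_of Q a \<in> cut_sets G q i a" "mk (block_of Q a) = Q" if Q: "Q \<in> F i" for Q
    proof -
      have Qr: "refines A (cyc A (ti i)) Q" "merge_blocks Q i a = R" "\<not> same_block Q i a" using Q Fi by auto
      have pQ: "partition_on A Q" using Qr(1) refines_partition by blast
      obtain X Y where X: "X \<in> Q" "i \<in> X" and Y: "Y \<in> Q" "a \<in> Y" and m: "merge_blocks Q i a = insert (X \<union> Y) (Q - {X, Y})"
        by (rule merge_blocks_eq[OF pQ iA a])
      have XY: "X \<noteq> Y" using Qr(3) X Y by (auto simp: same_block_def)
      then have disj: "X \<inter> Y = {}" using partition_unique[OF pQ X(1) Y(1)] by blast
      have Yb: "block_of Q a = Y" by (rule block_of_eq[OF pQ Y])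
      have GXY: "G = X \<union> Y" unfolding G_def by (rule block_of_eq[OF pR]) (use m Qr(2) Y in auto)
      have "X \<union> Y \<notin> Q - {X, Y}" using partition_unique[OF pQ _ X(1), of "X \<union> Y" i] X(2) by auto
      then have RG: "R - {G} = Q - {X, Y}" using m Qr(2) GXY by auto
      have "G - Y = X" using GXY disj by auto
      then show "mk (block_of Q a) = Q" unfolding mk_def Yb RG using X(1) Y(1) by auto
      have "ti i \<in> young A Q" using tiA[OF iA] Qr(1) by (simp add: young_def)
      then have "ti i x \<in> Y" if "x \<in> Y" for x using young_block[OF fin pQ _ Y(1) that] by blast
      then show "block_of Q a \<in> cut_sets G q i a"
        unfolding Yb cut_sets_def using GXY Y(2) X(2) disj qx by auto
    qed
    have "(\<Sum>Q\<in>F i. gamma_part Q (ti i)) = (\<Sum>X\<in>cut_sets G q i a. hurwitz_gamma X q * hurwitz_gamma (G - X) q * rest)"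
      by (rule sum.reindex_bij_witness[of _ mk "\<lambda>Q. block_of Q a"]) (use mk unmk in \<open>auto simp flip: mk(3)\<close>)
    then show ?thesis by (simp add: q_def sum_distrib_right)
  qed
  define f where "f i = (\<Sum>Q\<in>F i. gamma_part Q (ti i))" for i
  have Gsplit: "A - {a} = (A - G) \<union> ((G - orbit p a) \<union> (orbit p a - {a}))"
    using GA orbit_permutes[OF finG p G(2)] a G(2) by auto
  have "sum f (A - {a}) = sum f (A - G) + (sum f (G - orbit p a) + sum f (orbit p a - {a}))"
    unfolding Gsplit using orbit_permutes[OF finG p G(2)] GA fin finG finite_subset[of "orbit p a" G]
    by (subst sum.union_disjoint; (subst sum.union_disjoint)?) auto
  also have "sum f (A - G) = 0" unfolding f_def using outside by (intro sum.neutral) auto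
  also have "sum f (G - orbit p a) = (\<Sum>i\<in>G - orbit p a. hurwitz_gamma G (Transposition.transpose i a \<circ> p)) * rest"
    unfolding sum_distrib_right f_def by (rule sum.cong[OF refl]) (rule join)
  also have "sum f (orbit p a - {a}) = (\<Sum>i\<in>orbit p a - {a}. \<Sum>X\<in>cut_sets G (Transposition.transpose i a \<circ> p) i a.
        hurwitz_gamma X (Transposition.transpose i a \<circ> p) * hurwitz_gamma (G - X) (Transposition.transpose i a \<circ> p)) * rest"
    unfolding sum_distrib_right[of _ "orbit p a - {a}"] f_def by (rule sum.cong[OF refl]) (rule cut)
  finally have "gamma_part R \<nu> + sum f (A - {a}) = (if G = {a} then 1 else 0) * rest"
    unfolding W hurwitz_gamma_rec[OF finG p G(2), symmetric] by (simp only: distrib_right add_0_left add.assoc)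
  also have "\<dots> = (if {a} \<in> R then gamma_part (R - {{a}}) \<nu> else 0)"
  proof -
    have "G = {a} \<longleftrightarrow> {a} \<in> R" using G partition_unique[OF pR G(1) _ G(2), of "{a}"] by auto
    then show ?thesis by (auto simp: rest_def gamma_part_def)
  qed
  finally show ?thesis unfolding f_def[abs_def] F_def ti_def .
qed


section \<open>Asymptotics of the Weingarten cumulants\<close>

lemma powi_nonpos_tendsto:
  assumes "h \<le> 0"
  shows "(\<lambda>N. real N powi h) \<longlonglongrightarrow> (if h = 0 then 1 else 0)"
proof (cases "h = 0")
  case False
  define m where "m = nat (- h)"
  have m: "h = - int m" "m > 0" using assms False by (auto simp: m_def)
  have "(\<lambda>N. inverse (real N) ^ m) \<longlonglongrightarrow> 0 ^ m" by (intro tendsto_power lim_inverse_n)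
  then show ?thesis using m by (simp add: power_int_minus power_inverse zero_power)
qed simp

lemma sum_pairs_second:
  assumes "finite I" "\<And>Q. Q \<in> S \<Longrightarrow> (Q, v) \<in> I" "\<And>Q. (Q, v) \<in> I \<Longrightarrow> \<Phi> Q \<Longrightarrow> Q \<in> S" "\<And>Q. Q \<in> S \<Longrightarrow> \<Phi> Q"
  shows "(\<Sum>q\<in>I. if snd q = v \<and> \<Phi> (fst q) then g q else 0) = (\<Sum>Q\<in>S. (g (Q, v) :: real))"
proof -
  have "(\<Sum>q\<in>I. if snd q = v \<and> \<Phi> (fst q) then g q else 0) = (\<Sum>q\<in>{q \<in> I. snd q = v \<and> \<Phi> (fst q)}. g q)"
    using assms(1) by (simp add: sum.inter_filter)
  also have "\<dots> = (\<Sum>Q\<in>S. g (Q, v))"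
    by (rule sum.reindex_bij_witness[of _ "\<lambda>Q. (Q, v)" fst]) (use assms in auto)
  finally show ?thesis .
qed

text \<open>The number of points of A is lowered by one in the inhomogeneous term of
  \<open>wg_cum_rec\<close>, to which the induction applies. The other terms form a linear system
  over all pairs (R, \<nu>) on A, whose limit is solved by \<open>gamma_part_rec\<close>.\<close>

lemma wg_cum_limit:
  assumes "finite A" "\<nu> permutes A" "refines A (cyc A \<nu>) R"
  shows "(\<lambda>N. real N powi (2 * int (card A) + int (card (cyc A \<nu>)) - 2 * int (card R)) * wg_cum N A R \<nu>)
    \<longlonglongrightarrow> gamma_part R \<nu>"
  using assms
proof (induction "card A" arbitrary: A \<nu> R)
  case 0
  then have A: "A = {}" "\<nu> = id" by auto
  then have R: "R = {}" using 0 by (auto simp: refines_def partition_on_empty)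
  have c: "cyc {} id = ({} :: 'a set set)" by (simp add: cyc_def)
  have Q: "{Q. refines {} {} Q \<and> refines {} Q {}} = {{} :: 'a set set}" by (auto simp: refines_def partition_on_empty)
  have r: "refines {} {} ({} :: 'a set set)" by (simp add: refines_def partition_on_empty)
  have "part_mobius {} {} ({} :: 'a set set) = 1" using r by (subst part_mobius.simps) simp
  then have w: "wg_cum N {} {} (id :: 'a \<Rightarrow> 'a) = 1" for N by (simp add: wg_cum_def c Q wg_part_def)
  show ?case unfolding A R c w by (simp add: gamma_part_def)
next
  case (Suc n)
  note fin = \<open>finite A\<close>
  obtain a where a: "a \<in> A" using Suc.hyps(2) by (metis card.empty ex_in_conv nat.distinct(1))
  have n: "n = card (A - {a})" "card A = card (A - {a}) + 1" using Suc.hyps(2) a fin by auto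
  have finA': "finite (A - {a})" using fin by simp
  define I where "I = {(R, \<nu>). \<nu> permutes A \<and> refines A (cyc A \<nu>) R}"
  have finI: "finite I"
  proof (rule finite_subset)
    show "I \<subseteq> {P. partition_on A P} \<times> {\<nu>. \<nu> permutes A}" by (auto simp: I_def refines_def)
    show "finite ({P. partition_on A P} \<times> {\<nu>. \<nu> permutes A})"
      using finitely_many_partition_on[OF fin] finite_permutations[OF fin] by simp
  qed
  define ti where "ti i \<nu> = Transposition.transpose i a \<circ> \<nu>" for i and \<nu> :: "'a \<Rightarrow> 'a"
  have tiA: "ti i \<nu> permutes A" if "i \<in> A - {a}" "\<nu> permutes A" for i \<nu>
    unfolding ti_def by (rule transpose_comp_permutes[OF that(2) _ a]) (use that in auto)
  \<comment> \<open>The part of the exponent that varies within the system; it decreases by exactly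
    1 along the coefficients with nonzero limit.\<close>
  define e where "e p = int (card (cyc A (snd p))) - 2 * int (card (fst p))" for p :: "'a set set \<times> ('a \<Rightarrow> 'a)"
  define ex where "ex p = 2 * int (card A) + e p" for p
  define x where "x N p = real N powi ex p * wg_cum N A (fst p) (snd p)" for N p
  define b where "b N p = (if {a} \<in> fst p then
      real N powi (2 * int (card (A - {a})) + int (card (cyc (A - {a}) (snd p))) - 2 * int (card (fst p - {{a}})))
      * wg_cum N (A - {a}) (fst p - {{a}}) (snd p) else 0)" for N p
  define b' where "b' p = (if {a} \<in> fst p then gamma_part (fst p - {{a}}) (snd p) else 0)" for p
  define K where "K N p q = - (\<Sum>i\<in>A - {a}. if snd q = ti i (snd p) \<and> merge_blocks (fst q) i a = fst p
      then real N powi (e p - 1 - e q) else 0)" for N p q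
  define K' where "K' p q = - (\<Sum>i\<in>A - {a}. if snd q = ti i (snd p) \<and> merge_blocks (fst q) i a = fst p
      then (if e p - 1 - e q = 0 then 1 else 0 :: real) else 0)" for p q
  define y where "y p = gamma_part (fst p) (snd p)" for p :: "'a set set \<times> ('a \<Rightarrow> 'a)"
  have fixed: "\<nu> a = a \<and> refines (A - {a}) (cyc (A - {a}) \<nu>) (R - {{a}})"
    if "(R, \<nu>) \<in> I" "{a} \<in> R" for R \<nu>
  proof -
    have R: "\<nu> permutes A" "refines A (cyc A \<nu>) R" using that by (auto simp: I_def)
    note ps = partition_singleton_block[OF refines_partition(2)[OF R(2)] that(2)]
    show ?thesis using cyc_refines_insert_point[OF fin ps(1) a R(1)] R(2) unfolding ps(3) by blast
  qed
  \<comment> \<open>A join lowers #(\<nu>) by 1 and forces Q = R, so the exponent is 0. A cut raises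
    it by 1, and Q has at most one block more than R.\<close>
  have expo: "e (R, \<nu>) - 1 - e (Q, ti i \<nu>) \<le> 0"
    if "(R, \<nu>) \<in> I" "refines A (cyc A (ti i \<nu>)) Q" "i \<in> A - {a}" "merge_blocks Q i a = R" for R \<nu> Q i
  proof -
    have \<nu>: "\<nu> permutes A" and ia: "i \<in> A" "i \<noteq> a" using that by (auto simp: I_def)
    have pQ: "partition_on A Q" using that(2) by (rule refines_partition)
    note c = cyc_transpose[OF fin \<nu> ia(1) a ia(2), folded ti_def]
    have m: "card Q \<le> card R + 1" using card_merge_ge[OF pQ ia(1) a fin] that(4) by simp
    show ?thesis
    proof (cases "same_block (cyc A \<nu>) i a")
      case True
      then show ?thesis using c(3) m by (simp add: e_def)
    next
      case False
      then have "same_block Q i a" using c(1) refines_same_block[OF that(2)] by blast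
      then have "Q = R" using merge_same[OF pQ ia(1) a] that(4) by simp
      then show ?thesis using c(2)[OF False] by (simp add: e_def)
    qed
  qed
  have sub: "(\<Sum>q\<in>I. if snd q = ti i \<nu> \<and> merge_blocks (fst q) i a = R \<and> \<Psi> (fst q) then g q else 0) =
      (\<Sum>Q | refines A (cyc A (ti i \<nu>)) Q \<and> merge_blocks Q i a = R \<and> \<Psi> Q. g (Q, ti i \<nu>))"
    if "(R, \<nu>) \<in> I" "i \<in> A - {a}" for R \<nu> i \<Psi> and g :: "_ \<Rightarrow> real"
    by (rule sum_pairs_second[OF finI, where \<Phi> = "\<lambda>Q. merge_blocks Q i a = R \<and> \<Psi> Q"])
      (use that tiA in \<open>auto simp: I_def\<close>)
  have "(\<lambda>N. x N p) \<longlonglongrightarrow> y p" if p: "p \<in> I" for p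
  proof (rule triangular_system_limit[OF finI, where b = b and b' = b' and K = K and K' = K' and e = e])
    show "\<forall>\<^sub>F N in sequentially. \<forall>p\<in>I. x N p = b N p + (\<Sum>q\<in>I. K N p q * x N q)"
      using eventually_ge_at_top[of "card A"]
    proof eventually_elim
      case (elim N)
      have N0: "real N \<noteq> 0" using elim n(2) by auto
      show ?case
      proof
        fix p assume p: "p \<in> I"
        obtain R \<nu> where p_def: "p = (R, \<nu>)" by (cases p)
        have R: "\<nu> permutes A" "refines A (cyc A \<nu>) R" using p by (auto simp: I_def p_def)
        define S where "S i = {Q. refines A (cyc A (ti i \<nu>)) Q \<and> merge_blocks Q i a = R}" for i
        have "(\<Sum>q\<in>I. K N p q * x N q) = - (\<Sum>i\<in>A - {a}. \<Sum>q\<in>I. if snd q = ti i \<nu> \<and> merge_blocks (fst q) i a = R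
            then real N powi (e p - 1 - e q) * x N q else 0)"
          unfolding K_def p_def sum_negf[symmetric] sum_distrib_right mult_minus_left
          by (subst sum.swap) (auto intro!: sum.cong)
        also have "(\<Sum>i\<in>A - {a}. \<Sum>q\<in>I. if snd q = ti i \<nu> \<and> merge_blocks (fst q) i a = R
            then real N powi (e p - 1 - e q) * x N q else 0) =
            (\<Sum>i\<in>A - {a}. \<Sum>Q\<in>S i. real N powi (e p - 1 - e (Q, ti i \<nu>)) * x N (Q, ti i \<nu>))"
        proof (rule sum.cong[OF refl])
          fix i assume "i \<in> A - {a}"
          from sub[OF p[unfolded p_def] this, of "\<lambda>_. True" "\<lambda>q. real N powi (e p - 1 - e q) * x N q"]
          show "(\<Sum>q\<in>I. if snd q = ti i \<nu> \<and> merge_blocks (fst q) i a = R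
            then real N powi (e p - 1 - e q) * x N q else 0) =
            (\<Sum>Q\<in>S i. real N powi (e p - 1 - e (Q, ti i \<nu>)) * x N (Q, ti i \<nu>))"
            by (simp only: S_def simp_thms)
        qed
        also have "\<dots> = real N powi (ex p - 1) * (\<Sum>i\<in>A - {a}. \<Sum>Q\<in>S i. wg_cum N A Q (ti i \<nu>))"
        proof -
          have "real N powi (e p - 1 - e q) * x N q = real N powi (ex p - 1) * wg_cum N A (fst q) (snd q)" for q
          proof -
            have "real N powi (e p - 1 - e q) * real N powi ex q = real N powi (ex p - 1)"
              using N0 by (simp add: power_int_add[symmetric] ex_def algebra_simps)
            then show ?thesis by (simp add: x_def mult.assoc[symmetric])
          qed
          then show ?thesis by (simp add: sum_distrib_left)
        qed
        finally have KS: "(\<Sum>q\<in>I. K N p q * x N q) =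
          - (real N powi (ex p - 1) * (\<Sum>i\<in>A - {a}. \<Sum>Q\<in>S i. wg_cum N A Q (ti i \<nu>)))" .
        \<comment> \<open>Deleting the fixed point a changes 2 |A|, #(\<nu>) and - 2 #(R) by -2, -1
          and 2, hence the exponent by -1 in total.\<close>
        have B: "b N p = real N powi (ex p - 1) * (if {a} \<in> R then wg_cum N (A - {a}) (R - {{a}}) \<nu> else 0)"
        proof (cases "{a} \<in> R")
          case True
          have f: "\<nu> a = a" using fixed[OF p[unfolded p_def] True] by simp
          have "finite R" using finite_elements[OF fin refines_partition(2)[OF R(2)]] .
          then have "card R = card (R - {{a}}) + 1" using card_Suc_Diff1[of R "{a}"] True by simp
          then have "ex p - 1 = 2 * int (card (A - {a})) + int (card (cyc (A - {a}) \<nu>)) - 2 * int (card (R - {{a}}))"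
            using cyc_del_point(2)[OF fin R(1) a f] n(2) by (simp add: ex_def e_def p_def)
          then show ?thesis using True by (simp add: b_def p_def)
        qed (simp add: b_def p_def)
        have "x N p = real N powi (ex p - 1) * (real N * wg_cum N A R \<nu>)"
          using N0 by (simp add: x_def p_def power_int_diff)
        also have "real N * wg_cum N A R \<nu> = (if {a} \<in> R then wg_cum N (A - {a}) (R - {{a}}) \<nu> else 0)
            - (\<Sum>i\<in>A - {a}. \<Sum>Q\<in>S i. wg_cum N A Q (ti i \<nu>))"
          using wg_cum_rec[OF fin a elim R, folded ti_def] unfolding S_def by linarith
        finally show "x N p = b N p + (\<Sum>q\<in>I. K N p q * x N q)"
          unfolding KS B by (simp only: right_diff_distrib)
      qed
    qed
    show "(\<lambda>N. b N p) \<longlonglongrightarrow> b' p" if p: "p \<in> I" for p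
    proof (cases "{a} \<in> fst p")
      case True
      have f: "snd p a = a \<and> refines (A - {a}) (cyc (A - {a}) (snd p)) (fst p - {{a}})"
        using fixed[of "fst p" "snd p"] p True by simp
      have "snd p permutes A" using p by (auto simp: I_def)
      from permutes_del_point[OF this conjunct1[OF f]] have "snd p permutes (A - {a})" .
      from Suc.hyps(1)[OF n(1) finA' this conjunct2[OF f]] show ?thesis
        unfolding b_def b'_def by (simp only: True if_True)
    qed (simp add: b_def b'_def)
    show "(\<lambda>N. K N p q) \<longlonglongrightarrow> K' p q" if pq: "p \<in> I" "q \<in> I" for p q
      unfolding K_def K'_def
    proof (intro tendsto_minus tendsto_sum)
      fix i assume i: "i \<in> A - {a}"
      show "(\<lambda>N. if snd q = ti i (snd p) \<and> merge_blocks (fst q) i a = fst p then real N powi (e p - 1 - e q) else 0)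
        \<longlonglongrightarrow> (if snd q = ti i (snd p) \<and> merge_blocks (fst q) i a = fst p then (if e p - 1 - e q = 0 then 1 else 0) else 0)"
      proof (cases "snd q = ti i (snd p) \<and> merge_blocks (fst q) i a = fst p")
        case True
        have le: "e p - 1 - e q \<le> 0"
          using expo[of "fst p" "snd p" i "fst q"] pq i True by (cases p; cases q) (auto simp: I_def)
        from powi_nonpos_tendsto[OF le] show ?thesis by (simp only: True if_True simp_thms)
      next
        case False
        show ?thesis by (simp only: False if_False tendsto_const)
      qed
    qed
    show "e q < e p" if "p \<in> I" "q \<in> I" "K' p q \<noteq> 0" for p q
    proof (rule ccontr)
      assume "\<not> e q < e p"
      then have "K' p q = 0" by (auto simp: K'_def intro!: sum.neutral)
      then show False using that by simp
    qed
    show "y p = b' p + (\<Sum>q\<in>I. K' p q * y q)" if p: "p \<in> I" for p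
    proof -
      obtain R \<nu> where p_def: "p = (R, \<nu>)" by (cases p)
      have R: "\<nu> permutes A" "refines A (cyc A \<nu>) R" using p by (auto simp: I_def p_def)
      have "(\<Sum>q\<in>I. K' p q * y q) = - (\<Sum>i\<in>A - {a}. \<Sum>q\<in>I. if snd q = ti i \<nu> \<and> merge_blocks (fst q) i a = R \<and>
          int (card (cyc A (ti i \<nu>))) - 2 * int (card (fst q)) = int (card (cyc A \<nu>)) - 2 * int (card R) - 1 then y q else 0)"
        unfolding K'_def p_def sum_negf[symmetric] sum_distrib_right mult_minus_left
        by (subst sum.swap) (auto intro!: sum.cong simp: e_def)
      also have "(\<Sum>i\<in>A - {a}. \<Sum>q\<in>I. if snd q = ti i \<nu> \<and> merge_blocks (fst q) i a = R \<and>
          int (card (cyc A (ti i \<nu>))) - 2 * int (card (fst q)) = int (card (cyc A \<nu>)) - 2 * int (card R) - 1 then y q else 0) =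
          (\<Sum>i\<in>A - {a}. \<Sum>Q | refines A (cyc A (ti i \<nu>)) Q \<and> merge_blocks Q i a = R \<and>
          int (card (cyc A (ti i \<nu>))) - 2 * int (card Q) = int (card (cyc A \<nu>)) - 2 * int (card R) - 1. y (Q, ti i \<nu>))"
        by (rule sum.cong[OF refl]) (rule sub[OF p[unfolded p_def]])
      finally show ?thesis
        using gamma_part_rec[OF fin a R, folded ti_def] unfolding y_def b'_def p_def fst_conv snd_conv by linarith
    qed
  qed (rule p)
  from this[of "(R, \<nu>)"] Suc.prems show ?case
    by (simp add: I_def x_def y_def ex_def e_def algebra_simps)
qed


section \<open>Exact inversion in finite dimension\<close>

lemma cyc_comp_refines:
  assumes "finite A" "\<sigma> permutes A" "\<tau> permutes A" "refines A (cyc A \<sigma>) P" "refines A (cyc A \<tau>) P"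
  shows "refines A (cyc A (\<sigma> \<circ> perm_inv \<tau>)) P"
proof -
  have "\<sigma> \<in> young A P" "perm_inv \<tau> \<in> young A P"
    using assms young_inv[OF assms(1), of \<tau> P] by (auto simp: young_def)
  then have "\<sigma> \<circ> perm_inv \<tau> \<in> young A P"
    using young_comp[OF assms(1) refines_partition(2)[OF assms(4)]] by blast
  then show ?thesis by (simp add: young_def)
qed

text \<open>Moebius inversion that starts at S instead of the cycles of \<nu>. Summed over T in
  [S, P], both sides give \<open>wg_part\<close> at P: on the right each R below P is counted once,
  under its join with S.\<close>

lemma wg_join_sum:
  assumes fin: "finite A" and S: "refines A (cyc A \<nu>) S" and T: "refines A S T"
  shows "(\<Sum>Q | refines A S Q \<and> refines A Q T. of_int (part_mobius A Q T) * wg_part N Q \<nu>) =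
    (\<Sum>R | refines A (cyc A \<nu>) R \<and> part_join S R = T. wg_cum N A R \<nu>)"
proof -
  define g where "g P = (\<Sum>Q | refines A S Q \<and> refines A Q P. of_int (part_mobius A Q P) * wg_part N Q \<nu>)" for P
  define h where "h P = (\<Sum>R | refines A (cyc A \<nu>) R \<and> part_join S R = P. wg_cum N A R \<nu>)" for P
  have pS: "partition_on A S" using S by (rule refines_partition)
  have "g T = h T"
  proof (rule interval_sums_unique[OF fin _ T])
    fix P assume SP: "refines A S P"
    have "(\<Sum>Q | refines A S Q \<and> refines A Q P. g Q) = wg_part N P \<nu>"
      unfolding g_def by (rule mobius_inversion[OF fin SP])
    also have "\<dots> = (\<Sum>R | refines A (cyc A \<nu>) R \<and> refines A R P. wg_cum N A R \<nu>)"
      by (rule wg_cum_sum[symmetric, OF fin refines_trans[OF S SP]])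
    also have "\<dots> = (\<Sum>Q | refines A S Q \<and> refines A Q P. h Q)"
    proof -
      have "(\<Sum>Q | refines A S Q \<and> refines A Q P. h Q) =
        (\<Sum>Q | refines A S Q \<and> refines A Q P. \<Sum>R\<in>{R \<in> {R. refines A (cyc A \<nu>) R \<and> refines A R P}. part_join S R = Q}. wg_cum N A R \<nu>)"
      proof (rule sum.cong[OF refl])
        fix Q assume "Q \<in> {Q. refines A S Q \<and> refines A Q P}"
        then have "{R. refines A (cyc A \<nu>) R \<and> part_join S R = Q} =
            {R \<in> {R. refines A (cyc A \<nu>) R \<and> refines A R P}. part_join S R = Q}"
          using refines_part_join(2)[OF pS refines_partition(2)] refines_trans by blast
        then show "h Q = (\<Sum>R\<in>{R \<in> {R. refines A (cyc A \<nu>) R \<and> refines A R P}. part_join S R = Q}. wg_cum N A R \<nu>)"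
          by (simp only: h_def)
      qed
      also have "\<dots> = (\<Sum>R | refines A (cyc A \<nu>) R \<and> refines A R P. wg_cum N A R \<nu>)"
      proof (rule sum.group)
        show "part_join S ` {R. refines A (cyc A \<nu>) R \<and> refines A R P} \<subseteq> {Q. refines A S Q \<and> refines A Q P}"
          using refines_part_join(1)[OF pS refines_partition(2)] part_join_least[OF SP] by blast
      qed (rule finite_refines_between[OF fin])+
      finally show ?thesis by simp
    qed
    finally show "(\<Sum>Q | refines A S Q \<and> refines A Q P. g Q) = (\<Sum>Q | refines A S Q \<and> refines A Q P. h Q)" .
  qed
  then show ?thesis by (simp only: g_def h_def)
qed

text \<open>The formula for the cumulants with arbitrary moments \<phi>, so that the inversion is
  purely algebraic.\<close>

definition kappa :: "nat \<Rightarrow> 'a set \<Rightarrow> ('a set set \<Rightarrow> ('a \<Rightarrow> 'a) \<Rightarrow> complex) \<Rightarrow> 'a set set \<Rightarrow> ('a \<Rightarrow> 'a) \<Rightarrow> complex" where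
  "kappa N A \<phi> P \<sigma> = (\<Sum>\<tau> | \<tau> permutes A. \<Sum>Q | refines A (cyc A \<tau>) Q \<and> refines A Q P. \<phi> Q \<tau> *
    (\<Sum>R | refines A (part_join (cyc A \<sigma>) Q) R \<and> refines A R P.
      of_int (part_mobius A R P) * of_real (wg_part N R (\<sigma> \<circ> perm_inv \<tau>))))"

lemma kappa_eq_wg_cum:
  assumes fin: "finite A" and \<sigma>: "\<sigma> permutes A" and P: "refines A (cyc A \<sigma>) P"
  shows "kappa N A \<phi> P \<sigma> = (\<Sum>\<tau> | \<tau> permutes A. \<Sum>Q | refines A (cyc A \<tau>) Q \<and> refines A Q P.
    \<Sum>R | refines A (cyc A (\<sigma> \<circ> perm_inv \<tau>)) R \<and> part_join (part_join Q (cyc A \<sigma>)) R = P.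
      \<phi> Q \<tau> * of_real (wg_cum N A R (\<sigma> \<circ> perm_inv \<tau>)))"
  unfolding kappa_def
proof (intro sum.cong[OF refl])
  fix \<tau> Q assume \<tau>: "\<tau> \<in> {\<tau>. \<tau> permutes A}" and Q: "Q \<in> {Q. refines A (cyc A \<tau>) Q \<and> refines A Q P}"
  have pQ: "partition_on A Q" using Q refines_partition by blast
  have pc: "partition_on A (cyc A \<sigma>)" using partition_on_cyc[OF fin \<sigma>] .
  let ?S = "part_join Q (cyc A \<sigma>)"
  have S: "part_join (cyc A \<sigma>) Q = ?S" by (rule part_join_commute[OF pc pQ])
  have 1: "refines A (cyc A (\<sigma> \<circ> perm_inv \<tau>)) ?S"
    using cyc_comp_refines[OF fin \<sigma>, of \<tau> ?S] \<tau> Q refines_part_join[OF pQ pc] refines_trans by blast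
  have 2: "refines A ?S P" using part_join_least Q P by blast
  have "(\<Sum>R | refines A ?S R \<and> refines A R P.
      of_int (part_mobius A R P) * complex_of_real (wg_part N R (\<sigma> \<circ> perm_inv \<tau>))) =
    of_real (\<Sum>R | refines A ?S R \<and> refines A R P. of_int (part_mobius A R P) * wg_part N R (\<sigma> \<circ> perm_inv \<tau>))"
    by simp
  also have "\<dots> = of_real (\<Sum>R | refines A (cyc A (\<sigma> \<circ> perm_inv \<tau>)) R \<and> part_join ?S R = P. wg_cum N A R (\<sigma> \<circ> perm_inv \<tau>))"
    by (simp only: wg_join_sum[OF fin 1 2])
  finally show "\<phi> Q \<tau> * (\<Sum>R | refines A (part_join (cyc A \<sigma>) Q) R \<and> refines A R P.
      of_int (part_mobius A R P) * of_real (wg_part N R (\<sigma> \<circ> perm_inv \<tau>))) =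
    (\<Sum>R | refines A (cyc A (\<sigma> \<circ> perm_inv \<tau>)) R \<and> part_join ?S R = P.
      \<phi> Q \<tau> * of_real (wg_cum N A R (\<sigma> \<circ> perm_inv \<tau>)))"
    unfolding S by (simp add: sum_distrib_left)
qed

text \<open>Exchanging sums exhibits the cumulant as a Moebius transform; summing over lower
  partitions undoes it. What remains is a convolution on the Young subgroup of P, as other \<tau>
  admit no Q between their cycles and P.\<close>

lemma kappa_sum:
  assumes fin: "finite A" and \<sigma>: "\<sigma> permutes A" and P: "refines A (cyc A \<sigma>) P"
  shows "(\<Sum>R | refines A (cyc A \<sigma>) R \<and> refines A R P. kappa N A \<phi> R \<sigma>) =
    (\<Sum>\<tau>\<in>young A P. (\<Sum>Q | refines A (cyc A \<tau>) Q \<and> refines A Q P. \<phi> Q \<tau>) * of_real (wg_part N P (\<sigma> \<circ> perm_inv \<tau>)))"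
proof -
  define f where "f R = (\<Sum>\<tau> | \<tau> permutes A. \<Sum>Q | refines A (cyc A \<tau>) Q \<and> refines A Q R.
      \<phi> Q \<tau> * of_real (wg_part N R (\<sigma> \<circ> perm_inv \<tau>)))" for R
  have pc: "partition_on A (cyc A \<sigma>)" using partition_on_cyc[OF fin \<sigma>] .
  have finI: "finite {Q. refines A L Q \<and> refines A Q R}" for L R by (rule finite_refines_between[OF fin])
  have "kappa N A \<phi> R \<sigma> = (\<Sum>Q | refines A (cyc A \<sigma>) Q \<and> refines A Q R. of_int (part_mobius A Q R) * f Q)" for R
  proof -
    have inner: "(\<Sum>Q | refines A (cyc A \<tau>) Q \<and> refines A Q R. \<phi> Q \<tau> *
        (\<Sum>S | refines A (part_join (cyc A \<sigma>) Q) S \<and> refines A S R.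
          of_int (part_mobius A S R) * of_real (wg_part N S (\<sigma> \<circ> perm_inv \<tau>)))) =
      (\<Sum>S | refines A (cyc A \<sigma>) S \<and> refines A S R. \<Sum>Q | refines A (cyc A \<tau>) Q \<and> refines A Q S.
        of_int (part_mobius A S R) * (\<phi> Q \<tau> * of_real (wg_part N S (\<sigma> \<circ> perm_inv \<tau>))))"
      if \<tau>: "\<tau> permutes A" for \<tau>
    proof -
      let ?g = "\<lambda>Q S. of_int (part_mobius A S R) * (\<phi> Q \<tau> * complex_of_real (wg_part N S (\<sigma> \<circ> perm_inv \<tau>)))"
      have "(\<Sum>Q | refines A (cyc A \<tau>) Q \<and> refines A Q R. \<phi> Q \<tau> *
        (\<Sum>S | refines A (part_join (cyc A \<sigma>) Q) S \<and> refines A S R.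
          of_int (part_mobius A S R) * of_real (wg_part N S (\<sigma> \<circ> perm_inv \<tau>)))) =
        (\<Sum>Q | refines A (cyc A \<tau>) Q \<and> refines A Q R.
          \<Sum>S\<in>{S \<in> {S. refines A (cyc A \<sigma>) S \<and> refines A S R}. refines A Q S}. ?g Q S)"
      proof (rule sum.cong[OF refl])
        fix Q assume "Q \<in> {Q. refines A (cyc A \<tau>) Q \<and> refines A Q R}"
        then have pQ: "partition_on A Q" using refines_partition by blast
        have "{S. refines A (part_join (cyc A \<sigma>) Q) S \<and> refines A S R} =
            {S \<in> {S. refines A (cyc A \<sigma>) S \<and> refines A S R}. refines A Q S}"
          unfolding part_join_refines_iff[OF pc pQ] by blast
        then show "\<phi> Q \<tau> * (\<Sum>S | refines A (part_join (cyc A \<sigma>) Q) S \<and> refines A S R.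
          of_int (part_mobius A S R) * of_real (wg_part N S (\<sigma> \<circ> perm_inv \<tau>))) =
          (\<Sum>S\<in>{S \<in> {S. refines A (cyc A \<sigma>) S \<and> refines A S R}. refines A Q S}. ?g Q S)"
          by (simp only: sum_distrib_left mult.left_commute)
      qed
      also have "\<dots> = (\<Sum>S | refines A (cyc A \<sigma>) S \<and> refines A S R.
          \<Sum>Q\<in>{Q \<in> {Q. refines A (cyc A \<tau>) Q \<and> refines A Q R}. refines A Q S}. ?g Q S)"
        by (rule sum.swap_restrict[OF finI finI])
      also have "\<dots> = (\<Sum>S | refines A (cyc A \<sigma>) S \<and> refines A S R. \<Sum>Q | refines A (cyc A \<tau>) Q \<and> refines A Q S. ?g Q S)"
      proof (rule sum.cong[OF refl])
        fix S assume "S \<in> {S. refines A (cyc A \<sigma>) S \<and> refines A S R}"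
        then have "{Q \<in> {Q. refines A (cyc A \<tau>) Q \<and> refines A Q R}. refines A Q S} =
            {Q. refines A (cyc A \<tau>) Q \<and> refines A Q S}" using refines_trans by blast
        then show "(\<Sum>Q\<in>{Q \<in> {Q. refines A (cyc A \<tau>) Q \<and> refines A Q R}. refines A Q S}. ?g Q S) =
          (\<Sum>Q | refines A (cyc A \<tau>) Q \<and> refines A Q S. ?g Q S)" by (simp only:)
      qed
      finally show ?thesis .
    qed
    have "kappa N A \<phi> R \<sigma> = (\<Sum>\<tau> | \<tau> permutes A. \<Sum>S | refines A (cyc A \<sigma>) S \<and> refines A S R.
        \<Sum>Q | refines A (cyc A \<tau>) Q \<and> refines A Q S.
        of_int (part_mobius A S R) * (\<phi> Q \<tau> * of_real (wg_part N S (\<sigma> \<circ> perm_inv \<tau>))))"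
      unfolding kappa_def by (rule sum.cong[OF refl]) (rule inner, simp)
    also have "\<dots> = (\<Sum>S | refines A (cyc A \<sigma>) S \<and> refines A S R. of_int (part_mobius A S R) * f S)"
      unfolding f_def sum_distrib_left by (rule sum.swap)
    finally show ?thesis .
  qed
  then have "(\<Sum>R | refines A (cyc A \<sigma>) R \<and> refines A R P. kappa N A \<phi> R \<sigma>) = f P"
    using mobius_inversion[OF fin P, of f] by simp
  also have "f P = (\<Sum>\<tau> | \<tau> permutes A. if refines A (cyc A \<tau>) P then
      (\<Sum>Q | refines A (cyc A \<tau>) Q \<and> refines A Q P. \<phi> Q \<tau>) * of_real (wg_part N P (\<sigma> \<circ> perm_inv \<tau>)) else 0)"
    unfolding f_def
  proof (rule sum.cong[OF refl])
    fix \<tau>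
    show "(\<Sum>Q | refines A (cyc A \<tau>) Q \<and> refines A Q P. \<phi> Q \<tau> * of_real (wg_part N P (\<sigma> \<circ> perm_inv \<tau>))) =
      (if refines A (cyc A \<tau>) P then
      (\<Sum>Q | refines A (cyc A \<tau>) Q \<and> refines A Q P. \<phi> Q \<tau>) * of_real (wg_part N P (\<sigma> \<circ> perm_inv \<tau>)) else 0)"
    proof (cases "refines A (cyc A \<tau>) P")
      case False
      then have "{Q. refines A (cyc A \<tau>) Q \<and> refines A Q P} = {}" using refines_trans by blast
      then show ?thesis using False by (simp only: sum.empty if_False)
    qed (simp add: sum_distrib_right)
  qed
  also have "\<dots> = (\<Sum>\<tau>\<in>young A P. (\<Sum>Q | refines A (cyc A \<tau>) Q \<and> refines A Q P. \<phi> Q \<tau>) * of_real (wg_part N P (\<sigma> \<circ> perm_inv \<tau>)))"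
  proof -
    have "young A P = {\<tau> \<in> {\<tau>. \<tau> permutes A}. refines A (cyc A \<tau>) P}" by (auto simp: young_def)
    then show ?thesis using finite_permutations[OF fin] by (simp only: sum.inter_filter)
  qed
  finally show ?thesis .
qed

text \<open>Again both sides are summed over the partitions below some R. The condition on the join
  then only groups the Q below R, \<open>kappa_sum\<close> applies, and the factor N^# cancels the
  Weingarten functions on the Young subgroup of R.\<close>

lemma moment_kappa_exact:
  assumes fin: "finite A" and N: "card A \<le> N" and \<sigma>: "\<sigma> permutes A" and P: "refines A (cyc A \<sigma>) P"
  shows "\<phi> P \<sigma> = (\<Sum>\<tau> | \<tau> permutes A.
    \<Sum>Q | refines A (cyc A \<tau>) Q \<and> refines A Q P \<and> part_join Q (cyc A \<sigma>) = P.
      of_nat N ^ card (cyc A (\<sigma> \<circ> perm_inv \<tau>)) * kappa N A \<phi> Q \<tau>)"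
proof -
  let ?Z = "\<lambda>\<nu>. (of_nat N :: complex) ^ card (cyc A \<nu>)"
  define h where "h P = (\<Sum>\<tau> | \<tau> permutes A.
    \<Sum>Q | refines A (cyc A \<tau>) Q \<and> refines A Q P \<and> part_join Q (cyc A \<sigma>) = P.
      ?Z (\<sigma> \<circ> perm_inv \<tau>) * kappa N A \<phi> Q \<tau>)" for P
  have pc: "partition_on A (cyc A \<sigma>)" using partition_on_cyc[OF fin \<sigma>] .
  have "\<phi> P \<sigma> = h P"
  proof (rule interval_sums_unique[OF fin _ P, where g = "\<lambda>P. \<phi> P \<sigma>"])
    fix R assume R: "refines A (cyc A \<sigma>) R"
    have pR: "partition_on A R" using R by (rule refines_partition)
    have \<sigma>R: "\<sigma> \<in> young A R" using \<sigma> R by (simp add: young_def)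
    define \<Phi> where "\<Phi> \<mu> = (\<Sum>Q | refines A (cyc A \<mu>) Q \<and> refines A Q R. \<phi> Q \<mu>)" for \<mu>
    let ?I = "{Q. refines A (cyc A \<sigma>) Q \<and> refines A Q R}"
    have "(\<Sum>P\<in>?I. h P) = (\<Sum>\<tau> | \<tau> permutes A. \<Sum>P\<in>?I.
        \<Sum>Q | refines A (cyc A \<tau>) Q \<and> refines A Q P \<and> part_join Q (cyc A \<sigma>) = P. ?Z (\<sigma> \<circ> perm_inv \<tau>) * kappa N A \<phi> Q \<tau>)"
      unfolding h_def by (rule sum.swap)
    also have "\<dots> = (\<Sum>\<tau> | \<tau> permutes A. \<Sum>Q | refines A (cyc A \<tau>) Q \<and> refines A Q R. ?Z (\<sigma> \<circ> perm_inv \<tau>) * kappa N A \<phi> Q \<tau>)"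
    proof (rule sum.cong[OF refl])
      fix \<tau>
      have "(\<Sum>P\<in>?I. \<Sum>Q | refines A (cyc A \<tau>) Q \<and> refines A Q P \<and> part_join Q (cyc A \<sigma>) = P. ?Z (\<sigma> \<circ> perm_inv \<tau>) * kappa N A \<phi> Q \<tau>)
        = (\<Sum>P\<in>?I. \<Sum>Q\<in>{Q \<in> {Q. refines A (cyc A \<tau>) Q \<and> refines A Q R}. part_join Q (cyc A \<sigma>) = P}. ?Z (\<sigma> \<circ> perm_inv \<tau>) * kappa N A \<phi> Q \<tau>)"
      proof (rule sum.cong[OF refl])
        fix P assume PI: "P \<in> ?I"
        have "{Q. refines A (cyc A \<tau>) Q \<and> refines A Q P \<and> part_join Q (cyc A \<sigma>) = P} =
          {Q \<in> {Q. refines A (cyc A \<tau>) Q \<and> refines A Q R}. part_join Q (cyc A \<sigma>) = P}"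
          using PI refines_part_join(1)[OF refines_partition(2) pc] refines_trans by blast
        then show "(\<Sum>Q | refines A (cyc A \<tau>) Q \<and> refines A Q P \<and> part_join Q (cyc A \<sigma>) = P. ?Z (\<sigma> \<circ> perm_inv \<tau>) * kappa N A \<phi> Q \<tau>)
          = (\<Sum>Q\<in>{Q \<in> {Q. refines A (cyc A \<tau>) Q \<and> refines A Q R}. part_join Q (cyc A \<sigma>) = P}. ?Z (\<sigma> \<circ> perm_inv \<tau>) * kappa N A \<phi> Q \<tau>)"
          by (simp only:)
      qed
      also have "\<dots> = (\<Sum>Q | refines A (cyc A \<tau>) Q \<and> refines A Q R. ?Z (\<sigma> \<circ> perm_inv \<tau>) * kappa N A \<phi> Q \<tau>)"
      proof (rule sum.group)
        show "(\<lambda>Q. part_join Q (cyc A \<sigma>)) ` {Q. refines A (cyc A \<tau>) Q \<and> refines A Q R} \<subseteq> ?I"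
          using refines_part_join(2)[OF refines_partition(2) pc] part_join_least[OF _ R] by blast
      qed (rule finite_refines_between[OF fin])+
      finally show "(\<Sum>P\<in>?I. \<Sum>Q | refines A (cyc A \<tau>) Q \<and> refines A Q P \<and> part_join Q (cyc A \<sigma>) = P. ?Z (\<sigma> \<circ> perm_inv \<tau>) * kappa N A \<phi> Q \<tau>)
        = (\<Sum>Q | refines A (cyc A \<tau>) Q \<and> refines A Q R. ?Z (\<sigma> \<circ> perm_inv \<tau>) * kappa N A \<phi> Q \<tau>)" .
    qed
    also have "\<dots> = (\<Sum>\<tau> | \<tau> permutes A. if refines A (cyc A \<tau>) R then ?Z (\<sigma> \<circ> perm_inv \<tau>) *
        (\<Sum>\<mu>\<in>young A R. \<Phi> \<mu> * of_real (wg_part N R (\<tau> \<circ> perm_inv \<mu>))) else 0)"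
    proof (rule sum.cong[OF refl])
      fix \<tau> assume \<tau>: "\<tau> \<in> {\<tau>. \<tau> permutes A}"
      show "(\<Sum>Q | refines A (cyc A \<tau>) Q \<and> refines A Q R. ?Z (\<sigma> \<circ> perm_inv \<tau>) * kappa N A \<phi> Q \<tau>) =
        (if refines A (cyc A \<tau>) R then ?Z (\<sigma> \<circ> perm_inv \<tau>) *
        (\<Sum>\<mu>\<in>young A R. \<Phi> \<mu> * of_real (wg_part N R (\<tau> \<circ> perm_inv \<mu>))) else 0)"
      proof (cases "refines A (cyc A \<tau>) R")
        case True
        then show ?thesis using kappa_sum[OF fin _ True, of N \<phi>] \<tau>
          by (simp add: sum_distrib_left[symmetric] \<Phi>_def)
      next
        case False
        then have "{Q. refines A (cyc A \<tau>) Q \<and> refines A Q R} = {}" using refines_trans by blast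
        then show ?thesis using False by (simp only: sum.empty if_False)
      qed
    qed
    also have "\<dots> = (\<Sum>\<tau>\<in>young A R. ?Z (\<sigma> \<circ> perm_inv \<tau>) *
        (\<Sum>\<mu>\<in>young A R. \<Phi> \<mu> * of_real (wg_part N R (\<tau> \<circ> perm_inv \<mu>))))"
    proof -
      have "young A R = {\<tau> \<in> {\<tau>. \<tau> permutes A}. refines A (cyc A \<tau>) R}" by (auto simp: young_def)
      then show ?thesis using finite_permutations[OF fin] by (simp only: sum.inter_filter)
    qed
    also have "\<dots> = (\<Sum>\<mu>\<in>young A R. \<Phi> \<mu> *
        (\<Sum>\<tau>\<in>young A R. ?Z (\<sigma> \<circ> perm_inv \<tau>) * of_real (wg_part N R (\<tau> \<circ> perm_inv \<mu>))))"
      unfolding sum_distrib_left by (subst sum.swap) (simp only: mult.left_commute)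
    \<comment> \<open>The substitution \<beta> = \<tau> \<sigma>^(-1) brings the inner sum into the
      form of \<open>wg_part_inverse\<close>, using that N^# is invariant under inversion.\<close>
    also have "\<dots> = (\<Sum>\<mu>\<in>young A R. if \<mu> = \<sigma> then \<Phi> \<sigma> else 0)"
    proof (rule sum.cong[OF refl])
      fix \<mu> assume \<mu>R: "\<mu> \<in> young A R"
      then have \<mu>: "\<mu> permutes A" by (simp add: young_def)
      let ?\<nu> = "\<sigma> \<circ> perm_inv \<mu>"
      have \<nu>: "?\<nu> \<in> young A R" using young_comp[OF fin pR \<sigma>R young_inv[OF fin \<mu>R]] .
      have "(\<Sum>\<tau>\<in>young A R. ?Z (\<sigma> \<circ> perm_inv \<tau>) * of_real (wg_part N R (\<tau> \<circ> perm_inv \<mu>))) =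
        (\<Sum>\<beta>\<in>young A R. ?Z \<beta> * of_real (wg_part N R (\<beta> \<circ> ?\<nu>)))"
      proof (rule sum.reindex_bij_witness[of _ "\<lambda>\<beta>. \<beta> \<circ> \<sigma>" "\<lambda>\<tau>. \<tau> \<circ> perm_inv \<sigma>"])
        fix \<tau> assume \<tau>R: "\<tau> \<in> young A R"
        then have \<tau>: "\<tau> permutes A" by (simp add: young_def)
        show "\<tau> \<circ> perm_inv \<sigma> \<circ> \<sigma> = \<tau>" "\<tau> \<circ> \<sigma> \<circ> perm_inv \<sigma> = \<tau>"
          using permutes_inv_o[OF \<sigma>] by (simp_all add: comp_assoc)
        show "\<tau> \<circ> perm_inv \<sigma> \<in> young A R" "\<tau> \<circ> \<sigma> \<in> young A R"
          using young_comp[OF fin pR \<tau>R] young_inv[OF fin \<sigma>R] \<sigma>R by auto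
        have "perm_inv (\<tau> \<circ> perm_inv \<sigma>) = \<sigma> \<circ> perm_inv \<tau>"
          using permutes_bij[OF \<tau>] permutes_bij[OF permutes_inv[OF \<sigma>]] permutes_inv_inv[OF \<sigma>]
          by (simp add: o_inv_distrib)
        moreover have "cyc A (perm_inv (\<tau> \<circ> perm_inv \<sigma>)) = cyc A (\<tau> \<circ> perm_inv \<sigma>)"
          by (rule cyc_inv[OF fin permutes_compose[OF permutes_inv[OF \<sigma>] \<tau>]])
        moreover have "\<tau> \<circ> perm_inv \<sigma> \<circ> ?\<nu> = \<tau> \<circ> perm_inv \<mu>"
          using permutes_inv_o(2)[OF \<sigma>] by (metis comp_assoc comp_id)
        ultimately show "?Z (\<tau> \<circ> perm_inv \<sigma>) * of_real (wg_part N R (\<tau> \<circ> perm_inv \<sigma> \<circ> ?\<nu>)) =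
          ?Z (\<sigma> \<circ> perm_inv \<tau>) * of_real (wg_part N R (\<tau> \<circ> perm_inv \<mu>))" by simp
      qed
      also have "\<dots> = of_real (\<Sum>\<beta>\<in>young A R. real N ^ card (cyc A \<beta>) * wg_part N R (\<beta> \<circ> ?\<nu>))" by simp
      also have "\<dots> = of_real (if ?\<nu> = id then 1 else 0)" by (simp only: wg_part_inverse[OF fin pR N \<nu>])
      also have "?\<nu> = id \<longleftrightarrow> \<mu> = \<sigma>"
      proof
        assume "?\<nu> = id"
        then have "?\<nu> \<circ> \<mu> = \<mu>" by simp
        then show "\<mu> = \<sigma>" using permutes_inv_o(2)[OF \<mu>] by (simp add: comp_assoc)
      qed (use permutes_inv_o(1)[OF \<sigma>] in simp)
      finally have e: "(\<Sum>\<tau>\<in>young A R. ?Z (\<sigma> \<circ> perm_inv \<tau>) * of_real (wg_part N R (\<tau> \<circ> perm_inv \<mu>))) =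
        of_real (if \<mu> = \<sigma> then 1 else 0)" .
      show "\<Phi> \<mu> * (\<Sum>\<tau>\<in>young A R. ?Z (\<sigma> \<circ> perm_inv \<tau>) * of_real (wg_part N R (\<tau> \<circ> perm_inv \<mu>))) =
        (if \<mu> = \<sigma> then \<Phi> \<sigma> else 0)" unfolding e by simp
    qed
    also have "\<dots> = \<Phi> \<sigma>" using finite_young[OF fin] \<sigma>R by simp
    finally show "(\<Sum>P\<in>?I. \<phi> P \<sigma>) = (\<Sum>P\<in>?I. h P)" by (simp only: \<Phi>_def)
  qed
  then show ?thesis by (simp only: h_def)
qed


section \<open>Scaling exponents and limits\<close>

context
  fixes A :: "'a set" and \<sigma> \<tau> :: "'a \<Rightarrow> 'a" and Q :: "'a set set"
  assumes fin: "finite A" and \<sigma>: "\<sigma> permutes A" and \<tau>: "\<tau> permutes A" and Q: "refines A (cyc A \<tau>) Q"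
begin

lemma genus_eq:
  "2 * genus A \<sigma> (perm_inv \<tau>) = real_of_int (2 * int (card (part_join (cyc A \<sigma>) (cyc A \<tau>))) - int (card (cyc A \<sigma>))
    - int (card (cyc A \<tau>)) - int (card (cyc A (\<sigma> \<circ> perm_inv \<tau>))) + int (card A))"
  by (simp add: genus_def cyc_inv[OF fin \<tau>])

lemma genus_nonneg: "genus A \<sigma> (perm_inv \<tau>) \<ge> 0"
proof -
  have "int (card (cyc A \<sigma>)) + int (card (cyc A \<tau>)) + int (card (cyc A (\<sigma> \<circ> perm_inv \<tau>)))
    \<le> int (card A) + 2 * int (card (part_join (cyc A \<sigma>) (cyc A \<tau>)))"
    using genus_inequality[OF fin \<sigma> order.refl permutes_inv[OF \<tau>]] cyc_inv[OF fin \<tau>] by simp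
  then have "2 * genus A \<sigma> (perm_inv \<tau>) \<ge> 0" unfolding genus_eq by linarith
  then show ?thesis by simp
qed

text \<open>Q lies above the cycles of \<tau>. This makes the joins occurring in L and in the
  exponents agree.\<close>

lemma part_join_cyc: "part_join Q (part_join (cyc A \<sigma>) (cyc A \<tau>)) = part_join Q (cyc A \<sigma>)"
proof -
  have p: "partition_on A Q" "partition_on A (cyc A \<sigma>)" "partition_on A (cyc A \<tau>)"
    using refines_partition[OF Q] partition_on_cyc[OF fin \<sigma>] by auto
  show ?thesis
    using refines_trans[OF Q] p
    by (intro refines_eqI[of A]) (auto simp: partition_on_part_join part_join_refines_iff[of A])
qed

lemma part_L_cyc_nonneg: "part_L Q (part_join (cyc A \<sigma>) (cyc A \<tau>)) (cyc A \<tau>) \<ge> 0"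
  using part_L_nonneg[OF fin Q refines_part_join(2)[OF partition_on_cyc[OF fin \<sigma>] partition_on_cyc[OF fin \<tau>]]]
  by (simp add: part_L_def)

text \<open>The exponent h equals - 2 g - 2 L, with both terms nonnegative; it vanishes exactly on
  the index set of the first formula.\<close>

lemma moment_exponent:
  fixes P
  assumes "part_join Q (cyc A \<sigma>) = P"
  defines "h \<equiv> int (card (cyc A \<sigma>)) - 2 * int (card P) + int (card (cyc A (\<sigma> \<circ> perm_inv \<tau>)))
    - (int (card (cyc A \<tau>)) + int (card A) - 2 * int (card Q))"
  shows "h \<le> 0" "h = 0 \<longleftrightarrow> genus A \<sigma> (perm_inv \<tau>) = 0 \<and>
    part_L Q (part_join (cyc A \<sigma>) (cyc A \<tau>)) (cyc A \<tau>) = 0"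
proof -
  define L where "L = part_L Q (part_join (cyc A \<sigma>) (cyc A \<tau>)) (cyc A \<tau>)"
  have L0: "L \<ge> 0" unfolding L_def by (rule part_L_cyc_nonneg)
  have "real_of_int h = - (2 * genus A \<sigma> (perm_inv \<tau>)) - 2 * real_of_int L"
    unfolding genus_eq h_def L_def part_L_def part_join_cyc assms(1) by simp
  with L0 genus_nonneg show "h \<le> 0" "h = 0 \<longleftrightarrow> genus A \<sigma> (perm_inv \<tau>) = 0 \<and>
    part_L Q (part_join (cyc A \<sigma>) (cyc A \<tau>)) (cyc A \<tau>) = 0"
    unfolding L_def[symmetric] by linarith+
qed

text \<open>Here h equals - 2 g - 2 L - 2 L', where the last term comes from joining R to the join
  of Q with the cycles of \<sigma>.\<close>

lemma cumulant_exponent: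
  fixes P R
  assumes R: "refines A (cyc A (\<sigma> \<circ> perm_inv \<tau>)) R" and P: "part_join (part_join Q (cyc A \<sigma>)) R = P"
  defines "h \<equiv> int (card (cyc A \<sigma>)) + int (card A) - 2 * int (card P) - (int (card (cyc A \<tau>)) - 2 * int (card Q))
    - (2 * int (card A) + int (card (cyc A (\<sigma> \<circ> perm_inv \<tau>))) - 2 * int (card R))"
  shows "h \<le> 0" "h = 0 \<longleftrightarrow> genus A \<sigma> (perm_inv \<tau>) = 0 \<and>
    part_L Q (part_join (cyc A \<sigma>) (cyc A \<tau>)) (cyc A \<tau>) = 0 \<and>
    part_L R (part_join Q (cyc A \<sigma>)) (cyc A (\<sigma> \<circ> perm_inv \<tau>)) = 0"
proof -
  have p: "partition_on A Q" "partition_on A (cyc A \<sigma>)" "partition_on A R"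
    using refines_partition[OF Q] partition_on_cyc[OF fin \<sigma>] refines_partition[OF R] by auto
  let ?S = "part_join Q (cyc A \<sigma>)"
  have S: "refines A (cyc A (\<sigma> \<circ> perm_inv \<tau>)) ?S"
    by (rule cyc_comp_refines[OF fin \<sigma> \<tau> refines_part_join(2)[OF p(1,2)] refines_trans[OF Q refines_part_join(1)[OF p(1,2)]]])
  define L where "L = part_L Q (part_join (cyc A \<sigma>) (cyc A \<tau>)) (cyc A \<tau>)"
  define L' where "L' = part_L R ?S (cyc A (\<sigma> \<circ> perm_inv \<tau>))"
  have L0: "L \<ge> 0" unfolding L_def by (rule part_L_cyc_nonneg)
  have L'0: "L' \<ge> 0" using part_L_nonneg[OF fin R S] by (simp add: L'_def part_L_def)
  have c: "part_join R ?S = P" using P part_join_commute[OF p(3) partition_on_part_join[OF p(1,2)]] by simp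
  have "real_of_int h = - (2 * genus A \<sigma> (perm_inv \<tau>)) - 2 * real_of_int L - 2 * real_of_int L'"
    unfolding genus_eq h_def L_def L'_def part_L_def part_join_cyc c by simp
  with L0 L'0 genus_nonneg show "h \<le> 0" "h = 0 \<longleftrightarrow> genus A \<sigma> (perm_inv \<tau>) = 0 \<and>
    part_L Q (part_join (cyc A \<sigma>) (cyc A \<tau>)) (cyc A \<tau>) = 0 \<and>
    part_L R (part_join Q (cyc A \<sigma>)) (cyc A (\<sigma> \<circ> perm_inv \<tau>)) = 0"
    unfolding L_def[symmetric] L'_def[symmetric] by linarith+
qed

end

lemma of_nat_powi: "(of_nat N :: complex) powi h = of_real (real N powi h)"
  by simp

lemma sum_Collect_conj:
  assumes "finite {x. P x}"
  shows "(\<Sum>x | P x \<and> C x. f x) = (\<Sum>x | P x. if C x then f x else 0)"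
  using sum.inter_filter[OF assms, of f C] by simp

lemma cumulant_eq_kappa:
  "cumulant n M N B P \<sigma> = kappa N {1..n} (\<lambda>Q \<tau>. moment M N B Q \<tau>) P \<sigma>"
  by (simp add: cumulant_def kappa_def wg_part_def)

lemma tendsto_of_real_powi:
  assumes "h \<le> 0" "h = 0 \<longleftrightarrow> C"
  shows "(\<lambda>N. complex_of_real (real N powi h)) \<longlonglongrightarrow> (if C then 1 else 0)"
  using tendsto_of_real[OF powi_nonpos_tendsto[OF assms(1)], where 'a = complex] assms(2) by (simp add: if_distrib cong: if_cong)

lemma scaled_cumulant_tendsto:
  fixes M :: "nat \<Rightarrow> 'w measure"
  defines "A \<equiv> \<lambda>n. {1..n :: nat}"
  assumes limits_exist: "\<And>\<tau> \<rho>. \<tau> permutes A n \<Longrightarrow> refines (A n) (cyc (A n) \<tau>) \<rho> \<Longrightarrow>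
      convergent (scaled_moment n M B \<rho> \<tau>)"
    and \<sigma>: "\<sigma> permutes A n" and P: "refines (A n) (cyc (A n) \<sigma>) P"
  shows "scaled_cumulant n M B P \<sigma> \<longlonglongrightarrow>
      (\<Sum>\<tau> | \<tau> permutes A n \<and> genus (A n) \<sigma> (perm_inv \<tau>) = 0.
        \<Sum>Q | refines (A n) (cyc (A n) \<tau>) Q \<and> refines (A n) Q P \<and>
            part_L Q (part_join (cyc (A n) \<sigma>) (cyc (A n) \<tau>)) (cyc (A n) \<tau>) = 0.
          limit_moment n M B Q \<tau> *
          of_real (Gamma_coeff (A n) (\<sigma> \<circ> perm_inv \<tau>) P (part_join Q (cyc (A n) \<sigma>))))"
proof -
  let ?A = "A n"
  have fin: "finite ?A" and cA: "card ?A = n" by (simp_all add: A_def)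
  define h where "h \<tau> Q R = int (card (cyc ?A \<sigma>)) + int (card ?A) - 2 * int (card P) - (int (card (cyc ?A \<tau>)) - 2 * int (card Q))
    - (2 * int (card ?A) + int (card (cyc ?A (\<sigma> \<circ> perm_inv \<tau>))) - 2 * int (card R))" for \<tau> and Q R :: "nat set set"
  define c where "c N \<tau> R = real N powi (2 * int (card ?A) + int (card (cyc ?A (\<sigma> \<circ> perm_inv \<tau>))) - 2 * int (card R))
    * wg_cum N ?A R (\<sigma> \<circ> perm_inv \<tau>)" for N \<tau> R
  define G where "G \<tau> \<longleftrightarrow> genus ?A \<sigma> (perm_inv \<tau>) = 0" for \<tau>
  define L where "L \<tau> Q \<longleftrightarrow> part_L Q (part_join (cyc ?A \<sigma>) (cyc ?A \<tau>)) (cyc ?A \<tau>) = 0" for \<tau> Q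
  define L' where "L' \<tau> Q R \<longleftrightarrow> part_L R (part_join Q (cyc ?A \<sigma>)) (cyc ?A (\<sigma> \<circ> perm_inv \<tau>)) = 0" for \<tau> Q R
  let ?R = "\<lambda>\<tau> Q. {R. refines ?A (cyc ?A (\<sigma> \<circ> perm_inv \<tau>)) R \<and> part_join (part_join Q (cyc ?A \<sigma>)) R = P}"
  let ?Q = "\<lambda>\<tau>. {Q. refines ?A (cyc ?A \<tau>) Q \<and> refines ?A Q P}"
  define T where "T \<tau> Q R = limit_moment n M B Q \<tau> * (if G \<tau> \<and> L \<tau> Q \<and> L' \<tau> Q R then 1 else 0)
     * of_real (gamma_part R (\<sigma> \<circ> perm_inv \<tau>))" for \<tau> Q R
  \<comment> \<open>Each term is split into a scaled moment, a scaled Weingarten cumulant and the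
    excess power of N with exponent h; combining powers uses N > 0.\<close>
  have "eventually (\<lambda>N. (\<Sum>\<tau> | \<tau> permutes ?A. \<Sum>Q\<in>?Q \<tau>. \<Sum>R\<in>?R \<tau> Q.
      scaled_moment n M B Q \<tau> N * of_real (real N powi (h \<tau> Q R)) * of_real (c N \<tau> R)) = scaled_cumulant n M B P \<sigma> N) sequentially"
    using eventually_gt_at_top[of 0]
  proof eventually_elim
    case (elim N)
    then have N0: "real N \<noteq> 0" by simp
    have t: "scaled_moment n M B Q \<tau> N * of_real (real N powi (h \<tau> Q R)) * of_real (c N \<tau> R) =
      of_real (real N powi (int (card (cyc ?A \<sigma>)) + int n - 2 * int (card P))) *
        (moment (M N) N (B N) Q \<tau> * of_real (wg_cum N ?A R (\<sigma> \<circ> perm_inv \<tau>)))" for \<tau> Q R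
    proof -
      have "real N powi (int (card (cyc ?A \<tau>)) - 2 * int (card Q)) * real N powi (h \<tau> Q R) *
          real N powi (2 * int (card ?A) + int (card (cyc ?A (\<sigma> \<circ> perm_inv \<tau>))) - 2 * int (card R))
        = real N powi (int (card (cyc ?A \<sigma>)) + int n - 2 * int (card P))"
        unfolding power_int_add[OF disjI1[OF N0], symmetric] by (rule arg_cong[of _ _ "power_int (real N)"]) (simp add: h_def cA)
      then show ?thesis
        unfolding scaled_moment_def A_def[symmetric] of_nat_powi c_def of_real_mult
        by (simp only: of_real_mult[symmetric] mult_ac)
    qed
    show ?case
      unfolding t scaled_cumulant_def cumulant_eq_kappa A_def[symmetric] kappa_eq_wg_cum[OF fin \<sigma> P] of_nat_powi
      by (simp only: sum_distrib_left)
  qed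
  moreover have "(\<lambda>N. \<Sum>\<tau> | \<tau> permutes ?A. \<Sum>Q\<in>?Q \<tau>. \<Sum>R\<in>?R \<tau> Q.
      scaled_moment n M B Q \<tau> N * of_real (real N powi (h \<tau> Q R)) * of_real (c N \<tau> R)) \<longlonglongrightarrow>
    (\<Sum>\<tau> | \<tau> permutes ?A. \<Sum>Q\<in>?Q \<tau>. \<Sum>R\<in>?R \<tau> Q. T \<tau> Q R)"
  proof (intro tendsto_sum)
    fix \<tau> Q R assume a: "\<tau> \<in> {\<tau>. \<tau> permutes ?A}" "Q \<in> ?Q \<tau>" "R \<in> ?R \<tau> Q"
    then have \<tau>: "\<tau> permutes ?A" and Q: "refines ?A (cyc ?A \<tau>) Q" and R: "refines ?A (cyc ?A (\<sigma> \<circ> perm_inv \<tau>)) R"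
      and J: "part_join (part_join Q (cyc ?A \<sigma>)) R = P" by auto
    have "\<sigma> \<circ> perm_inv \<tau> permutes ?A" using permutes_compose[OF permutes_inv[OF \<tau>] \<sigma>] .
    from wg_cum_limit[OF fin this R] have "(\<lambda>N. c N \<tau> R) \<longlonglongrightarrow> gamma_part R (\<sigma> \<circ> perm_inv \<tau>)" by (simp only: c_def)
    moreover have "scaled_moment n M B Q \<tau> \<longlonglongrightarrow> limit_moment n M B Q \<tau>"
      using limits_exist[OF \<tau> Q] by (simp add: limit_moment_def convergent_LIMSEQ_iff)
    moreover have "(\<lambda>N. complex_of_real (real N powi (h \<tau> Q R))) \<longlonglongrightarrow> (if G \<tau> \<and> L \<tau> Q \<and> L' \<tau> Q R then 1 else 0)"
      unfolding h_def G_def L_def L'_def by (rule tendsto_of_real_powi; rule cumulant_exponent[OF fin \<sigma> \<tau> Q R J])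
    ultimately show "(\<lambda>N. scaled_moment n M B Q \<tau> N * of_real (real N powi (h \<tau> Q R)) * of_real (c N \<tau> R)) \<longlonglongrightarrow> T \<tau> Q R"
      unfolding T_def by (intro tendsto_mult tendsto_of_real)
  qed
  ultimately have lim: "scaled_cumulant n M B P \<sigma> \<longlonglongrightarrow> (\<Sum>\<tau> | \<tau> permutes ?A. \<Sum>Q\<in>?Q \<tau>. \<Sum>R\<in>?R \<tau> Q. T \<tau> Q R)"
    by (rule Lim_transform_eventually[rotated])
  \<comment> \<open>Of the sum over R the terms with L' = 0 survive, and they make up the
    coefficient \<Gamma>.\<close>
  have inner: "(\<Sum>R\<in>?R \<tau> Q. T \<tau> Q R) = (if G \<tau> \<and> L \<tau> Q then limit_moment n M B Q \<tau> *
      of_real (Gamma_coeff ?A (\<sigma> \<circ> perm_inv \<tau>) P (part_join Q (cyc ?A \<sigma>))) else 0)" for \<tau> Q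
  proof -
    have "Gamma_coeff ?A (\<sigma> \<circ> perm_inv \<tau>) P (part_join Q (cyc ?A \<sigma>)) =
      (\<Sum>R\<in>?R \<tau> Q. if L' \<tau> Q R then gamma_part R (\<sigma> \<circ> perm_inv \<tau>) else 0)"
      unfolding Gamma_coeff_def gamma_part_def[symmetric] L'_def
      by (subst sum_Collect_conj[symmetric, OF finite_refines_between(1)[OF fin]]) (simp only: conj_assoc)
    then show ?thesis by (auto simp: T_def sum_distrib_left intro!: sum.cong)
  qed
  have "(\<Sum>\<tau> | \<tau> permutes ?A. \<Sum>Q\<in>?Q \<tau>. \<Sum>R\<in>?R \<tau> Q. T \<tau> Q R) =
    (\<Sum>\<tau> | \<tau> permutes ?A. if G \<tau> then \<Sum>Q\<in>?Q \<tau>. if L \<tau> Q then limit_moment n M B Q \<tau> *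
      of_real (Gamma_coeff ?A (\<sigma> \<circ> perm_inv \<tau>) P (part_join Q (cyc ?A \<sigma>))) else 0 else 0)"
    unfolding inner by (rule sum.cong[OF refl]) (auto intro!: sum.cong)
  also have "\<dots> = (\<Sum>\<tau> | \<tau> permutes ?A \<and> G \<tau>. \<Sum>Q\<in>?Q \<tau>. if L \<tau> Q then limit_moment n M B Q \<tau> *
      of_real (Gamma_coeff ?A (\<sigma> \<circ> perm_inv \<tau>) P (part_join Q (cyc ?A \<sigma>))) else 0)"
    by (rule sum_Collect_conj[symmetric]) (rule finite_permutations[OF fin])
  also have "\<dots> = (\<Sum>\<tau> | \<tau> permutes ?A \<and> G \<tau>. \<Sum>Q | (refines ?A (cyc ?A \<tau>) Q \<and> refines ?A Q P) \<and> L \<tau> Q.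
      limit_moment n M B Q \<tau> * of_real (Gamma_coeff ?A (\<sigma> \<circ> perm_inv \<tau>) P (part_join Q (cyc ?A \<sigma>))))"
    by (rule sum.cong[OF refl], rule sum_Collect_conj[symmetric]) (rule finite_refines_between[OF fin])
  finally show ?thesis using lim unfolding G_def L_def conj_assoc by simp
qed

theorem theorem3p1:
  fixes n :: nat
    and M :: "nat \<Rightarrow> 'w measure"
    and B :: "nat \<Rightarrow> nat \<Rightarrow> 'w \<Rightarrow> complex mat"
    and \<sigma> :: "nat \<Rightarrow> nat"
    and \<pi> :: "nat set set"
  assumes "\<And>N. prob_space (M N)"
    and "\<And>N j. j \<in> {1..n} \<Longrightarrow> random_matrix (M N) N (B N j)"
    and moments_exist: "\<And>N \<tau> \<C>. \<tau> permutes {1..n} \<Longrightarrow> \<C> \<subseteq> cyc {1..n} \<tau> \<Longrightarrow>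
      integrable (M N) (\<lambda>\<omega>. \<Prod>C\<in>\<C>. cycle_trace N (\<lambda>j. B N j \<omega>) \<tau> C)"
    and limits_exist: "\<And>\<tau> \<rho>. \<tau> permutes {1..n} \<Longrightarrow> refines {1..n} (cyc {1..n} \<tau>) \<rho> \<Longrightarrow>
      convergent (scaled_moment n M B \<rho> \<tau>)"
    and "\<sigma> permutes {1..n}"
    and "refines {1..n} (cyc {1..n} \<sigma>) \<pi>"
  shows "limit_moment n M B \<pi> \<sigma> =
      (\<Sum>\<tau> | \<tau> permutes {1..n} \<and> genus {1..n} \<sigma> (perm_inv \<tau>) = 0.
        \<Sum>\<pi>' | refines {1..n} (cyc {1..n} \<tau>) \<pi>' \<and> refines {1..n} \<pi>' \<pi> \<and>
            part_join \<pi>' (cyc {1..n} \<sigma>) = \<pi> \<and>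
            part_L \<pi>' (part_join (cyc {1..n} \<sigma>) (cyc {1..n} \<tau>)) (cyc {1..n} \<tau>) = 0.
          free_cumulant n M B \<pi>' \<tau>)
    \<and> convergent (scaled_cumulant n M B \<pi> \<sigma>)
    \<and> free_cumulant n M B \<pi> \<sigma> =
      (\<Sum>\<tau> | \<tau> permutes {1..n} \<and> genus {1..n} \<sigma> (perm_inv \<tau>) = 0.
        \<Sum>\<pi>' | refines {1..n} (cyc {1..n} \<tau>) \<pi>' \<and> refines {1..n} \<pi>' \<pi> \<and>
            part_L \<pi>' (part_join (cyc {1..n} \<sigma>) (cyc {1..n} \<tau>)) (cyc {1..n} \<tau>) = 0.
          limit_moment n M B \<pi>' \<tau> *
          of_real (Gamma_coeff {1..n} (\<sigma> \<circ> perm_inv \<tau>) \<pi> (part_join \<pi>' (cyc {1..n} \<sigma>))))"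
proof (intro conjI)
  note cumulant_lim = scaled_cumulant_tendsto[OF limits_exist]
  note lim = cumulant_lim[OF _ _ assms(5,6)]
  from lim show "convergent (scaled_cumulant n M B \<pi> \<sigma>)" by (rule convergentI)
  from lim show "free_cumulant n M B \<pi> \<sigma> =
      (\<Sum>\<tau> | \<tau> permutes {1..n} \<and> genus {1..n} \<sigma> (perm_inv \<tau>) = 0.
        \<Sum>\<pi>' | refines {1..n} (cyc {1..n} \<tau>) \<pi>' \<and> refines {1..n} \<pi>' \<pi> \<and>
            part_L \<pi>' (part_join (cyc {1..n} \<sigma>) (cyc {1..n} \<tau>)) (cyc {1..n} \<tau>) = 0.
          limit_moment n M B \<pi>' \<tau> *
          of_real (Gamma_coeff {1..n} (\<sigma> \<circ> perm_inv \<tau>) \<pi> (part_join \<pi>' (cyc {1..n} \<sigma>))))"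
    unfolding free_cumulant_def by (rule limI)
  define A where "A = {1..n}"
  note \<sigma> = assms(5)[folded A_def] and \<pi> = assms(6)[folded A_def]
  have fin: "finite A" and cA: "card A = n" by (simp_all add: A_def)
  \<comment> \<open>The second formula, applied to every pair (Q, \<tau>), yields the convergence of
    all the cumulants that occur in the first one.\<close>
  have free: "scaled_cumulant n M B Q \<tau> \<longlonglongrightarrow> free_cumulant n M B Q \<tau>"
    if "\<tau> permutes A" "refines A (cyc A \<tau>) Q" for \<tau> Q
    unfolding free_cumulant_def convergent_LIMSEQ_iff[symmetric]
    by (rule convergentI, rule cumulant_lim[OF _ _ that[unfolded A_def]])
  define h where "h \<tau> Q = int (card (cyc A \<sigma>)) - 2 * int (card \<pi>) + int (card (cyc A (\<sigma> \<circ> perm_inv \<tau>)))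
    - (int (card (cyc A \<tau>)) + int (card A) - 2 * int (card Q))" for \<tau> and Q :: "nat set set"
  define G where "G \<tau> \<longleftrightarrow> genus A \<sigma> (perm_inv \<tau>) = 0" for \<tau>
  define L where "L \<tau> Q \<longleftrightarrow> part_L Q (part_join (cyc A \<sigma>) (cyc A \<tau>)) (cyc A \<tau>) = 0" for \<tau> Q
  let ?Q = "\<lambda>\<tau>. {Q. refines A (cyc A \<tau>) Q \<and> refines A Q \<pi> \<and> part_join Q (cyc A \<sigma>) = \<pi>}"
  have "eventually (\<lambda>N. (\<Sum>\<tau> | \<tau> permutes A. \<Sum>Q\<in>?Q \<tau>.
      of_real (real N powi (h \<tau> Q)) * scaled_cumulant n M B Q \<tau> N) = scaled_moment n M B \<pi> \<sigma> N) sequentially"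
    \<comment> \<open>N > n ensures N \<ge> n for the exact inversion, and N \<noteq> 0.\<close>
    using eventually_gt_at_top[of n]
  proof eventually_elim
    case (elim N)
    then have N0: "real N \<noteq> 0" and N: "card A \<le> N" using cA by auto
    have t: "of_real (real N powi (h \<tau> Q)) * scaled_cumulant n M B Q \<tau> N =
      of_real (real N powi (int (card (cyc A \<sigma>)) - 2 * int (card \<pi>))) *
      (of_nat N ^ card (cyc A (\<sigma> \<circ> perm_inv \<tau>)) * kappa N A (\<lambda>Q \<tau>. moment (M N) N (B N) Q \<tau>) Q \<tau>)" for \<tau> Q
    proof -
      have "real N powi (h \<tau> Q) * real N powi (int (card (cyc A \<tau>)) + int n - 2 * int (card Q)) =
        real N powi (int (card (cyc A \<sigma>)) - 2 * int (card \<pi>)) * real N powi int (card (cyc A (\<sigma> \<circ> perm_inv \<tau>)))"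
        unfolding power_int_add[OF disjI1[OF N0], symmetric] by (rule arg_cong[of _ _ "power_int (real N)"]) (simp add: h_def cA)
      then have "complex_of_real (real N powi (h \<tau> Q)) * of_real (real N powi (int (card (cyc A \<tau>)) + int n - 2 * int (card Q))) =
        of_real (real N powi (int (card (cyc A \<sigma>)) - 2 * int (card \<pi>))) * of_nat N ^ card (cyc A (\<sigma> \<circ> perm_inv \<tau>))"
        unfolding of_real_mult[symmetric] by (simp only:) simp
      then show ?thesis
        unfolding scaled_cumulant_def cumulant_eq_kappa A_def[symmetric] of_nat_powi by (simp only: mult.assoc[symmetric])
    qed
    show ?case
      unfolding t scaled_moment_def A_def[symmetric] of_nat_powi
      by (subst moment_kappa_exact[OF fin N \<sigma> \<pi>, of "\<lambda>Q \<tau>. moment (M N) N (B N) Q \<tau>"]) (simp only: sum_distrib_left)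
  qed
  moreover have "(\<lambda>N. \<Sum>\<tau> | \<tau> permutes A. \<Sum>Q\<in>?Q \<tau>. of_real (real N powi (h \<tau> Q)) * scaled_cumulant n M B Q \<tau> N)
      \<longlonglongrightarrow> (\<Sum>\<tau> | \<tau> permutes A. \<Sum>Q\<in>?Q \<tau>. (if G \<tau> \<and> L \<tau> Q then 1 else 0) * free_cumulant n M B Q \<tau>)"
  proof (intro tendsto_sum)
    fix \<tau> Q assume "\<tau> \<in> {\<tau>. \<tau> permutes A}" "Q \<in> ?Q \<tau>"
    then have \<tau>: "\<tau> permutes A" and Q: "refines A (cyc A \<tau>) Q" and J: "part_join Q (cyc A \<sigma>) = \<pi>" by auto
    have "(\<lambda>N. complex_of_real (real N powi (h \<tau> Q))) \<longlonglongrightarrow> (if G \<tau> \<and> L \<tau> Q then 1 else 0)"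
      unfolding h_def G_def L_def by (rule tendsto_of_real_powi; rule moment_exponent[OF fin \<sigma> \<tau> Q J])
    then show "(\<lambda>N. of_real (real N powi (h \<tau> Q)) * scaled_cumulant n M B Q \<tau> N) \<longlonglongrightarrow>
        (if G \<tau> \<and> L \<tau> Q then 1 else 0) * free_cumulant n M B Q \<tau>"
      by (intro tendsto_mult free[OF \<tau> Q])
  qed
  ultimately have "scaled_moment n M B \<pi> \<sigma> \<longlonglongrightarrow>
      (\<Sum>\<tau> | \<tau> permutes A. \<Sum>Q\<in>?Q \<tau>. (if G \<tau> \<and> L \<tau> Q then 1 else 0) * free_cumulant n M B Q \<tau>)"
    by (rule Lim_transform_eventually[rotated])
  then have "limit_moment n M B \<pi> \<sigma> =
      (\<Sum>\<tau> | \<tau> permutes A. \<Sum>Q\<in>?Q \<tau>. (if G \<tau> \<and> L \<tau> Q then 1 else 0) * free_cumulant n M B Q \<tau>)"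
    unfolding limit_moment_def by (rule limI)
  also have "\<dots> = (\<Sum>\<tau> | \<tau> permutes A. if G \<tau> then \<Sum>Q\<in>?Q \<tau>. if L \<tau> Q then free_cumulant n M B Q \<tau> else 0 else 0)"
    by (rule sum.cong[OF refl]) (auto intro!: sum.cong)
  also have "\<dots> = (\<Sum>\<tau> | \<tau> permutes A \<and> G \<tau>. \<Sum>Q\<in>?Q \<tau>. if L \<tau> Q then free_cumulant n M B Q \<tau> else 0)"
    by (rule sum_Collect_conj[symmetric]) (rule finite_permutations[OF fin])
  also have "\<dots> = (\<Sum>\<tau> | \<tau> permutes A \<and> G \<tau>.
      \<Sum>Q | (refines A (cyc A \<tau>) Q \<and> refines A Q \<pi> \<and> part_join Q (cyc A \<sigma>) = \<pi>) \<and> L \<tau> Q. free_cumulant n M B Q \<tau>)"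
    by (rule sum.cong[OF refl], rule sum_Collect_conj[symmetric]) (rule finite_refines_between[OF fin])
  finally show "limit_moment n M B \<pi> \<sigma> =
      (\<Sum>\<tau> | \<tau> permutes {1..n} \<and> genus {1..n} \<sigma> (perm_inv \<tau>) = 0.
        \<Sum>\<pi>' | refines {1..n} (cyc {1..n} \<tau>) \<pi>' \<and> refines {1..n} \<pi>' \<pi> \<and>
            part_join \<pi>' (cyc {1..n} \<sigma>) = \<pi> \<and>
            part_L \<pi>' (part_join (cyc {1..n} \<sigma>) (cyc {1..n} \<tau>)) (cyc {1..n} \<tau>) = 0.
          free_cumulant n M B \<pi>' \<tau>)"
    unfolding G_def L_def A_def conj_assoc .
qed

end
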